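(* Let $\mathbf X\in\mathbb R^{n\times d}$ with $r=\mathrm{rank}(\mathbf X)$, $\mathbf y\in\mathbb R^n$, and let $h_\lambda:\mathbb R^d\to\mathbb R$ be Fréchet subdifferentiable. Suppose $0<\varepsilon<\varepsilon_0<1$, where $\varepsilon_0$ is a small positive constant, $\delta\in(0,1)$, and $\mathbf P$ is drawn from an $(\varepsilon,\delta)$ oblivious $\ell^2$-subspace embedding over $\tilde n\times n$ matrices; put $\tilde{\mathbf X}=\mathbf P\mathbf X$. Let $\boldsymbol\beta^*$ be a critical point of $f(\boldsymbol\beta)=\frac12\|\mathbf y-\mathbf X\boldsymbol\beta\|_2^2+h_\lambda(\boldsymbol\beta)$. Let $N\ge1$ and let $\boldsymbol\beta^{(N)}$ be the output of the following iteration (Iterative SRO): $\boldsymbol\beta^{(0)}=\mathbf 0$ and, for $t=1,\dots,N$, $$\boldsymbol\beta^{(t)}=\operatorname*{arg\,min}_{\boldsymbol\beta\in\mathbb R^d}\ \tfrac12\big\|\tilde{\mathbf X}(\boldsymbol\beta-\boldsymbol\beta^{(t-1)})\big\|_2^2-\langle\mathbf y-\mathbf X\boldsymbol\beta^{(t-1)},\mathbf X\boldsymbol\beta\rangle+h_\lambda(\boldsymbol\beta).$$ Suppose that either $h_\lambda$ is convex, or the Fréchet subdifferential of $h_\lambda$ is $L_h$-smooth and $\mathbf X$ has full column rank with $\frac{L_h}{\sigma_{\min}^2(\mathbf X)}<1-\varepsilon$. Then with probability at least $1-\delta$, $$\|\boldsymbol\beta^{(N)}-\boldsymbol\beta^*\|_{\mathbf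 X}\le\rho^N\|\boldsymbol\beta^*\|_{\mathbf X}$$ for a constant $0<\rho<1$. In particular, if $\mathbf P$ is a Gaussian subspace embedding, then $\tilde n=\mathcal O\big((r+\log\frac1\delta)\cdot(\rho+1)^2/\rho^2\big)$; if $\mathbf P$ is a sparse subspace embedding, then $\tilde n=\mathcal O\big(\frac{r^2}{\delta}\cdot(\rho+1)^2/\rho^2\big)$.
   Context: Notation: $\|\mathbf u\|_{\mathbf X}=\|\mathbf X\mathbf u\|_2$; $\sigma_{\min}(\mathbf X)$ is the smallest singular value. The same matrix $\mathbf P$ (and $\tilde{\mathbf X}$) is used in all iterations. The stated $\tilde n$ is the sketch size with which the given contraction factor $\rho$ is attained; $\mathcal O(\cdot)$ hides an absolute constant. Fréchet subdifferential: for a proper lower semicontinuous $f$ and $\mathbf x\in\mathrm{dom} f$, $\tilde\partial f(\mathbf x)$ is the set of all $\mathbf u\in\mathbb R^d$ with $\liminf_{\mathbf y\ne\mathbf x,\mathbf y\to\mathbf x}\frac{f(\mathbf y)-f(\mathbf x)-\langle\mathbf u,\mathbf y-\mathbf x\rangle}{\|\mathbf y-\mathbf x\|_2}\ge0$. Limiting subdifferential: $\partial f(\mathbf x)=\{\mathbf u:\exists\,\mathbf x^k\to\mathbf x,\ f(\mathbf x^k)\to f(\mathbf x),\ \tilde{\mathbf u}^k\in\tilde\partial f(\mathbf x^k),\ \tilde{\mathbf u}^k\to\mathbf u\}$. A point $\mathbf x$ is a critical point of $f$ if $\mathbf 0\in\partial f(\mathbf x)$. The Fréchet subdifferential of $h_\lambda$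 is $L_h$-smooth if $\sup_{\mathbf u\in\tilde\partial h_\lambda(\mathbf x),\,\mathbf v\in\tilde\partial h_\lambda(\mathbf z)}\|\mathbf u-\mathbf v\|_2\le L_h\|\mathbf x-\mathbf z\|_2$ for all $\mathbf x,\mathbf z$. A distribution $\mathcal P$ over $\tilde n\times n$ matrices (where $\tilde n$ is a function of $n,d,\varepsilon,\delta$) is an $(\varepsilon,\delta)$ oblivious $\ell^2$-subspace embedding if for any fixed $n\times d$ matrix $\mathbf X$, with probability at least $1-\delta$ a matrix $\mathbf P\sim\mathcal P$ satisfies $(1-\varepsilon)\|\mathbf X\boldsymbol\beta\|_2^2\le\|\mathbf P\mathbf X\boldsymbol\beta\|_2^2\le(1+\varepsilon)\|\mathbf X\boldsymbol\beta\|_2^2$ for all $\boldsymbol\beta\in\mathbb R^d$. Gaussian subspace embedding: $\mathbf P=\mathbf P'/\sqrt{\tilde n}$ with $\mathbf P'$ having i.i.d. $\mathcal N(0,1)$ entries. Sparse subspace embedding: for each column $i\in[n]$, a row $h(i)\in[\tilde n]$ is chosen uniformly and a sign $\sigma(i)\in\{1,-1\}$ uniformly; $\mathbf P_{h(i)i}=\sigma(i)$ and $\mathbf P_{ji}=0$ for $j\neq h(i)$.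
   Formalization: In the non-convex case, ε₀, ρ and the O-constants may depend on a bound κ<1 for L_h/σ_min²(X) (with absolute constants the claim fails, e.g. n=d=1, h=-Kb²/2+cb, K=1-1.5ε); in the convex case ε₀ and the O-constants stay absolute. *)

theory Defs
  imports
    "HOL-Probability.Probability"
    "Jordan_Normal_Form.DL_Rank"
    "Jordan_Normal_Form.Char_Poly"
begin

unbundle no inner_syntax
unbundle no vec_syntax

text \<open>
  Vectors and matrices are those of \<^theory>\<open>Jordan_Normal_Form.Matrix\<close>, so that the dimensions are
  natural numbers and constants can be quantified outside of them.  A function on the
  \<open>d\<close>-dimensional space is a function on \<^typ>\<open>real vec\<close> of which only the values on
  \<^term>\<open>carrier_vec d\<close> matter.
\<close>

definition norm2 :: "real vec \<Rightarrow> real" where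
  "norm2 v = sqrt (v \<bullet> v)"

definition matrix_norm_of :: "real mat \<Rightarrow> real vec \<Rightarrow> real" where
  "matrix_norm_of X u = norm2 (X *\<^sub>v u)"

text \<open>
  The set below is the set of singular values for matrices with at least as many rows as columns,
  in particular for those of full column rank.
\<close>

definition sigma_min :: "real mat \<Rightarrow> real" where
  "sigma_min X = Min {s. 0 \<le> s \<and> eigenvalue (transpose_mat X * X) (s\<^sup>2)}"

definition convex_on_vec :: "nat \<Rightarrow> (real vec \<Rightarrow> real) \<Rightarrow> bool" where
  "convex_on_vec d h \<longleftrightarrow>
     (\<forall>x\<in>carrier_vec d. \<forall>z\<in>carrier_vec d. \<forall>t\<in>{0..1}.
        h ((1 - t) \<cdot>\<^sub>v x + t \<cdot>\<^sub>v z) \<le> (1 - t) * h x + t * h z)"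

text \<open>The filter of \<open>z \<rightarrow> x\<close>, \<open>z \<noteq> x\<close> in the \<open>d\<close>-dimensional space.\<close>

definition punctured_nhds_vec :: "nat \<Rightarrow> real vec \<Rightarrow> real vec filter" where
  "punctured_nhds_vec d x =
     inf (filtercomap (\<lambda>z. norm2 (z - x)) (at_right 0)) (principal (carrier_vec d))"

definition frechet_subdifferential :: "nat \<Rightarrow> (real vec \<Rightarrow> real) \<Rightarrow> real vec \<Rightarrow> real vec set" where
  "frechet_subdifferential d f x =
     {u \<in> carrier_vec d.
        0 \<le> Liminf (punctured_nhds_vec d x)
              (\<lambda>z. ereal ((f z - f x - u \<bullet> (z - x)) / norm2 (z - x)))}"

definition limiting_subdifferential :: "nat \<Rightarrow> (real vec \<Rightarrow> real) \<Rightarrow> real vec \<Rightarrow> real vec set" where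
  "limiting_subdifferential d f x =
     {u \<in> carrier_vec d. \<exists>xs us.
        (\<forall>k. xs k \<in> carrier_vec d \<and> us k \<in> frechet_subdifferential d f (xs k)) \<and>
        (\<lambda>k. norm2 (xs k - x)) \<longlonglongrightarrow> 0 \<and>
        (\<lambda>k. f (xs k)) \<longlonglongrightarrow> f x \<and>
        (\<lambda>k. norm2 (us k - u)) \<longlonglongrightarrow> 0}"

definition critical_point :: "nat \<Rightarrow> (real vec \<Rightarrow> real) \<Rightarrow> real vec \<Rightarrow> bool" where
  "critical_point d f x \<longleftrightarrow> x \<in> carrier_vec d \<and> 0\<^sub>v d \<in> limiting_subdifferential d f x"

definition frechet_subdifferentiable :: "nat \<Rightarrow> (real vec \<Rightarrow> real) \<Rightarrow> bool" where
  "frechet_subdifferentiable d f \<longleftrightarrow>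
     (\<forall>x\<in>carrier_vec d. frechet_subdifferential d f x \<noteq> {})"

definition frechet_subdifferential_smooth :: "nat \<Rightarrow> real \<Rightarrow> (real vec \<Rightarrow> real) \<Rightarrow> bool" where
  "frechet_subdifferential_smooth d L f \<longleftrightarrow>
     (\<forall>x\<in>carrier_vec d. \<forall>z\<in>carrier_vec d.
        \<forall>u\<in>frechet_subdifferential d f x. \<forall>v\<in>frechet_subdifferential d f z.
          norm2 (u - v) \<le> L * norm2 (x - z))"

definition regularized_ls ::
    "real mat \<Rightarrow> real vec \<Rightarrow> (real vec \<Rightarrow> real) \<Rightarrow> real vec \<Rightarrow> real" where
  "regularized_ls X y h b = (norm2 (y - X *\<^sub>v b))\<^sup>2 / 2 + h b"

definition sro_objective ::
    "real mat \<Rightarrow> real vec \<Rightarrow> (real vec \<Rightarrow> real) \<Rightarrow> real mat \<Rightarrow> real vec \<Rightarrow> real vec \<Rightarrow> real" where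
  "sro_objective X y h P b' b =
     (norm2 ((P * X) *\<^sub>v (b - b')))\<^sup>2 / 2 - (y - X *\<^sub>v b') \<bullet> (X *\<^sub>v b) + h b"

text \<open>Minimizers need not be unique: any choice of minimizers is a run of the iteration.\<close>

definition iterative_sro ::
    "nat \<Rightarrow> real mat \<Rightarrow> real vec \<Rightarrow> (real vec \<Rightarrow> real) \<Rightarrow> real mat \<Rightarrow> nat \<Rightarrow> (nat \<Rightarrow> real vec) \<Rightarrow> bool"
  where
  "iterative_sro d X y h P N b \<longleftrightarrow>
     b 0 = 0\<^sub>v d \<and>
     (\<forall>t\<in>{1..N}. is_arg_min (sro_objective X y h P (b (t - 1))) (\<lambda>z. z \<in> carrier_vec d) (b t))"

text \<open>Borel sigma-algebra on \<open>m \<times> n\<close> matrices: the one generated by the entries.\<close>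

definition mat_borel :: "nat \<Rightarrow> nat \<Rightarrow> real mat measure" where
  "mat_borel m n =
     vimage_algebra (carrier_mat m n) (\<lambda>A. \<lambda>ij\<in>{..<m} \<times> {..<n}. A $$ ij)
       (Pi\<^sub>M ({..<m} \<times> {..<n}) (\<lambda>_. borel))"

text \<open>
  The formulation by a measurable subset avoids the question whether \<open>{A. Q A}\<close>, which below
  quantifies over all choices of minimizers, is itself measurable.
\<close>

definition holds_with_prob_ge :: "'a measure \<Rightarrow> real \<Rightarrow> ('a \<Rightarrow> bool) \<Rightarrow> bool" where
  "holds_with_prob_ge M p Q \<longleftrightarrow> (\<exists>E\<in>sets M. p \<le> measure M E \<and> (\<forall>A\<in>E. Q A))"

definition oblivious_l2_embedding ::
    "nat \<Rightarrow> nat \<Rightarrow> nat \<Rightarrow> real \<Rightarrow> real \<Rightarrow> real mat measure \<Rightarrow> bool" where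
  "oblivious_l2_embedding m n d \<epsilon> \<delta> D \<longleftrightarrow>
     prob_space D \<and> sets D = sets (mat_borel m n) \<and>
     (\<forall>X\<in>carrier_mat n d.
        holds_with_prob_ge D (1 - \<delta>)
          (\<lambda>P. \<forall>b\<in>carrier_vec d.
             (1 - \<epsilon>) * (norm2 (X *\<^sub>v b))\<^sup>2 \<le> (norm2 ((P * X) *\<^sub>v b))\<^sup>2 \<and>
             (norm2 ((P * X) *\<^sub>v b))\<^sup>2 \<le> (1 + \<epsilon>) * (norm2 (X *\<^sub>v b))\<^sup>2))"

definition gaussian_embedding :: "nat \<Rightarrow> nat \<Rightarrow> real mat measure" where
  "gaussian_embedding m n =
     distr (Pi\<^sub>M ({..<m} \<times> {..<n}) (\<lambda>_. density lborel std_normal_density)) (mat_borel m n)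
       (\<lambda>g. Matrix.mat m n (\<lambda>ij. g ij / sqrt (real m)))"

text \<open>Column \<open>j\<close> draws a pair \<open>s j\<close> of a row and a sign, independently of the other columns.\<close>

definition sparse_embedding :: "nat \<Rightarrow> nat \<Rightarrow> real mat pmf" where
  "sparse_embedding m n =
     map_pmf (\<lambda>s. Matrix.mat m n (\<lambda>(i, j). if i = fst (s j) then snd (s j) else 0))
       (Pi_pmf {..<n} (0, 1) (\<lambda>_. pair_pmf (pmf_of_set {..<m}) (pmf_of_set {1, -1})))"

end

(*
  Write e_t = beta_t - beta* and A = P X.  The optimality conditions of the t-th subproblem and of
  beta* give two subgradients of h whose difference, paired with e_t, equals
    - <X e_(t-1), X e_t> - |A e_t|^2 + <A e_(t-1), A e_t>.
  Convexity (or smoothness together with the smallest singular value) bounds this from below by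
  - kappa |X e_t|^2.  If |A c|^2 and |X c|^2 differ by at most eps |X c|^2, then by polarization
  <A a, A c> and <X a, X c> differ by at most eps |X a| |X c|, so that
    |X e_t| <= eps / (1 - kappa - eps) |X e_(t-1)|.
  The contraction factor is rho for eps = (1 - kappa) rho / (1 + rho), and it remains to see that the
  two random matrices have distortion eps on the r-dimensional column space of X.  For the sparse
  embedding, the expected squared Frobenius norm of (P U)^T P U - 1 is at most 2 r^2 / m for an
  orthonormal basis U, and Markov's inequality applies.  For the Gaussian one, chi-square tails are
  combined with a union bound over a lattice net of exponential size.
*)
theory Submission
  imports Defs "Jordan_Normal_Form.Gram_Schmidt"
begin

subsection \<open>Euclidean vectors\<close>

text \<open>The vectors carry no topology, so no extremum is obtained from compactness: the smallest
  singular value is reached through an infimum and the inverse of a shifted Gram matrix, and the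
  worst distortion on the unit ball is a supremum that is only known to be finite. Limits are taken
  coordinate by coordinate. The point beta* is critical in the limiting sense only. Its optimality
  condition is exact at nearby points and holds up to a vanishing error, so each inequality that
  uses it is first proved along a sequence and then passed to the limit. The function
  \<open>h\<close> is never differentiated. The quadratic parts of both objectives are removed by a
  sum rule for Frechet subgradients that tolerates a second-order remainder. Polarization costs no
  constant factor because one of the two vectors is rescaled before the squares are compared. This
  keeps the contraction factor at eps / (1 - kappa - eps), and it is also what lets a net of fixed
  mesh control the whole ball.\<close>

lemma scalar_prod_self_nonneg: "0 \<le> (v :: real vec) \<bullet> v"
  unfolding scalar_prod_def by (intro sum_nonneg) auto

lemma norm2_power2: "(norm2 v)\<^sup>2 = v \<bullet> v"
  unfolding norm2_def by (simp add: scalar_prod_self_nonneg)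

lemma norm2_nonneg [simp]: "0 \<le> norm2 v"
  unfolding norm2_def by (simp add: scalar_prod_self_nonneg)

lemma norm2_eq_L2_set:
  assumes "v \<in> carrier_vec d"
  shows "norm2 v = L2_set (\<lambda>i. v $ i) {..<d}"
  using assms unfolding norm2_def L2_set_def scalar_prod_def
  by (auto simp: power2_eq_square lessThan_atLeast0)

lemma norm2_power2_eq_sum:
  assumes "v \<in> carrier_vec d"
  shows "(norm2 v)\<^sup>2 = (\<Sum>i<d. (v $ i)\<^sup>2)"
  using assms by (simp add: norm2_eq_L2_set L2_set_def sum_nonneg)

lemma norm2_triangle:
  assumes "u \<in> carrier_vec d" "v \<in> carrier_vec d"
  shows "norm2 (u + v) \<le> norm2 u + norm2 v"
proof -
  have "norm2 (u + v) = L2_set (\<lambda>i. u $ i + v $ i) {..<d}"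
    using assms by (subst norm2_eq_L2_set[of _ d]) (auto intro!: L2_set_cong)
  then show ?thesis
    using L2_set_triangle_ineq[of "\<lambda>i. u $ i" "\<lambda>i. v $ i" "{..<d}"] assms
    by (simp add: norm2_eq_L2_set[of _ d])
qed

lemma abs_scalar_prod_le:
  assumes "u \<in> carrier_vec d" "v \<in> carrier_vec d"
  shows "\<bar>u \<bullet> v\<bar> \<le> norm2 u * norm2 v"
proof -
  have "\<bar>u \<bullet> v\<bar> \<le> (\<Sum>i\<in>{..<d}. \<bar>u $ i\<bar> * \<bar>v $ i\<bar>)"
    using assms unfolding scalar_prod_def
    by (auto simp: lessThan_atLeast0 abs_mult intro!: order_trans[OF sum_abs] sum_mono)
  also have "\<dots> \<le> norm2 u * norm2 v"
    using L2_set_mult_ineq[of "\<lambda>i. u $ i" "\<lambda>i. v $ i" "{..<d}"] assms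
    by (simp add: norm2_eq_L2_set[of _ d])
  finally show ?thesis .
qed

lemma norm2_smult [simp]: "norm2 (a \<cdot>\<^sub>v v) = \<bar>a\<bar> * norm2 v"
  unfolding norm2_def by (simp add: real_sqrt_mult flip: mult.assoc)

lemma norm2_zero [simp]: "norm2 (0\<^sub>v d) = 0"
  unfolding norm2_def by simp

lemma norm2_eq_0_iff:
  assumes "v \<in> carrier_vec d"
  shows "norm2 v = 0 \<longleftrightarrow> v = 0\<^sub>v d"
proof
  assume "norm2 v = 0"
  then have "\<forall>i\<in>{..<d}. v $ i = 0"
    using assms by (simp add: norm2_eq_L2_set[of _ d] L2_set_eq_0_iff)
  then show "v = 0\<^sub>v d" using assms by (intro eq_vecI) auto
qed simp

lemma norm2_add_power2:
  assumes "u \<in> carrier_vec d" "v \<in> carrier_vec d"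
  shows "(norm2 (u + v))\<^sup>2 = (norm2 u)\<^sup>2 + 2 * (u \<bullet> v) + (norm2 v)\<^sup>2"
  using assms
  by (simp add: norm2_power2 add_scalar_prod_distrib[of _ d] scalar_prod_add_distrib[of _ d]
      comm_scalar_prod[of v d u])

lemma norm2_diff_power2:
  assumes "u \<in> carrier_vec d" "v \<in> carrier_vec d"
  shows "(norm2 (u - v))\<^sup>2 = (norm2 u)\<^sup>2 - 2 * (u \<bullet> v) + (norm2 v)\<^sup>2"
  using assms
  by (simp add: norm2_power2 minus_scalar_prod_distrib[of _ d] scalar_prod_minus_distrib[of _ d]
      comm_scalar_prod[of v d u])

text \<open>A crude operator norm: Cauchy-Schwarz in every row, then the sum of the row norms. Its
  size never matters, only that some finite \<open>K\<close> exists, for quadratic remainders, for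
  the norm of an inverse and for the finiteness of a supremum.\<close>

lemma norm2_mult_mat_vec_le:
  assumes "A \<in> carrier_mat m d"
  obtains K where "0 \<le> K" "\<And>v. v \<in> carrier_vec d \<Longrightarrow> norm2 (A *\<^sub>v v) \<le> K * norm2 v"
proof
  define K where "K = (\<Sum>i<m. norm2 (row A i))"
  show "0 \<le> K" unfolding K_def by (simp add: sum_nonneg)
  fix v :: "real vec" assume v: "v \<in> carrier_vec d"
  have "norm2 (A *\<^sub>v v) = L2_set (\<lambda>i. row A i \<bullet> v) {..<m}"
    using assms v by (subst norm2_eq_L2_set[of _ m]) (auto intro!: L2_set_cong)
  also have "\<dots> \<le> (\<Sum>i<m. \<bar>row A i \<bullet> v\<bar>)" by (rule L2_set_le_sum_abs)
  also have "\<dots> \<le> (\<Sum>i<m. norm2 (row A i) * norm2 v)"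
    using assms v by (intro sum_mono abs_scalar_prod_le[of _ d]) auto
  finally show "norm2 (A *\<^sub>v v) \<le> K * norm2 v" by (simp add: K_def sum_distrib_right)
qed

text \<open>The scalar core of polarization. \<open>B\<close> is the value of a bilinear form,
  \<open>p\<close> and \<open>q\<close> are the lengths of its arguments, and \<open>s\<close>
  rescales the second argument. The best \<open>s\<close> turns a bound by a sum of squares into a
  bound by the product.\<close>

lemma polarization_bound:
  fixes B S p q :: real
  assumes le: "\<And>s. \<bar>4 * s * B\<bar> \<le> S * (2 * (p\<^sup>2 + s\<^sup>2 * q\<^sup>2))"
    and nn: "0 \<le> p" "0 \<le> q" "0 \<le> S"
  shows "\<bar>B\<bar> \<le> S * p * q"
proof (cases "B = 0 \<or> (0 < p \<and> 0 < q)")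
  case True
  show ?thesis
  proof (cases "B = 0")
    case False
    with True have pq: "0 < p" "0 < q" by auto
    \<comment> \<open>The scale \<open>p / q\<close> minimizes the bound on \<open>B\<close>: it
      makes the two squares on the right equal.\<close>
    have "4 * (p / q) * \<bar>B\<bar> \<le> S * (2 * (p\<^sup>2 + p\<^sup>2))"
      using le[of "p / q"] pq by (simp add: power_divide abs_mult)
    then have "(4 * (p / q) * \<bar>B\<bar>) * (q / (4 * p)) \<le> (S * (2 * (p\<^sup>2 + p\<^sup>2))) * (q / (4 * p))"
      by (rule mult_right_mono) (use pq in auto)
    then show ?thesis using pq by (simp add: field_simps power2_eq_square)
  qed (use nn in auto)
next
  case False
  then consider "B \<noteq> 0" "p = 0" | "B \<noteq> 0" "q = 0" using nn by force
  then show ?thesis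
  proof cases
    case 1
    \<comment> \<open>For \<open>p = 0\<close> the hypothesis bounds \<open>B\<close> by a multiple
      of \<open>s\<close>, so a small positive \<open>s\<close> forces \<open>B = 0\<close>. The
      scale is \<open>\<bar>B\<bar> / c\<close>, where the summand 1 keeps \<open>c\<close> positive
      and makes the contradiction strict.\<close>
    define c where "c = S * q\<^sup>2 + 1"
    have c: "0 < c" using nn by (simp add: c_def add_nonneg_pos)
    have "4 * (\<bar>B\<bar> / c) * \<bar>B\<bar> \<le> S * (2 * ((\<bar>B\<bar> / c)\<^sup>2 * q\<^sup>2))"
      using le[of "\<bar>B\<bar> / c"] c 1 by (simp add: abs_mult)
    then have "(4 * (\<bar>B\<bar> / c) * \<bar>B\<bar>) * c\<^sup>2 \<le> S * (2 * ((\<bar>B\<bar> / c)\<^sup>2 * q\<^sup>2)) * c\<^sup>2"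
      by (rule mult_right_mono) auto
    then have "4 * B\<^sup>2 * c \<le> 2 * B\<^sup>2 * (S * q\<^sup>2)"
      using c by (simp add: field_simps power2_eq_square)
    also have "\<dots> = 2 * B\<^sup>2 * c - 2 * B\<^sup>2" by (simp add: c_def algebra_simps)
    finally have "2 * (B\<^sup>2 * c) + 2 * B\<^sup>2 \<le> 0" by (simp add: algebra_simps)
    moreover have "0 < B\<^sup>2 * c" "0 < B\<^sup>2" using 1 c by auto
    ultimately show ?thesis by linarith
  next
    case 2
    \<comment> \<open>For \<open>q = 0\<close> the right side does not depend on \<open>s\<close>
      while the left side grows without bound; this scale is already too large.\<close>
    have "4 * (S * p\<^sup>2 + 1) \<le> S * (2 * p\<^sup>2)"
      using le[of "(S * p\<^sup>2 + 1) / \<bar>B\<bar>"] 2 nn by (simp add: abs_mult add_nonneg_pos)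
    moreover have "0 \<le> S * p\<^sup>2" using nn by simp
    ultimately show ?thesis by argo
  qed
qed

text \<open>The difference of the two Gram forms is symmetric, so \<open>4 * s\<close> times its
  value at \<open>a\<close>, \<open>c\<close> is the difference of its quadratic form at
  \<open>a + s c\<close> and \<open>a - s c\<close>. The parallelogram law for \<open>X\<close> adds
  up the two distortion bounds.\<close>

lemma abs_scalar_prod_distortion_le:
  assumes A: "A \<in> carrier_mat m d" and X: "X \<in> carrier_mat n d" and "0 \<le> \<epsilon>"
    and dist: "\<And>c. c \<in> carrier_vec d \<Longrightarrow>
      \<bar>(norm2 (A *\<^sub>v c))\<^sup>2 - (norm2 (X *\<^sub>v c))\<^sup>2\<bar> \<le> \<epsilon> * (norm2 (X *\<^sub>v c))\<^sup>2"
    and a: "a \<in> carrier_vec d" and c: "c \<in> carrier_vec d"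
  shows "\<bar>(A *\<^sub>v a) \<bullet> (A *\<^sub>v c) - (X *\<^sub>v a) \<bullet> (X *\<^sub>v c)\<bar>
    \<le> \<epsilon> * norm2 (X *\<^sub>v a) * norm2 (X *\<^sub>v c)"
proof (rule polarization_bound)
  fix s :: real
  have exp: "(norm2 (M *\<^sub>v (a + s \<cdot>\<^sub>v c)))\<^sup>2 =
      (norm2 (M *\<^sub>v a))\<^sup>2 + 2 * s * ((M *\<^sub>v a) \<bullet> (M *\<^sub>v c)) + s\<^sup>2 * (norm2 (M *\<^sub>v c))\<^sup>2"
      "(norm2 (M *\<^sub>v (a - s \<cdot>\<^sub>v c)))\<^sup>2 =
      (norm2 (M *\<^sub>v a))\<^sup>2 - 2 * s * ((M *\<^sub>v a) \<bullet> (M *\<^sub>v c)) + s\<^sup>2 * (norm2 (M *\<^sub>v c))\<^sup>2"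
    if M: "M \<in> carrier_mat k d" for M k
  proof -
    have Mv: "M *\<^sub>v a \<in> carrier_vec k" "M *\<^sub>v c \<in> carrier_vec k" using M a c by auto
    have "M *\<^sub>v (a + s \<cdot>\<^sub>v c) = M *\<^sub>v a + s \<cdot>\<^sub>v (M *\<^sub>v c)"
      "M *\<^sub>v (a - s \<cdot>\<^sub>v c) = M *\<^sub>v a - s \<cdot>\<^sub>v (M *\<^sub>v c)"
      using M a c by (simp_all add: mult_add_distrib_mat_vec[of _ k d] mult_mat_vec
          mult_minus_distrib_mat_vec[of _ k d])
    then show "(norm2 (M *\<^sub>v (a + s \<cdot>\<^sub>v c)))\<^sup>2 =
      (norm2 (M *\<^sub>v a))\<^sup>2 + 2 * s * ((M *\<^sub>v a) \<bullet> (M *\<^sub>v c)) + s\<^sup>2 * (norm2 (M *\<^sub>v c))\<^sup>2"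
      "(norm2 (M *\<^sub>v (a - s \<cdot>\<^sub>v c)))\<^sup>2 =
      (norm2 (M *\<^sub>v a))\<^sup>2 - 2 * s * ((M *\<^sub>v a) \<bullet> (M *\<^sub>v c)) + s\<^sup>2 * (norm2 (M *\<^sub>v c))\<^sup>2"
      using Mv by (simp_all add: norm2_add_power2[of _ k] norm2_diff_power2[of _ k] power_mult_distrib)
  qed
  have "\<bar>(norm2 (A *\<^sub>v (a + s \<cdot>\<^sub>v c)))\<^sup>2 - (norm2 (X *\<^sub>v (a + s \<cdot>\<^sub>v c)))\<^sup>2\<bar>
        \<le> \<epsilon> * (norm2 (X *\<^sub>v (a + s \<cdot>\<^sub>v c)))\<^sup>2"
       "\<bar>(norm2 (A *\<^sub>v (a - s \<cdot>\<^sub>v c)))\<^sup>2 - (norm2 (X *\<^sub>v (a - s \<cdot>\<^sub>v c)))\<^sup>2\<bar>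
        \<le> \<epsilon> * (norm2 (X *\<^sub>v (a - s \<cdot>\<^sub>v c)))\<^sup>2"
    using a c by (auto intro!: dist)
  then show "\<bar>4 * s * ((A *\<^sub>v a) \<bullet> (A *\<^sub>v c) - (X *\<^sub>v a) \<bullet> (X *\<^sub>v c))\<bar>
    \<le> \<epsilon> * (2 * ((norm2 (X *\<^sub>v a))\<^sup>2 + s\<^sup>2 * (norm2 (X *\<^sub>v c))\<^sup>2))"
    unfolding exp[OF A] exp[OF X] by (auto simp: abs_if algebra_simps split: if_splits)
qed (use assms in auto)

subsection \<open>Componentwise limits\<close>

lemma tendsto_index_of_norm2:
  assumes "\<And>k. xs k \<in> carrier_vec d" "x \<in> carrier_vec d"
    and lim: "(\<lambda>k. norm2 (xs k - x)) \<longlonglongrightarrow> 0" and i: "i < d"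
  shows "(\<lambda>k. xs k $ i) \<longlonglongrightarrow> x $ i"
proof -
  have "\<bar>xs k $ i - x $ i\<bar> \<le> norm2 (xs k - x)" for k
    using member_le_L2_set[of "{..<d}" i "\<lambda>i. \<bar>(xs k - x) $ i\<bar>"] i assms(1)[of k] assms(2)
    by (simp add: norm2_eq_L2_set[of _ d] L2_set_def)
  then have "(\<lambda>k. xs k $ i - x $ i) \<longlonglongrightarrow> 0"
    by (intro Lim_null_comparison[OF _ lim]) auto
  then show ?thesis by (simp add: LIM_zero_iff)
qed

lemma tendsto_scalar_prod:
  assumes "\<And>k. us k \<in> carrier_vec d" "\<And>k. xs k \<in> carrier_vec d" "u \<in> carrier_vec d" "x \<in> carrier_vec d"
    and "\<And>i. i < d \<Longrightarrow> (\<lambda>k. us k $ i) \<longlonglongrightarrow> u $ i"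
    and "\<And>i. i < d \<Longrightarrow> (\<lambda>k. xs k $ i) \<longlonglongrightarrow> x $ i"
  shows "(\<lambda>k. us k \<bullet> xs k :: real) \<longlonglongrightarrow> u \<bullet> x"
proof -
  have "(\<lambda>k. \<Sum>i<d. us k $ i * xs k $ i) \<longlonglongrightarrow> (\<Sum>i<d. u $ i * x $ i)"
    using assms by (intro tendsto_intros) auto
  moreover have "dim_vec (xs k) = d" "dim_vec x = d" for k using assms(2)[of k] assms(4) by auto
  ultimately show ?thesis by (simp add: scalar_prod_def lessThan_atLeast0)
qed

lemma tendsto_norm2:
  assumes "\<And>k. xs k \<in> carrier_vec d" "x \<in> carrier_vec d"
    and "\<And>i. i < d \<Longrightarrow> (\<lambda>k. xs k $ i) \<longlonglongrightarrow> x $ i"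
  shows "(\<lambda>k. norm2 (xs k)) \<longlonglongrightarrow> norm2 x"
  unfolding norm2_def using assms by (intro tendsto_intros tendsto_scalar_prod) auto

lemma tendsto_mult_mat_vec:
  assumes A: "A \<in> carrier_mat m d" and "\<And>k. xs k \<in> carrier_vec d" "x \<in> carrier_vec d"
    and "\<And>i. i < d \<Longrightarrow> (\<lambda>k. xs k $ i) \<longlonglongrightarrow> x $ i" and "j < m"
  shows "(\<lambda>k. (A *\<^sub>v xs k :: real vec) $ j) \<longlonglongrightarrow> (A *\<^sub>v x) $ j"
proof -
  have "(\<lambda>k. row A j \<bullet> xs k) \<longlonglongrightarrow> row A j \<bullet> x"
    using assms by (intro tendsto_scalar_prod) auto
  then show ?thesis using assms by simp
qed

subsection \<open>Subdifferentials\<close>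

text \<open>The epsilon-delta form of the \<open>Liminf\<close> condition, multiplied by the
  distance so that no quotient remains. All later work with Frechet subgradients goes through
  it.\<close>

lemma mem_frechet_subdifferential_iff:
  "u \<in> frechet_subdifferential d f x \<longleftrightarrow> u \<in> carrier_vec d \<and>
     (\<forall>e>0. \<exists>r>0. \<forall>z\<in>carrier_vec d. 0 < norm2 (z - x) \<and> norm2 (z - x) < r \<longrightarrow>
        - e * norm2 (z - x) \<le> f z - f x - u \<bullet> (z - x))"
proof -
  define q where "q z = (f z - f x - u \<bullet> (z - x)) / norm2 (z - x)" for z
  have ev: "eventually P (punctured_nhds_vec d x) \<longleftrightarrow>
      (\<exists>r>0. \<forall>z\<in>carrier_vec d. 0 < norm2 (z - x) \<and> norm2 (z - x) < r \<longrightarrow> P z)" for P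
    unfolding punctured_nhds_vec_def eventually_inf_principal eventually_filtercomap
      eventually_at_right_field
  proof safe
    fix Q b assume "(0::real) < b" "\<forall>y>0. y < b \<longrightarrow> Q y"
      and "\<forall>z. Q (norm2 (z - x)) \<longrightarrow> z \<in> carrier_vec d \<longrightarrow> P z"
    then show "\<exists>r>0. \<forall>z\<in>carrier_vec d. 0 < norm2 (z - x) \<and> norm2 (z - x) < r \<longrightarrow> P z"
      by (intro exI[of _ b]) auto
  next
    fix r assume "(0::real) < r"
      "\<forall>z\<in>carrier_vec d. 0 < norm2 (z - x) \<and> norm2 (z - x) < r \<longrightarrow> P z"
    then show "\<exists>Q. (\<exists>b>0. \<forall>y>0. y < b \<longrightarrow> Q y) \<and> (\<forall>z. Q (norm2 (z - x)) \<longrightarrow> z \<in> carrier_vec d \<longrightarrow> P z)"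
      by (intro exI[of _ "\<lambda>y. 0 < y \<and> y < r"]) auto
  qed
  have "0 \<le> Liminf (punctured_nhds_vec d x) (\<lambda>z. ereal (q z)) \<longleftrightarrow>
     (\<forall>e>0. eventually (\<lambda>z. - e \<le> q z) (punctured_nhds_vec d x))"
    unfolding le_Liminf_iff
  proof safe
    fix e :: real assume "\<forall>y<0. \<forall>\<^sub>F z in punctured_nhds_vec d x. y < ereal (q z)" "0 < e"
    then have "\<forall>\<^sub>F z in punctured_nhds_vec d x. ereal (- e) < ereal (q z)"
      by (metis ereal_less(5) neg_less_0_iff_less zero_ereal_def ereal_less_eq(3) less_ereal.simps(1))
    then show "\<forall>\<^sub>F z in punctured_nhds_vec d x. - e \<le> q z" by eventually_elim simp
  next
    fix y :: ereal assume *: "\<forall>e>0. \<forall>\<^sub>F z in punctured_nhds_vec d x. - e \<le> q z" and "y < 0"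
    \<comment> \<open>A real number strictly between \<open>y\<close> and 0 turns the non-strict
      bound into a strict one and also covers \<open>y\<close> equal to minus infinity.\<close>
    then obtain e where e: "y < ereal e" "ereal e < 0" using ereal_dense2 by blast
    then have "\<forall>\<^sub>F z in punctured_nhds_vec d x. e \<le> q z"
      using *[rule_format, of "- e"] by simp
    then show "\<forall>\<^sub>F z in punctured_nhds_vec d x. y < ereal (q z)"
      by eventually_elim (use e in \<open>auto intro: less_le_trans\<close>)
  qed
  also have "\<dots> \<longleftrightarrow> (\<forall>e>0. \<exists>r>0. \<forall>z\<in>carrier_vec d. 0 < norm2 (z - x) \<and> norm2 (z - x) < r \<longrightarrow>
        - e * norm2 (z - x) \<le> f z - f x - u \<bullet> (z - x))"
    unfolding ev q_def by (auto simp: pos_le_divide_eq)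
  finally show ?thesis unfolding frechet_subdifferential_def q_def by simp
qed

text \<open>The sum rule in the form that is used: if the linearization errors of \<open>f\<close>
  at \<open>w\<close> and of \<open>h\<close> at \<open>u\<close> compare up to a quadratic term,
  that term is of lower order than the distance and the subgradient transfers.\<close>

lemma frechet_subdifferential_perturb:
  assumes w: "w \<in> frechet_subdifferential d f x" and u: "u \<in> carrier_vec d"
    and le: "\<And>z. z \<in> carrier_vec d \<Longrightarrow>
      f z - f x - w \<bullet> (z - x) \<le> h z - h x - u \<bullet> (z - x) + K * (norm2 (z - x))\<^sup>2"
  shows "u \<in> frechet_subdifferential d h x"
  unfolding mem_frechet_subdifferential_iff
proof (intro conjI allI impI u)
  fix e :: real assume e: "0 < e"
  then obtain r where r: "0 < r" and
    w': "\<And>z. z \<in> carrier_vec d \<Longrightarrow> 0 < norm2 (z - x) \<Longrightarrow> norm2 (z - x) < r \<Longrightarrow>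
        - (e / 2) * norm2 (z - x) \<le> f z - f x - w \<bullet> (z - x)"
    using w[unfolded mem_frechet_subdifferential_iff] half_gt_zero[OF e] by meson
  \<comment> \<open>Within this radius the quadratic term uses at most half of the tolerance
    \<open>e\<close>; the other half is spent on \<open>w\<close>. The 1 in
    \<open>\<bar>K\<bar> + 1\<close> guards against \<open>K = 0\<close>.\<close>
  define r' where "r' = min r (e / (2 * (\<bar>K\<bar> + 1)))"
  show "\<exists>r>0. \<forall>z\<in>carrier_vec d. 0 < norm2 (z - x) \<and> norm2 (z - x) < r \<longrightarrow>
      - e * norm2 (z - x) \<le> h z - h x - u \<bullet> (z - x)"
  proof (intro exI[of _ r'] conjI ballI impI)
    show "0 < r'" using r e by (auto simp: r'_def)
    fix z assume z: "z \<in> carrier_vec d" "0 < norm2 (z - x) \<and> norm2 (z - x) < r'"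
    then have "norm2 (z - x) * (2 * (\<bar>K\<bar> + 1)) \<le> e"
      by (simp add: r'_def pos_less_divide_eq)
    moreover have "K * norm2 (z - x) \<le> (\<bar>K\<bar> + 1) * norm2 (z - x)"
      by (rule mult_right_mono) auto
    ultimately have "K * norm2 (z - x) \<le> e / 2" by (simp add: algebra_simps)
    then have "K * norm2 (z - x) * norm2 (z - x) \<le> e / 2 * norm2 (z - x)"
      by (rule mult_right_mono) auto
    moreover have "- (e / 2) * norm2 (z - x) \<le> f z - f x - w \<bullet> (z - x)"
      using z by (intro w') (auto simp: r'_def)
    ultimately show "- e * norm2 (z - x) \<le> h z - h x - u \<bullet> (z - x)"
      using le[OF z(1)] by (simp add: power2_eq_square algebra_simps)
  qed
qed

text \<open>Convexity makes the local inequality global: apply it close to \<open>x\<close> on the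
  segment towards \<open>z\<close>, at parameter \<open>t\<close>, and divide by
  \<open>t\<close>.\<close>

lemma convex_subgradient_inequality:
  assumes cvx: "convex_on_vec d h" and u: "u \<in> frechet_subdifferential d h x"
    and x: "x \<in> carrier_vec d" and z: "z \<in> carrier_vec d"
  shows "h x + u \<bullet> (z - x) \<le> h z"
proof (cases "norm2 (z - x) = 0")
  case True
  then have "z - x = 0\<^sub>v d" using x z by (simp add: norm2_eq_0_iff[of _ d])
  moreover have "z = z - x + x" using x z by auto
  moreover have "u \<in> carrier_vec d" using u by (simp add: mem_frechet_subdifferential_iff)
  ultimately show ?thesis using x z by auto
next
  case False
  define p where "p = norm2 (z - x)"
  have p: "0 < p" using False norm2_nonneg[of "z - x"] unfolding p_def by linarith
  have uc: "u \<in> carrier_vec d" using u by (simp add: mem_frechet_subdifferential_iff)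
  have "u \<bullet> (z - x) \<le> h z - h x + e" if e: "0 < e" for e
  proof -
    \<comment> \<open>At distance \<open>t * p\<close> a tolerance of \<open>e / p\<close> per unit
      of length amounts to \<open>e * t\<close>, which becomes \<open>e\<close> after division by
      \<open>t\<close>.\<close>
    have ep: "0 < e / p" using e p by simp
    obtain r where r: "0 < r" and
      u': "\<And>y. y \<in> carrier_vec d \<Longrightarrow> 0 < norm2 (y - x) \<Longrightarrow> norm2 (y - x) < r \<Longrightarrow>
          - (e / p) * norm2 (y - x) \<le> h y - h x - u \<bullet> (y - x)"
      using u[unfolded mem_frechet_subdifferential_iff] ep by meson
    define t where "t = min 1 (r / (2 * p))"
    have t: "0 < t" "t \<le> 1" using r p by (auto simp: t_def)
    have "t * p \<le> r / (2 * p) * p" unfolding t_def using p by (intro mult_right_mono) auto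
    then have tr: "t * p < r" using p r by simp
    define y where "y = (1 - t) \<cdot>\<^sub>v x + t \<cdot>\<^sub>v z"
    have y: "y \<in> carrier_vec d" using x z by (simp add: y_def)
    have yx: "y - x = t \<cdot>\<^sub>v (z - x)"
      unfolding y_def using x z by (intro eq_vecI) (auto simp: algebra_simps)
    have "- (e / p) * norm2 (y - x) \<le> h y - h x - u \<bullet> (y - x)"
      using t p tr by (intro u' y) (simp_all add: yx p_def)
    then have "- (e * t) \<le> h y - h x - t * (u \<bullet> (z - x))"
      using t p uc x z by (simp add: yx flip: p_def)
    moreover have "h y \<le> (1 - t) * h x + t * h z"
      using cvx x z t unfolding convex_on_vec_def y_def by auto
    ultimately have "t * (u \<bullet> (z - x)) \<le> t * (h z - h x + e)" by (simp add: algebra_simps)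
    then show ?thesis using t by simp
  qed
  then have "u \<bullet> (z - x) \<le> h z - h x" by (rule field_le_epsilon)
  then show ?thesis by simp
qed

subsection \<open>The smallest singular value\<close>

lemma transpose_mult_scalar_prod:
  fixes X :: "real mat"
  assumes "X \<in> carrier_mat n d" "u \<in> carrier_vec d" "v \<in> carrier_vec d"
  shows "((transpose_mat X * X) *\<^sub>v u) \<bullet> v = (X *\<^sub>v u) \<bullet> (X *\<^sub>v v)"
proof -
  have "(transpose_mat X * X) *\<^sub>v u = transpose_mat X *\<^sub>v (X *\<^sub>v u)"
    using assms by (intro assoc_mult_mat_vec) auto
  then show ?thesis using assms by (simp add: transpose_vec_mult_scalar[of _ n d])
qed

text \<open>If the infimum of the Rayleigh quotient were not an eigenvalue, then the form shifted by it
  would be invertible and positive semidefinite, hence bounded below by a positive multiple of the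
  identity.\<close>

lemma gram_eigenvalue_le_rayleigh:
  fixes X :: "real mat"
  assumes X: "X \<in> carrier_mat n d" and d: "0 < d"
  obtains \<mu> where "0 \<le> \<mu>" "eigenvalue (transpose_mat X * X) \<mu>"
    "\<And>v. v \<in> carrier_vec d \<Longrightarrow> \<mu> * (norm2 v)\<^sup>2 \<le> (norm2 (X *\<^sub>v v))\<^sup>2"
proof -
  define M where "M = transpose_mat X * X"
  have M: "M \<in> carrier_mat d d" using X by (simp add: M_def)
  define R where "R = (\<lambda>v. (norm2 (X *\<^sub>v v))\<^sup>2 / (norm2 v)\<^sup>2) ` (carrier_vec d - {0\<^sub>v d})"
  have npos: "0 < (norm2 v)\<^sup>2" if "v \<in> carrier_vec d" "v \<noteq> 0\<^sub>v d" for v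
    using that by (simp add: norm2_eq_0_iff[of _ d])
  have "unit_vec d 0 \<in> carrier_vec d" "unit_vec d 0 \<noteq> (0\<^sub>v d :: real vec)"
    using d by (auto simp: unit_vec_def vec_eq_iff)
  then have ne: "R \<noteq> {}" unfolding R_def by blast
  have bdd: "bdd_below R" unfolding R_def by (intro bdd_belowI[of _ 0]) auto
  define \<mu> where "\<mu> = Inf R"
  have mu0: "0 \<le> \<mu>" unfolding \<mu>_def by (intro cInf_greatest ne) (auto simp: R_def)
  have mu: "\<mu> * (norm2 v)\<^sup>2 \<le> (norm2 (X *\<^sub>v v))\<^sup>2" if v: "v \<in> carrier_vec d" for v
  proof (cases "v = 0\<^sub>v d")
    case False
    then have "\<mu> \<le> (norm2 (X *\<^sub>v v))\<^sup>2 / (norm2 v)\<^sup>2"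
      unfolding \<mu>_def using v by (intro cInf_lower bdd) (auto simp: R_def)
    then show ?thesis using npos[OF v False] by (simp add: field_simps)
  qed simp
  have "eigenvalue M \<mu>"
  proof (rule ccontr)
    assume "\<not> eigenvalue M \<mu>"
    then have "det (char_matrix M \<mu>) \<noteq> 0" using eigenvalue_det[OF M] by simp
    then have "char_matrix M \<mu> \<in> Units (ring_mat TYPE(real) d ())"
      by (intro det_non_zero_imp_unit) (use M in auto)
    then obtain H where H: "H \<in> carrier_mat d d" and GH: "char_matrix M \<mu> * H = 1\<^sub>m d"
      unfolding Units_def ring_mat_def by auto
    obtain K where K: "0 \<le> K" "\<And>v. v \<in> carrier_vec d \<Longrightarrow> norm2 (H *\<^sub>v v) \<le> K * norm2 v"
      using norm2_mult_mat_vec_le[OF H] by blast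
    define s where "s = 1 / (K + 1)"
    have s: "0 < s" "s * K \<le> 1" using K by (auto simp: s_def field_simps)
    have gain: "(\<mu> + s) * (norm2 v)\<^sup>2 \<le> (norm2 (X *\<^sub>v v))\<^sup>2" if v: "v \<in> carrier_vec d" for v
    proof -
      define y where "y = H *\<^sub>v v"
      have y: "y \<in> carrier_vec d" using H v by (simp add: y_def)
      have "char_matrix M \<mu> *\<^sub>v y = (char_matrix M \<mu> * H) *\<^sub>v v"
        unfolding y_def using M H v by (intro assoc_mult_mat_vec[of _ d d _ d, symmetric]) auto
      then have "char_matrix M \<mu> *\<^sub>v y = v" using v by (simp add: GH)
      moreover have "char_matrix M \<mu> *\<^sub>v y = M *\<^sub>v y + (- \<mu>) \<cdot>\<^sub>v y"
        unfolding char_matrix_def using M y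
        by (subst add_mult_distrib_mat_vec[of _ d d]) (auto intro!: eq_vecI)
      ultimately have v_eq: "v = M *\<^sub>v y + (- \<mu>) \<cdot>\<^sub>v y" by simp
      have form: "v \<bullet> x = (X *\<^sub>v y) \<bullet> (X *\<^sub>v x) - \<mu> * (y \<bullet> x)" if x: "x \<in> carrier_vec d" for x
      proof -
        have "v \<bullet> x = (M *\<^sub>v y) \<bullet> x + ((- \<mu>) \<cdot>\<^sub>v y) \<bullet> x"
          using M x y by (subst v_eq) (intro add_scalar_prod_distrib, auto)
        moreover have "(M *\<^sub>v y) \<bullet> x = (X *\<^sub>v y) \<bullet> (X *\<^sub>v x)"
          unfolding M_def by (rule transpose_mult_scalar_prod[OF X y x])
        ultimately show ?thesis using x y by simp
      qed
      \<comment> \<open>Write Q for the shifted form, which is nonnegative at every vector. Since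
        \<open>y\<close> is the preimage of \<open>v\<close> under the shifted matrix, Q at
        \<open>z\<close> equals Q at \<open>v\<close>, minus \<open>2 * s\<close> times the squared
        norm of \<open>v\<close>, plus \<open>s\<^sup>2 * (v \<bullet> y)\<close>. As
        \<open>s * K \<le> 1\<close>, the last term returns at most half of the middle one, so Q at
        \<open>v\<close> is at least \<open>s\<close> times the squared norm.\<close>
      define z where "z = v - s \<cdot>\<^sub>v y"
      have Xv: "X *\<^sub>v v \<in> carrier_vec n" and Xy: "X *\<^sub>v y \<in> carrier_vec n" using X v y by auto
      have Xz: "X *\<^sub>v z = X *\<^sub>v v - s \<cdot>\<^sub>v (X *\<^sub>v y)"
        unfolding z_def using X v y by (simp add: mult_minus_distrib_mat_vec[of _ n d] mult_mat_vec)
      have "0 \<le> (norm2 (X *\<^sub>v z))\<^sup>2 - \<mu> * (norm2 z)\<^sup>2" using mu[of z] v y by (simp add: z_def)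
      also have "\<dots> = (norm2 (X *\<^sub>v v))\<^sup>2 - \<mu> * (norm2 v)\<^sup>2
          - 2 * s * ((X *\<^sub>v y) \<bullet> (X *\<^sub>v v) - \<mu> * (y \<bullet> v)) + s\<^sup>2 * ((X *\<^sub>v y) \<bullet> (X *\<^sub>v y) - \<mu> * (y \<bullet> y))"
        unfolding Xz unfolding z_def using Xv Xy v y
        by (simp add: norm2_diff_power2[of _ n] norm2_diff_power2[of _ d] power_mult_distrib
            comm_scalar_prod[of "X *\<^sub>v v" n "X *\<^sub>v y"] comm_scalar_prod[of v d y] norm2_power2[of y] norm2_power2[of "X *\<^sub>v y"] algebra_simps)
      also have "\<dots> = (norm2 (X *\<^sub>v v))\<^sup>2 - \<mu> * (norm2 v)\<^sup>2 - 2 * s * (norm2 v)\<^sup>2 + s\<^sup>2 * (v \<bullet> y)"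
        using form[OF v] form[OF y] by (simp add: norm2_power2)
      finally have 1: "0 \<le> \<dots>" .
      have "v \<bullet> y \<le> norm2 v * (K * norm2 v)"
        using abs_scalar_prod_le[OF v y] mult_left_mono[OF K(2)[OF v] norm2_nonneg[of v]]
        by (auto simp: y_def)
      then have "s\<^sup>2 * (v \<bullet> y) \<le> s\<^sup>2 * (norm2 v * (K * norm2 v))" by (rule mult_left_mono) simp
      also have "\<dots> = s * K * (s * (norm2 v)\<^sup>2)" by (simp add: power2_eq_square)
      also have "\<dots> \<le> 1 * (s * (norm2 v)\<^sup>2)" using s by (intro mult_right_mono) auto
      finally show ?thesis using 1 by (simp add: algebra_simps)
    qed
    have "\<mu> + s \<le> Inf R"
    proof (intro cInf_greatest ne)
      fix q assume "q \<in> R"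
      then obtain v where v: "v \<in> carrier_vec d" "v \<noteq> 0\<^sub>v d"
        and q: "q = (norm2 (X *\<^sub>v v))\<^sup>2 / (norm2 v)\<^sup>2" by (auto simp: R_def)
      show "\<mu> + s \<le> q" unfolding q using gain[OF v(1)] npos[OF v] by (simp add: pos_le_divide_eq)
    qed
    then show False using s by (simp add: \<mu>_def)
  qed
  then show ?thesis using that mu0 mu unfolding M_def by blast
qed

text \<open>Linear dependence speaks about the set of columns, so repeated columns have to be
  excluded first: with a repetition, a maximal independent set of columns has fewer than
  \<open>d\<close> elements, against the rank.\<close>

lemma full_column_rank_injective:
  fixes X :: "real mat"
  assumes X: "X \<in> carrier_mat n d" and rank: "vec_space.rank n X = d"
    and v: "v \<in> carrier_vec d" and Xv: "X *\<^sub>v v = 0\<^sub>v n"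
  shows "v = 0\<^sub>v d"
proof (rule ccontr)
  interpret vec_space "TYPE(real)" n .
  assume "v \<noteq> 0\<^sub>v d"
  have "distinct (cols X)"
  proof (rule ccontr)
    assume "\<not> distinct (cols X)"
    then have "card (set (cols X)) < d"
      using X card_distinct[of "cols X"] card_length[of "cols X"] by (metis carrier_matD(2) cols_length le_neq_implies_less)
    moreover obtain S where S: "maximal S (\<lambda>T. T \<subseteq> set (cols X) \<and> lin_indpt T)"
      using maximal_exists_superset[of "set (cols X)" "\<lambda>T. T \<subseteq> set (cols X) \<and> lin_indpt T" "{}"]
      by (auto simp: lin_dep_def)
    moreover have "card S \<le> card (set (cols X))" using S by (auto simp: maximal_def intro: card_mono)
    ultimately show False using rank_card_indpt[OF X S] rank by simp
  qed
  then show False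
    using lin_depI[OF X v \<open>v \<noteq> 0\<^sub>v d\<close> Xv] full_rank_lin_indpt[OF X rank] by blast
qed

text \<open>The minimum ranges over a finite set, because the squares are roots of the
  characteristic polynomial, and the set contains the square root of the eigenvalue below the
  Rayleigh quotient. Hence the squared minimum is below that quotient too. A zero minimum would give
  an eigenvector in the kernel of \<open>X\<close>.\<close>

lemma sigma_min_bounds:
  fixes X :: "real mat"
  assumes X: "X \<in> carrier_mat n d" and d: "0 < d" and rank: "vec_space.rank n X = d"
  shows "0 < sigma_min X"
    and "\<And>v. v \<in> carrier_vec d \<Longrightarrow> (sigma_min X)\<^sup>2 * (norm2 v)\<^sup>2 \<le> (norm2 (X *\<^sub>v v))\<^sup>2"
proof -
  define M where "M = transpose_mat X * X"
  have M: "M \<in> carrier_mat d d" using X by (simp add: M_def)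
  define S where "S = {s. 0 \<le> s \<and> eigenvalue M (s\<^sup>2)}"
  have sm: "sigma_min X = Min S" by (simp add: sigma_min_def S_def M_def)
  have "coeff (char_poly M) d = 1" using degree_monic_char_poly[OF M] by simp
  then have "char_poly M \<noteq> 0" by auto
  then have "finite {e. poly (char_poly M) e = 0}" by (rule poly_roots_finite)
  moreover have "S \<subseteq> sqrt ` {e. poly (char_poly M) e = 0}"
    unfolding S_def eigenvalue_root_char_poly[OF M]
    by (auto intro!: image_eqI[where x = "_\<^sup>2"])
  ultimately have fin: "finite S" by (meson finite_imageI finite_subset)
  obtain \<mu> where mu: "0 \<le> \<mu>" "eigenvalue M \<mu>"
    "\<And>v. v \<in> carrier_vec d \<Longrightarrow> \<mu> * (norm2 v)\<^sup>2 \<le> (norm2 (X *\<^sub>v v))\<^sup>2"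
    using gram_eigenvalue_le_rayleigh[OF X d] unfolding M_def by blast
  have mem: "sqrt \<mu> \<in> S" using mu by (simp add: S_def)
  then have "sigma_min X \<in> S" unfolding sm using fin by (intro Min_in) auto
  then have s0: "0 \<le> sigma_min X" and ev: "eigenvalue M ((sigma_min X)\<^sup>2)" by (auto simp: S_def)
  have "sigma_min X \<le> sqrt \<mu>" unfolding sm by (rule Min_le[OF fin mem])
  then have "(sigma_min X)\<^sup>2 \<le> (sqrt \<mu>)\<^sup>2" using s0 by (rule power_mono)
  then have le: "(sigma_min X)\<^sup>2 \<le> \<mu>" using mu by simp
  show "(sigma_min X)\<^sup>2 * (norm2 v)\<^sup>2 \<le> (norm2 (X *\<^sub>v v))\<^sup>2" if "v \<in> carrier_vec d" for v
    using mult_right_mono[OF le, of "(norm2 v)\<^sup>2"] mu(3)[OF that] by simp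
  have "sigma_min X \<noteq> 0"
  proof
    assume "sigma_min X = 0"
    with ev obtain v where v: "v \<in> carrier_vec d" "v \<noteq> 0\<^sub>v d" "M *\<^sub>v v = 0 \<cdot>\<^sub>v v"
      using M unfolding eigenvalue_def eigenvector_def by auto
    have "(norm2 (X *\<^sub>v v))\<^sup>2 = (M *\<^sub>v v) \<bullet> v"
      unfolding M_def transpose_mult_scalar_prod[OF X v(1) v(1)] by (simp add: norm2_power2)
    also have "\<dots> = 0" using v by simp
    finally have "X *\<^sub>v v = 0\<^sub>v n" using X v by (simp add: norm2_eq_0_iff[of _ n])
    then show False using full_column_rank_injective[OF X rank v(1)] v(2) by simp
  qed
  then show "0 < sigma_min X" using s0 by simp
qed

subsection \<open>Critical points and minimizers\<close>

text \<open>Half the squared residual has gradient minus \<open>X\<close> transposed times the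
  residual, and its second-order remainder is half the squared length of
  \<open>X *\<^sub>v v\<close>. The sum rule therefore moves subgradients from the objective to
  \<open>h\<close>.\<close>

lemma residual_subgradient:
  assumes X: "X \<in> carrier_mat n d" and y: "y \<in> carrier_vec n" and x: "x \<in> carrier_vec d"
    and w: "w \<in> frechet_subdifferential d (regularized_ls X y h) x"
  shows "w + transpose_mat X *\<^sub>v (y - X *\<^sub>v x) \<in> frechet_subdifferential d h x"
proof -
  have wc: "w \<in> carrier_vec d" using w by (simp add: mem_frechet_subdifferential_iff)
  obtain K where K: "0 \<le> K" "\<And>v. v \<in> carrier_vec d \<Longrightarrow> norm2 (X *\<^sub>v v) \<le> K * norm2 v"
    using norm2_mult_mat_vec_le[OF X] by blast
  show ?thesis
  proof (rule frechet_subdifferential_perturb[OF w, where K = "K\<^sup>2"])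
    show "w + transpose_mat X *\<^sub>v (y - X *\<^sub>v x) \<in> carrier_vec d" using wc X y x by simp
    fix z :: "real vec" assume z: "z \<in> carrier_vec d"
    define r where "r = y - X *\<^sub>v x"
    define v where "v = z - x"
    have r: "r \<in> carrier_vec n" and v: "v \<in> carrier_vec d" using X y x z by (auto simp: r_def v_def)
    have Xv: "X *\<^sub>v v \<in> carrier_vec n" using X v by simp
    have "y - X *\<^sub>v z = r - X *\<^sub>v v"
      unfolding r_def v_def using X y x z
      by (auto simp: mult_minus_distrib_mat_vec[of _ n d] intro!: eq_vecI)
    then have "regularized_ls X y h z - regularized_ls X y h x
        = h z - h x - r \<bullet> (X *\<^sub>v v) + (norm2 (X *\<^sub>v v))\<^sup>2 / 2"
      unfolding regularized_ls_def r_def[symmetric]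
      by (simp add: norm2_diff_power2[OF r Xv] field_simps)
    moreover have "(w + transpose_mat X *\<^sub>v r) \<bullet> v = w \<bullet> v + r \<bullet> (X *\<^sub>v v)"
      using wc X r v by (simp add: add_scalar_prod_distrib[of _ d] transpose_vec_mult_scalar[of _ n d])
    moreover have "(norm2 (X *\<^sub>v v))\<^sup>2 / 2 \<le> K\<^sup>2 * (norm2 v)\<^sup>2"
    proof -
      have "(norm2 (X *\<^sub>v v))\<^sup>2 \<le> (K * norm2 v)\<^sup>2" by (rule power_mono[OF K(2)[OF v]]) simp
      moreover have "0 \<le> (norm2 (X *\<^sub>v v))\<^sup>2" by simp
      ultimately show ?thesis unfolding power_mult_distrib by linarith
    qed
    ultimately show "regularized_ls X y h z - regularized_ls X y h x - w \<bullet> (z - x)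
        \<le> h z - h x - (w + transpose_mat X *\<^sub>v (y - X *\<^sub>v x)) \<bullet> (z - x) + K\<^sup>2 * (norm2 (z - x))\<^sup>2"
      unfolding r_def[symmetric] v_def[symmetric] by simp
  qed
qed

text \<open>Fermat's rule gives the zero subgradient of the objective at the minimizer; the sum rule
  then splits off the linear term and the sketched quadratic one.\<close>

lemma sro_minimizer_subgradient:
  assumes X: "X \<in> carrier_mat n d" and P: "P \<in> carrier_mat m n" and y: "y \<in> carrier_vec n"
    and b': "b' \<in> carrier_vec d"
    and min: "is_arg_min (sro_objective X y h P b') (\<lambda>z. z \<in> carrier_vec d) b"
  shows "transpose_mat X *\<^sub>v (y - X *\<^sub>v b') - transpose_mat (P * X) *\<^sub>v ((P * X) *\<^sub>v (b - b'))
    \<in> frechet_subdifferential d h b"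
proof -
  define F where "F = sro_objective X y h P b'"
  define A where "A = P * X"
  define r where "r = y - X *\<^sub>v b'"
  have le: "F b \<le> F z" if "z \<in> carrier_vec d" for z
    using min that unfolding is_arg_min_linorder F_def by auto
  have b: "b \<in> carrier_vec d" using min unfolding is_arg_min_linorder by auto
  have A: "A \<in> carrier_mat m d" using P X by (simp add: A_def)
  have r: "r \<in> carrier_vec n" using X y b' by (simp add: r_def)
  define a where "a = A *\<^sub>v (b - b')"
  have a: "a \<in> carrier_vec m" using A b b' by (simp add: a_def)
  obtain K where K: "0 \<le> K" "\<And>v. v \<in> carrier_vec d \<Longrightarrow> norm2 (A *\<^sub>v v) \<le> K * norm2 v"
    using norm2_mult_mat_vec_le[OF A] by blast
  have "0\<^sub>v d \<in> frechet_subdifferential d F b"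
    unfolding mem_frechet_subdifferential_iff
  proof (intro conjI allI impI)
    fix e :: real assume e: "0 < e"
    have *: "- e * norm2 (z - b) \<le> F z - F b - 0\<^sub>v d \<bullet> (z - b)" if z: "z \<in> carrier_vec d" for z
    proof -
      have "0 \<le> e * norm2 (z - b)" using e by simp
      then show ?thesis using le[OF z] z b by simp
    qed
    show "\<exists>r>0. \<forall>z\<in>carrier_vec d. 0 < norm2 (z - b) \<and> norm2 (z - b) < r \<longrightarrow>
        - e * norm2 (z - b) \<le> F z - F b - 0\<^sub>v d \<bullet> (z - b)"
      by (rule exI[of _ "1::real"], rule conjI, simp, intro ballI impI, rule *)
  qed simp
  then have "transpose_mat X *\<^sub>v r - transpose_mat A *\<^sub>v a \<in> frechet_subdifferential d h b"
  proof (rule frechet_subdifferential_perturb[where K = "K\<^sup>2"])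
    show "transpose_mat X *\<^sub>v r - transpose_mat A *\<^sub>v a \<in> carrier_vec d" using X A r a by simp
    fix z :: "real vec" assume z: "z \<in> carrier_vec d"
    define v where "v = z - b"
    have v: "v \<in> carrier_vec d" using z b by (simp add: v_def)
    have Av: "A *\<^sub>v v \<in> carrier_vec m" using A v by simp
    have "z - b' = (b - b') + v" unfolding v_def using z b b' by (intro eq_vecI) auto
    then have 1: "A *\<^sub>v (z - b') = a + A *\<^sub>v v"
      unfolding a_def using A b b' v by (simp add: mult_add_distrib_mat_vec[of _ m d])
    have "z = b + v" unfolding v_def using z b by (intro eq_vecI) auto
    then have 2: "r \<bullet> (X *\<^sub>v z) = r \<bullet> (X *\<^sub>v b) + r \<bullet> (X *\<^sub>v v)"
      using X b v r by (simp add: mult_add_distrib_mat_vec[of _ n d] scalar_prod_add_distrib[of _ n])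
    have "F z - F b = h z - h b + a \<bullet> (A *\<^sub>v v) + (norm2 (A *\<^sub>v v))\<^sup>2 / 2 - r \<bullet> (X *\<^sub>v v)"
      unfolding F_def sro_objective_def A_def[symmetric] r_def[symmetric] 1 2 a_def[symmetric]
      by (simp add: norm2_add_power2[OF a Av] field_simps)
    moreover have "(transpose_mat X *\<^sub>v r - transpose_mat A *\<^sub>v a) \<bullet> v = r \<bullet> (X *\<^sub>v v) - a \<bullet> (A *\<^sub>v v)"
      using X A r a v by (simp add: minus_scalar_prod_distrib[of _ d]
          transpose_vec_mult_scalar[of _ n d] transpose_vec_mult_scalar[of _ m d])
    moreover have "(norm2 (A *\<^sub>v v))\<^sup>2 / 2 \<le> K\<^sup>2 * (norm2 v)\<^sup>2"
    proof -
      have "(norm2 (A *\<^sub>v v))\<^sup>2 \<le> (K * norm2 v)\<^sup>2" by (rule power_mono[OF K(2)[OF v]]) simp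
      moreover have "0 \<le> (norm2 (A *\<^sub>v v))\<^sup>2" by simp
      ultimately show ?thesis unfolding power_mult_distrib by linarith
    qed
    ultimately show "F z - F b - 0\<^sub>v d \<bullet> (z - b)
        \<le> h z - h b - (transpose_mat X *\<^sub>v r - transpose_mat A *\<^sub>v a) \<bullet> (z - b) + K\<^sup>2 * (norm2 (z - b))\<^sup>2"
      unfolding v_def[symmetric] using v by simp
  qed
  then show ?thesis by (simp add: r_def a_def A_def)
qed

text \<open>In the convex case the bound is monotonicity of the subdifferential; in the smooth case it is
  Cauchy-Schwarz.  A limiting subgradient inherits either from the Frechet subgradients nearby.\<close>

lemma subgradient_weakly_monotone:
  assumes X: "X \<in> carrier_mat n d" and y: "y \<in> carrier_vec n" and d: "0 < d"
    and crit: "critical_point d (regularized_ls X y h) x"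
    and reg: "convex_on_vec d h \<or>
      (\<exists>L. frechet_subdifferential_smooth d L h \<and> vec_space.rank n X = d \<and> L / (sigma_min X)\<^sup>2 \<le> \<kappa>)"
    and \<kappa>: "0 \<le> \<kappa>" and w: "w \<in> frechet_subdifferential d h b" and b: "b \<in> carrier_vec d"
  shows "- \<kappa> * (norm2 (X *\<^sub>v (b - x)))\<^sup>2 \<le> (w - transpose_mat X *\<^sub>v (y - X *\<^sub>v x)) \<bullet> (b - x)"
proof -
  have x: "x \<in> carrier_vec d" using crit by (simp add: critical_point_def)
  have wc: "w \<in> carrier_vec d" using w by (simp add: mem_frechet_subdifferential_iff)
  obtain xs us where xs: "\<And>k. xs k \<in> carrier_vec d"
    and us: "\<And>k. us k \<in> frechet_subdifferential d (regularized_ls X y h) (xs k)"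
    and lims: "(\<lambda>k. norm2 (xs k - x)) \<longlonglongrightarrow> 0" "(\<lambda>k. norm2 (us k - 0\<^sub>v d)) \<longlonglongrightarrow> 0"
    and limf: "(\<lambda>k. regularized_ls X y h (xs k)) \<longlonglongrightarrow> regularized_ls X y h x"
    using crit unfolding critical_point_def limiting_subdifferential_def by blast
  have usc: "us k \<in> carrier_vec d" for k using us[of k] by (simp add: mem_frechet_subdifferential_iff)
  have xlim: "(\<lambda>k. xs k $ i) \<longlonglongrightarrow> x $ i" if "i < d" for i
    using tendsto_index_of_norm2[OF xs x lims(1) that] .
  have ulim: "(\<lambda>k. us k $ i) \<longlonglongrightarrow> 0" if "i < d" for i
    using tendsto_index_of_norm2[OF usc zero_carrier_vec lims(2) that] that by simp
  have Xt: "transpose_mat X \<in> carrier_mat d n" using X by simp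
  define res where "res z = y - X *\<^sub>v z" for z
  have resc: "res z \<in> carrier_vec n" if "z \<in> carrier_vec d" for z using X y that by (simp add: res_def)
  have reslim: "(\<lambda>k. res (xs k) $ i) \<longlonglongrightarrow> res x $ i" if i: "i < n" for i
  proof -
    have "(\<lambda>k. y $ i - (X *\<^sub>v xs k) $ i) \<longlonglongrightarrow> y $ i - (X *\<^sub>v x) $ i"
      using i by (intro tendsto_intros tendsto_mult_mat_vec[OF X xs x]) (auto intro: xlim)
    then show ?thesis using i X y by (simp add: res_def)
  qed
  \<comment> \<open>Since \<open>us k\<close> tends to 0, \<open>v\<close> is the limit of genuine
    Frechet subgradients \<open>vs k\<close> of \<open>h\<close> at the points
    \<open>xs k\<close>.\<close>
  define v where "v = transpose_mat X *\<^sub>v res x"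
  define vs where "vs k = us k + transpose_mat X *\<^sub>v res (xs k)" for k
  have vc: "v \<in> carrier_vec d" and vsc: "vs k \<in> carrier_vec d" for k
    using Xt resc[OF x] resc[OF xs] usc by (auto simp: v_def vs_def)
  have vs: "vs k \<in> frechet_subdifferential d h (xs k)" for k
    using residual_subgradient[OF X y xs us] by (simp add: vs_def res_def)
  have vlim: "(\<lambda>k. vs k $ i) \<longlonglongrightarrow> v $ i" if i: "i < d" for i
  proof -
    have "(\<lambda>k. us k $ i + (transpose_mat X *\<^sub>v res (xs k)) $ i)
        \<longlonglongrightarrow> 0 + (transpose_mat X *\<^sub>v res x) $ i"
      using i by (intro tendsto_intros ulim tendsto_mult_mat_vec[OF Xt resc[OF xs] resc[OF x]])
        (auto intro: reslim)
    then show ?thesis using i Xt usc by (simp add: vs_def v_def)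
  qed
  have "- \<kappa> * (norm2 (X *\<^sub>v (b - x)))\<^sup>2 \<le> (w - v) \<bullet> (b - x)"
    using reg
  proof
    assume cvx: "convex_on_vec d h"
    \<comment> \<open>Convergence of \<open>h\<close> along the sequence is read off from the
      convergence of the objective values, which is part of the limiting subdifferential, and from
      the continuity of the residual term.\<close>
    have "(\<lambda>k. regularized_ls X y h (xs k) - (norm2 (res (xs k)))\<^sup>2 / 2)
        \<longlonglongrightarrow> regularized_ls X y h x - (norm2 (res x))\<^sup>2 / 2"
      by (intro tendsto_intros limf tendsto_norm2[OF resc[OF xs] resc[OF x]]) (auto intro: reslim)
    then have hlim: "(\<lambda>k. h (xs k)) \<longlonglongrightarrow> h x" by (simp add: regularized_ls_def res_def)
    have "(\<lambda>k. h (xs k) + vs k \<bullet> (b - xs k)) \<longlonglongrightarrow> h x + v \<bullet> (b - x)"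
    proof (intro tendsto_intros hlim tendsto_scalar_prod[OF vsc _ vc])
      fix i assume "i < d"
      then have "(\<lambda>k. b $ i - xs k $ i) \<longlonglongrightarrow> b $ i - x $ i" by (intro tendsto_intros xlim)
      moreover have "(b - xs k) $ i = b $ i - xs k $ i" "(b - x) $ i = b $ i - x $ i" for k
        using \<open>i < d\<close> xs[of k] x by auto
      ultimately show "(\<lambda>k. (b - xs k) $ i) \<longlonglongrightarrow> (b - x) $ i" by simp
    qed (use b xs x vlim in auto)
    then have "h x + v \<bullet> (b - x) \<le> h b"
      by (rule LIMSEQ_le_const2) (use convex_subgradient_inequality[OF cvx vs xs b] in auto)
    moreover have "h b + w \<bullet> (x - b) \<le> h x" by (rule convex_subgradient_inequality[OF cvx w b x])
    moreover have "(w - v) \<bullet> (b - x) = - (w \<bullet> (x - b)) - v \<bullet> (b - x)"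
      using wc vc b x
      by (simp add: minus_scalar_prod_distrib[of _ d] scalar_prod_minus_distrib[of _ d])
    ultimately have "0 \<le> (w - v) \<bullet> (b - x)" by linarith
    moreover have "0 \<le> \<kappa> * (norm2 (X *\<^sub>v (b - x)))\<^sup>2" using \<kappa> by simp
    ultimately show ?thesis by linarith
  next
    assume "\<exists>L. frechet_subdifferential_smooth d L h \<and> vec_space.rank n X = d \<and> L / (sigma_min X)\<^sup>2 \<le> \<kappa>"
    then obtain L where sm: "frechet_subdifferential_smooth d L h" and rank: "vec_space.rank n X = d"
      and L: "L / (sigma_min X)\<^sup>2 \<le> \<kappa>" by blast
    have "norm2 (w - v) \<le> L * norm2 (b - x)"
    proof (rule LIMSEQ_le)
      show "(\<lambda>k. norm2 (w - vs k)) \<longlonglongrightarrow> norm2 (w - v)"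
      proof (rule tendsto_norm2)
        fix i assume "i < d"
        then have "(\<lambda>k. w $ i - vs k $ i) \<longlonglongrightarrow> w $ i - v $ i" by (intro tendsto_intros vlim)
        moreover have "(w - vs k) $ i = w $ i - vs k $ i" "(w - v) $ i = w $ i - v $ i" for k
          using \<open>i < d\<close> vsc[of k] vc by auto
        ultimately show "(\<lambda>k. (w - vs k) $ i) \<longlonglongrightarrow> (w - v) $ i" by simp
      qed (use wc vsc vc in auto)
      show "(\<lambda>k. L * norm2 (b - xs k)) \<longlonglongrightarrow> L * norm2 (b - x)"
      proof (intro tendsto_intros tendsto_norm2)
        fix i assume "i < d"
        then have "(\<lambda>k. b $ i - xs k $ i) \<longlonglongrightarrow> b $ i - x $ i" by (intro tendsto_intros xlim)
        moreover have "(b - xs k) $ i = b $ i - xs k $ i" "(b - x) $ i = b $ i - x $ i" for k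
          using \<open>i < d\<close> xs[of k] x by auto
        ultimately show "(\<lambda>k. (b - xs k) $ i) \<longlonglongrightarrow> (b - x) $ i" by simp
      qed (use b xs x in auto)
      show "\<exists>N. \<forall>k\<ge>N. norm2 (w - vs k) \<le> L * norm2 (b - xs k)"
        using sm[unfolded frechet_subdifferential_smooth_def, rule_format, OF b xs w vs] by blast
    qed
    then have "norm2 (w - v) * norm2 (b - x) \<le> L * norm2 (b - x) * norm2 (b - x)"
      by (rule mult_right_mono) simp
    moreover have "\<bar>(w - v) \<bullet> (b - x)\<bar> \<le> norm2 (w - v) * norm2 (b - x)"
      by (rule abs_scalar_prod_le[of _ d]) (use wc vc b x in auto)
    ultimately have "- (L * (norm2 (b - x))\<^sup>2) \<le> (w - v) \<bullet> (b - x)"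
      by (simp add: power2_eq_square abs_le_iff)
    moreover have "L * (norm2 (b - x))\<^sup>2 \<le> \<kappa> * (norm2 (X *\<^sub>v (b - x)))\<^sup>2"
    proof -
      have s: "0 < (sigma_min X)\<^sup>2" using sigma_min_bounds(1)[OF X d rank] by simp
      then have "L \<le> \<kappa> * (sigma_min X)\<^sup>2" using L by (simp add: pos_divide_le_eq)
      then have "L * (norm2 (b - x))\<^sup>2 \<le> \<kappa> * (sigma_min X)\<^sup>2 * (norm2 (b - x))\<^sup>2"
        by (rule mult_right_mono) simp
      also have "\<dots> \<le> \<kappa> * (norm2 (X *\<^sub>v (b - x)))\<^sup>2"
        using mult_left_mono[OF sigma_min_bounds(2)[OF X d rank, of "b - x"] \<kappa>] b x
        by (simp add: mult.assoc)
      finally show ?thesis .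
    qed
    ultimately show ?thesis by linarith
  qed
  then show ?thesis by (simp add: v_def res_def)
qed

subsection \<open>Contraction of the iteration\<close>

text \<open>The interface between the deterministic contraction and the probabilistic bounds: each
  random sketch is shown to satisfy this event with \<open>A\<close> equal to \<open>P * X\<close>,
  and nothing else about the sketch enters the iteration.\<close>

definition sketch_distortion :: "real mat \<Rightarrow> real mat \<Rightarrow> real \<Rightarrow> bool" where
  "sketch_distortion A X \<epsilon> \<longleftrightarrow> (\<forall>c\<in>carrier_vec (dim_col X).
     \<bar>(norm2 (A *\<^sub>v c))\<^sup>2 - (norm2 (X *\<^sub>v c))\<^sup>2\<bar> \<le> \<epsilon> * (norm2 (X *\<^sub>v c))\<^sup>2)"

lemma sro_step_contracts:
  assumes X: "X \<in> carrier_mat n d" and P: "P \<in> carrier_mat m n" and y: "y \<in> carrier_vec n"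
    and d: "0 < d" and crit: "critical_point d (regularized_ls X y h) x"
    and reg: "convex_on_vec d h \<or>
      (\<exists>L. frechet_subdifferential_smooth d L h \<and> vec_space.rank n X = d \<and> L / (sigma_min X)\<^sup>2 \<le> \<kappa>)"
    and \<kappa>: "0 \<le> \<kappa>" and \<epsilon>: "0 \<le> \<epsilon>" "\<epsilon> < 1 - \<kappa>"
    and dist: "sketch_distortion (P * X) X \<epsilon>"
    and b': "b' \<in> carrier_vec d"
    and min: "is_arg_min (sro_objective X y h P b') (\<lambda>z. z \<in> carrier_vec d) b"
  shows "norm2 (X *\<^sub>v (b - x)) \<le> \<epsilon> / (1 - \<kappa> - \<epsilon>) * norm2 (X *\<^sub>v (b' - x))"
proof -
  define A where "A = P * X"
  have A: "A \<in> carrier_mat m d" using P X by (simp add: A_def)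
  have b: "b \<in> carrier_vec d" using min unfolding is_arg_min_linorder by auto
  have x: "x \<in> carrier_vec d" using crit by (simp add: critical_point_def)
  have D: "\<bar>(norm2 (A *\<^sub>v c))\<^sup>2 - (norm2 (X *\<^sub>v c))\<^sup>2\<bar> \<le> \<epsilon> * (norm2 (X *\<^sub>v c))\<^sup>2"
    if "c \<in> carrier_vec d" for c
    using dist that X unfolding sketch_distortion_def A_def by auto
  define e where "e = b - x"
  define e' where "e' = b' - x"
  have e: "e \<in> carrier_vec d" and e': "e' \<in> carrier_vec d" using b b' x by (auto simp: e_def e'_def)
  have Xe: "X *\<^sub>v e \<in> carrier_vec n" "X *\<^sub>v e' \<in> carrier_vec n"
    and Ae: "A *\<^sub>v e \<in> carrier_vec m" "A *\<^sub>v e' \<in> carrier_vec m" using X A e e' by auto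
  define r where "r = y - X *\<^sub>v x"
  have r: "r \<in> carrier_vec n" using y X x by (simp add: r_def)
  have bb: "b - b' = e - e'" unfolding e_def e'_def using b b' x by (intro eq_vecI) auto
  \<comment> \<open>Splitting the residual at \<open>x\<close> off from the one at \<open>b'\<close>
    makes the data vector disappear: the terms with \<open>r\<close> cancel in the pairing with
    \<open>e\<close> below.\<close>
  have "b' = x + e'" unfolding e'_def using b' x by (intro eq_vecI) auto
  then have yb: "y - X *\<^sub>v b' = r - X *\<^sub>v e'"
    unfolding r_def using X y x e'
    by (auto simp: mult_add_distrib_mat_vec[of _ n d] intro!: eq_vecI)
  define w where "w = transpose_mat X *\<^sub>v (y - X *\<^sub>v b') - transpose_mat A *\<^sub>v (A *\<^sub>v (b - b'))"
  have w: "w \<in> frechet_subdifferential d h b"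
    using sro_minimizer_subgradient[OF X P y b' min] by (simp add: w_def A_def)
  have "(w - transpose_mat X *\<^sub>v r) \<bullet> e = w \<bullet> e - r \<bullet> (X *\<^sub>v e)"
    using w X e r by (simp add: mem_frechet_subdifferential_iff minus_scalar_prod_distrib[of _ d]
        transpose_vec_mult_scalar[of _ n d])
  also have "w \<bullet> e = (r - X *\<^sub>v e') \<bullet> (X *\<^sub>v e) - (A *\<^sub>v e - A *\<^sub>v e') \<bullet> (A *\<^sub>v e)"
    unfolding w_def yb bb using X A r e e'
    by (simp add: minus_scalar_prod_distrib[of "transpose_mat X *\<^sub>v _" d] mult_minus_distrib_mat_vec[of A m d]
        transpose_vec_mult_scalar[of X n d] transpose_vec_mult_scalar[of A m d])
  also have "\<dots> - r \<bullet> (X *\<^sub>v e) = - ((X *\<^sub>v e') \<bullet> (X *\<^sub>v e)) - (norm2 (A *\<^sub>v e))\<^sup>2 + (A *\<^sub>v e') \<bullet> (A *\<^sub>v e)"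
    using r Xe Ae by (simp add: minus_scalar_prod_distrib[of _ n] minus_scalar_prod_distrib[of _ m] norm2_power2)
  finally have "- \<kappa> * (norm2 (X *\<^sub>v e))\<^sup>2
      \<le> - ((X *\<^sub>v e') \<bullet> (X *\<^sub>v e)) - (norm2 (A *\<^sub>v e))\<^sup>2 + (A *\<^sub>v e') \<bullet> (A *\<^sub>v e)"
    using subgradient_weakly_monotone[OF X y d crit reg \<kappa> w b] by (simp add: e_def r_def)
  moreover have "\<bar>(A *\<^sub>v e') \<bullet> (A *\<^sub>v e) - (X *\<^sub>v e') \<bullet> (X *\<^sub>v e)\<bar>
      \<le> \<epsilon> * norm2 (X *\<^sub>v e') * norm2 (X *\<^sub>v e)"
    by (rule abs_scalar_prod_distortion_le[OF A X \<epsilon>(1) D e' e])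
  \<comment> \<open>The distortion enters twice: through the lower bound
    \<open>(1 - \<epsilon>)\<close> for the sketched square of \<open>e\<close>, and through the
    polarized bound for the mixed terms.\<close>
  ultimately have "(1 - \<kappa> - \<epsilon>) * norm2 (X *\<^sub>v e) * norm2 (X *\<^sub>v e)
      \<le> \<epsilon> * norm2 (X *\<^sub>v e') * norm2 (X *\<^sub>v e)"
    using D[OF e] by (simp add: abs_le_iff power2_eq_square algebra_simps)
  then have "(1 - \<kappa> - \<epsilon>) * norm2 (X *\<^sub>v e) \<le> \<epsilon> * norm2 (X *\<^sub>v e')"
    using \<epsilon> norm2_nonneg[of "X *\<^sub>v e"]
    by (cases "norm2 (X *\<^sub>v e) = 0") (auto simp: mult_le_cancel_right)
  then show ?thesis using \<epsilon> by (simp add: e_def e'_def field_simps)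
qed

lemma iterative_sro_converges:
  assumes X: "X \<in> carrier_mat n d" and P: "P \<in> carrier_mat m n" and y: "y \<in> carrier_vec n"
    and d: "0 < d" and crit: "critical_point d (regularized_ls X y h) x"
    and reg: "convex_on_vec d h \<or>
      (\<exists>L. frechet_subdifferential_smooth d L h \<and> vec_space.rank n X = d \<and> L / (sigma_min X)\<^sup>2 \<le> \<kappa>)"
    and \<kappa>: "0 \<le> \<kappa>" and \<epsilon>: "0 \<le> \<epsilon>" "\<epsilon> < 1 - \<kappa>"
    and dist: "sketch_distortion (P * X) X \<epsilon>"
    and run: "iterative_sro d X y h P N \<beta>"
  shows "matrix_norm_of X (\<beta> N - x) \<le> (\<epsilon> / (1 - \<kappa> - \<epsilon>)) ^ N * matrix_norm_of X x"
proof -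
  define \<rho> where "\<rho> = \<epsilon> / (1 - \<kappa> - \<epsilon>)"
  have \<rho>: "0 \<le> \<rho>" using \<epsilon> by (simp add: \<rho>_def)
  have x: "x \<in> carrier_vec d" using crit by (simp add: critical_point_def)
  have "\<beta> 0 = 0\<^sub>v d" using run by (simp add: iterative_sro_def)
  have min: "is_arg_min (sro_objective X y h P (\<beta> t)) (\<lambda>z. z \<in> carrier_vec d) (\<beta> (Suc t))"
    if "t < N" for t
  proof -
    have "Suc t \<in> {1..N}" using that by simp
    then show ?thesis using run unfolding iterative_sro_def by (metis diff_Suc_1)
  qed
  have "\<beta> t \<in> carrier_vec d \<and> norm2 (X *\<^sub>v (\<beta> t - x)) \<le> \<rho> ^ t * norm2 (X *\<^sub>v x)" if "t \<le> N" for t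
    using that
  proof (induction t)
    case 0
    have "0\<^sub>v d - x = (- 1) \<cdot>\<^sub>v x" using x by (intro eq_vecI) auto
    then have "X *\<^sub>v (0\<^sub>v d - x) = (- 1) \<cdot>\<^sub>v (X *\<^sub>v x)" using X x by (simp only: mult_mat_vec)
    then show ?case by (simp only: \<open>\<beta> 0 = 0\<^sub>v d\<close> norm2_smult) simp
  next
    case (Suc t)
    then have IH: "\<beta> t \<in> carrier_vec d" "norm2 (X *\<^sub>v (\<beta> t - x)) \<le> \<rho> ^ t * norm2 (X *\<^sub>v x)"
      and m: "is_arg_min (sro_objective X y h P (\<beta> t)) (\<lambda>z. z \<in> carrier_vec d) (\<beta> (Suc t))"
      using min[of t] by auto
    have "norm2 (X *\<^sub>v (\<beta> (Suc t) - x)) \<le> \<rho> * norm2 (X *\<^sub>v (\<beta> t - x))"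
      unfolding \<rho>_def by (rule sro_step_contracts[OF X P y d crit reg \<kappa> \<epsilon> dist IH(1) m])
    also have "\<dots> \<le> \<rho> * (\<rho> ^ t * norm2 (X *\<^sub>v x))" by (rule mult_left_mono[OF IH(2) \<rho>])
    finally show ?case using m by (simp add: is_arg_min_linorder)
  qed
  then show ?thesis unfolding matrix_norm_of_def \<rho>_def by simp
qed

subsection \<open>Orthonormal bases of column spaces\<close>

text \<open>A maximal independent set of columns has as many elements as the rank, and by maximality
  every column already lies in its span.\<close>

lemma ex_basis_of_columns:
  fixes X :: "real mat"
  assumes X: "X \<in> carrier_mat n d"
  obtains S where "S \<subseteq> carrier_vec n" "finite S" "card S = vec_space.rank n X"
    "\<not> LinearCombinations.module.lin_dep class_ring (module_vec TYPE(real) n) S"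
    "LinearCombinations.module.span class_ring (module_vec TYPE(real) n) S
      = LinearCombinations.module.span class_ring (module_vec TYPE(real) n) (set (cols X))"
proof -
  interpret vec_space "TYPE(real)" n .
  have cX: "set (cols X) \<subseteq> carrier_vec n" using X cols_dim by blast
  obtain S where S: "maximal S (\<lambda>T. T \<subseteq> set (cols X) \<and> lin_indpt T)"
    using maximal_exists_superset[of "set (cols X)" "\<lambda>T. T \<subseteq> set (cols X) \<and> lin_indpt T" "{}"]
    by (auto simp: lin_dep_def)
  then have sub: "S \<subseteq> set (cols X)" and ind: "lin_indpt S"
    and max: "\<And>T. S \<subseteq> T \<Longrightarrow> T \<subseteq> set (cols X) \<Longrightarrow> lin_indpt T \<Longrightarrow> T = S"
    by (auto simp: maximal_def)
  have SV: "S \<subseteq> carrier_vec n" using sub cX by blast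
  have fin: "finite S" using sub finite_subset by blast
  have "s \<in> span S" if s: "s \<in> set (cols X)" for s
  proof (rule ccontr)
    assume ns: "s \<notin> span S"
    then have "s \<notin> S" using SV span_mem by blast
    have "lin_indpt (insert s S)"
      using lin_dep_iff_in_span[of S s] SV ind s cX ns \<open>s \<notin> S\<close> by auto
    then have "insert s S = S" using s sub by (intro max) auto
    then show False using \<open>s \<notin> S\<close> by blast
  qed
  then have "span (set (cols X)) \<subseteq> span S"
    using SV span_is_submodule by (intro span_is_subset) auto
  then have "span S = span (set (cols X))" using span_is_monotone[OF sub] by blast
  then show thesis using that SV fin rank_card_indpt[OF X S] ind by auto
qed

text \<open>Trading the \<open>d\<close> columns of \<open>X\<close> for as many orthonormal ones as
  the rank is what puts the rank into the sketch sizes.\<close>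

lemma ex_orthonormal_column_basis:
  fixes X :: "real mat"
  assumes X: "X \<in> carrier_mat n d"
  obtains U where "U \<in> carrier_mat n (vec_space.rank n X)"
    "transpose_mat U * U = 1\<^sub>m (vec_space.rank n X)"
    "\<And>b. b \<in> carrier_vec d \<Longrightarrow> \<exists>c\<in>carrier_vec (vec_space.rank n X). X *\<^sub>v b = U *\<^sub>v c"
proof -
  define r where "r = vec_space.rank n X"
  interpret cof_vec_space n "TYPE(real)" .
  obtain S where SV: "S \<subseteq> carrier_vec n" and fin: "finite S" and card: "card S = r"
    and ind: "lin_indpt S" and span: "span S = span (set (cols X))"
    using ex_basis_of_columns[OF X] unfolding r_def by blast
  obtain ws where ws: "set ws = S" "distinct ws" using finite_distinct_list[OF fin] by blast
  define us where "us = gram_schmidt n ws"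
  have wsV: "set ws \<subseteq> carrier_vec n" and wsi: "lin_indpt (set ws)" using SV ind ws by auto
  note gs = gram_schmidt_result[OF wsV ws(2) wsi us_def]
  have len: "length us = r" using gs(4) ws card distinct_card by fastforce
  have usc: "us ! j \<in> carrier_vec n" if "j < r" for j using that len gs(3) by auto
  have orth: "us ! i \<bullet> us ! j = 0 \<longleftrightarrow> i \<noteq> j" if "i < r" "j < r" for i j
    using corthogonalD[OF gs(2), of i j] that len by simp
  \<comment> \<open>The orthogonality relation is an equivalence, so its diagonal case says that no
    Gram-Schmidt vector vanishes; hence normalization is legitimate.\<close>
  have npos: "norm2 (us ! j) \<noteq> 0" if "j < r" for j
    using orth[OF that that] unfolding norm2_def by simp
  define U where "U = Matrix.mat n r (\<lambda>(i, j). us ! j $ i / norm2 (us ! j))"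
  have U: "U \<in> carrier_mat n r" by (simp add: U_def)
  have colU: "col U j = (1 / norm2 (us ! j)) \<cdot>\<^sub>v (us ! j)" if "j < r" for j
    unfolding U_def using that usc[OF that] by (intro eq_vecI) auto
  have "transpose_mat U * U = 1\<^sub>m r"
  proof (rule eq_matI)
    fix i j assume "i < dim_row (1\<^sub>m r :: real mat)" "j < dim_col (1\<^sub>m r :: real mat)"
    then have ij: "i < r" "j < r" by auto
    then have "(transpose_mat U * U) $$ (i, j) = col U i \<bullet> col U j" using U by simp
    also have "\<dots> = (us ! i \<bullet> us ! j) / (norm2 (us ! i) * norm2 (us ! j))"
      using ij usc[OF ij(1)] usc[OF ij(2)] by (simp add: colU)
    also have "\<dots> = 1\<^sub>m r $$ (i, j)"
      using ij orth[OF ij] npos[OF ij(1)] norm2_power2[of "us ! i"] by (auto simp: power2_eq_square)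
    finally show "(transpose_mat U * U) $$ (i, j) = 1\<^sub>m r $$ (i, j)" .
  qed (use U in auto)
  moreover have "\<exists>c\<in>carrier_vec r. X *\<^sub>v b = U *\<^sub>v c" if b: "b \<in> carrier_vec d" for b
  proof -
    define W where "W = mat_of_cols n us"
    have W: "W \<in> carrier_mat n r" using mat_of_cols_carrier(1)[of n us] by (simp add: W_def len)
    have colsW: "cols W = us" unfolding W_def using gs(3) by simp
    have "X *\<^sub>v b \<in> col_space X" using X b by (auto simp: col_space_eq[OF X])
    then have "X *\<^sub>v b \<in> col_space W" unfolding col_space_def colsW using span gs(1) ws(1) by simp
    then obtain a where a: "a \<in> carrier_vec r" "W *\<^sub>v a = X *\<^sub>v b"
      using W by (auto simp: col_space_eq[OF W])
    \<comment> \<open>The coefficients absorb the lengths that the normalization of the columns of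
      \<open>U\<close> removed.\<close>
    define c where "c = vec r (\<lambda>j. norm2 (us ! j) * a $ j)"
    have "U *\<^sub>v c = W *\<^sub>v a"
    proof (rule eq_vecI)
      fix i assume "i < dim_vec (W *\<^sub>v a)"
      then have i: "i < n" using W by simp
      have "row U i \<bullet> c = row W i \<bullet> a"
        unfolding scalar_prod_def using i a(1) npos U W
        by (auto simp: c_def U_def W_def mat_of_cols_def len intro!: sum.cong)
      then show "(U *\<^sub>v c) $ i = (W *\<^sub>v a) $ i" using i U W by simp
    qed (use U W in auto)
    then show ?thesis using a by (intro bexI[of _ c]) (auto simp: c_def)
  qed
  ultimately show thesis using that U unfolding r_def by blast
qed

lemma norm2_orthonormal:
  assumes U: "U \<in> carrier_mat n r" "transpose_mat U * U = 1\<^sub>m r" and c: "c \<in> carrier_vec r"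
  shows "norm2 (U *\<^sub>v c) = norm2 c"
  using transpose_mult_scalar_prod[OF U(1) c c] c unfolding norm2_def U(2) by simp

text \<open>On the column space \<open>X b = U c\<close> with \<open>U\<close> isometric, so the
  claim is about how far \<open>P * U\<close> is from an isometry on coefficient vectors.\<close>

lemma sketch_distortion_of_basis:
  assumes X: "X \<in> carrier_mat n d" and P: "P \<in> carrier_mat m n"
    and U: "U \<in> carrier_mat n r" "transpose_mat U * U = 1\<^sub>m r"
    and range: "\<And>b. b \<in> carrier_vec d \<Longrightarrow> \<exists>c\<in>carrier_vec r. X *\<^sub>v b = U *\<^sub>v c"
    and dist: "\<And>c. c \<in> carrier_vec r \<Longrightarrow>
      \<bar>(norm2 ((P * U) *\<^sub>v c))\<^sup>2 - (norm2 c)\<^sup>2\<bar> \<le> \<epsilon> * (norm2 c)\<^sup>2"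
  shows "sketch_distortion (P * X) X \<epsilon>"
  unfolding sketch_distortion_def
proof
  fix b :: "real vec" assume "b \<in> carrier_vec (dim_col X)"
  then have b: "b \<in> carrier_vec d" using X by simp
  then obtain c where c: "c \<in> carrier_vec r" "X *\<^sub>v b = U *\<^sub>v c" using range by blast
  have "(P * X) *\<^sub>v b = P *\<^sub>v (X *\<^sub>v b)" using P X b by (intro assoc_mult_mat_vec) auto
  also have "\<dots> = (P * U) *\<^sub>v c"
    unfolding c(2) using P U(1) c(1) by (intro assoc_mult_mat_vec[symmetric]) auto
  finally show "\<bar>(norm2 ((P * X) *\<^sub>v b))\<^sup>2 - (norm2 (X *\<^sub>v b))\<^sup>2\<bar> \<le> \<epsilon> * (norm2 (X *\<^sub>v b))\<^sup>2"
    using dist[OF c(1)] norm2_orthonormal[OF U c(1)] by (simp add: c(2))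
qed

subsection \<open>The sparse embedding\<close>

text \<open>Only the first \<open>k\<close> columns are used, so that adding one column at a time turns the moment
  computations into recursions.\<close>

definition count_sketch :: "nat \<Rightarrow> (nat \<Rightarrow> nat \<times> real) \<Rightarrow> (nat \<Rightarrow> real) \<Rightarrow> nat \<Rightarrow> real" where
  "count_sketch k s w i = (\<Sum>j<k. if fst (s j) = i then snd (s j) * w j else 0)"

text \<open>If \<open>k = n\<close> and \<open>u\<close>, \<open>v\<close> are columns of an
  orthonormal \<open>U\<close>, this is the corresponding entry of (P U)^T (P U) - 1.\<close>

definition count_sketch_err :: "nat \<Rightarrow> nat \<Rightarrow> (nat \<Rightarrow> nat \<times> real) \<Rightarrow> (nat \<Rightarrow> real) \<Rightarrow> (nat \<Rightarrow> real) \<Rightarrow> real" where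
  "count_sketch_err m k s u v = (\<Sum>i<m. count_sketch k s u i * count_sketch k s v i) - (\<Sum>j<k. u j * v j)"

definition count_sketch_pmf :: "nat \<Rightarrow> nat \<Rightarrow> (nat \<Rightarrow> nat \<times> real) pmf" where
  "count_sketch_pmf m k = Pi_pmf {..<k} (0, 1) (\<lambda>_. pair_pmf (pmf_of_set {..<m}) (pmf_of_set {1, -1}))"

section \<open>Algebra of the sketch error\<close>

lemma count_sketch_Suc_upd:
  "count_sketch (Suc k) (s(k := (h, \<sigma>))) w i = count_sketch k s w i + (if h = i then \<sigma> * w k else 0)"
  unfolding count_sketch_def by (auto intro!: sum.cong)

lemma count_sketch_linear:
  "count_sketch k s (\<lambda>j. \<Sum>a\<in>A. c a * u a j) i = (\<Sum>a\<in>A. c a * count_sketch k s (u a) i)"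
proof -
  have "count_sketch k s (\<lambda>j. \<Sum>a\<in>A. c a * u a j) i
      = (\<Sum>j<k. \<Sum>a\<in>A. c a * (if fst (s j) = i then snd (s j) * u a j else 0))"
    unfolding count_sketch_def by (intro sum.cong) (auto simp: sum_distrib_left algebra_simps)
  then show ?thesis unfolding count_sketch_def by (subst (asm) sum.swap) (simp add: sum_distrib_left)
qed

lemma count_sketch_linear2:
  "count_sketch k s (\<lambda>j. a * u j + b * v j) i = a * count_sketch k s u i + b * count_sketch k s v i"
  unfolding count_sketch_def sum_distrib_left sum.distrib[symmetric]
  by (intro sum.cong) (auto simp: algebra_simps)

lemma count_sketch_err_bilinear:
  "count_sketch_err m k s (\<lambda>j. \<Sum>a\<in>A. c a * u a j) (\<lambda>j. \<Sum>b\<in>B. e b * v b j)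
    = (\<Sum>a\<in>A. \<Sum>b\<in>B. c a * e b * count_sketch_err m k s (u a) (v b))"
proof -
  have swap: "(\<Sum>i\<in>I. (\<Sum>a\<in>A. c a * f a i) * (\<Sum>b\<in>B. e b * g b i))
      = (\<Sum>a\<in>A. \<Sum>b\<in>B. c a * e b * (\<Sum>i\<in>I. f a i * g b i))" for I :: "nat set" and f g
  proof -
    have "(\<Sum>i\<in>I. (\<Sum>a\<in>A. c a * f a i) * (\<Sum>b\<in>B. e b * g b i))
        = (\<Sum>i\<in>I. \<Sum>a\<in>A. \<Sum>b\<in>B. c a * e b * (f a i * g b i))"
      by (simp add: sum_product algebra_simps)
    also have "\<dots> = (\<Sum>a\<in>A. \<Sum>i\<in>I. \<Sum>b\<in>B. c a * e b * (f a i * g b i))" by (rule sum.swap)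
    also have "\<dots> = (\<Sum>a\<in>A. \<Sum>b\<in>B. \<Sum>i\<in>I. c a * e b * (f a i * g b i))"
      by (intro sum.cong refl sum.swap)
    finally show ?thesis by (simp add: sum_distrib_left)
  qed
  show ?thesis
    unfolding count_sketch_err_def count_sketch_linear swap by (simp add: sum_subtractf right_diff_distrib)
qed

text \<open>A new column is hashed to the single bucket \<open>h\<close>, so only that summand
  changes.\<close>

lemma sum_update_square:
  fixes f g :: "nat \<Rightarrow> real"
  assumes "h < m"
  shows "(\<Sum>i<m. (f i + (if h = i then a else 0)) * (g i + (if h = i then b else 0)))
    = (\<Sum>i<m. f i * g i) + a * g h + b * f h + a * b"
proof -
  have "(\<Sum>i<m. (f i + (if h = i then a else 0)) * (g i + (if h = i then b else 0)))
      = (\<Sum>i<m. f i * g i + (if h = i then a * g h + b * f h + a * b else 0))"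
    by (intro sum.cong) (auto simp: algebra_simps)
  then show ?thesis using assms by (simp add: sum.distrib)
qed

text \<open>The square of the new sign is 1, so the new diagonal term cancels against the new term
  of the exact inner product. What remains is linear in the sign, and its coefficient is again a
  sketch, of a combination of \<open>u\<close> and \<open>v\<close>.\<close>

lemma count_sketch_err_Suc_upd:
  assumes "h < m" "\<sigma> * \<sigma> = 1"
  shows "count_sketch_err m (Suc k) (s(k := (h, \<sigma>))) u v
    = count_sketch_err m k s u v + \<sigma> * count_sketch k s (\<lambda>j. u k * v j + v k * u j) h"
proof -
  have "\<sigma> * u k * (\<sigma> * v k) = u k * v k" using assms(2) by (metis mult.assoc mult.left_commute mult_1)
  then show ?thesis
    unfolding count_sketch_err_def count_sketch_Suc_upd sum_update_square[OF assms(1)] count_sketch_linear2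
    by (simp add: algebra_simps)
qed

section \<open>Moments of the sketch error\<close>

lemma finite_set_count_sketch_pmf: "0 < m \<Longrightarrow> finite (set_pmf (count_sketch_pmf m k))"
  unfolding count_sketch_pmf_def
  by (subst set_Pi_pmf) (auto intro!: finite_PiE_dflt simp: set_pmf_of_set lessThan_empty_iff)

lemma integrable_count_sketch_pmf: "0 < m \<Longrightarrow> integrable (measure_pmf (count_sketch_pmf m k)) (f :: _ \<Rightarrow> real)"
  by (intro integrable_measure_pmf_finite finite_set_count_sketch_pmf)

text \<open>The two signs of the new column are kept together as a sum, so that terms odd in the
  sign cancel pointwise in the recursions that follow.\<close>

lemma expectation_count_sketch_pmf_Suc:
  fixes f :: "_ \<Rightarrow> real"
  assumes m: "0 < m"
  shows "measure_pmf.expectation (count_sketch_pmf m (Suc k)) f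
    = (\<Sum>h<m. measure_pmf.expectation (count_sketch_pmf m k)
        (\<lambda>s. f (s(k := (h, 1))) + f (s(k := (h, -1))))) / (2 * real m)"
proof -
  let ?q = "pair_pmf (pmf_of_set {..<m}) (pmf_of_set {1, -1 :: real})"
  have ne: "{..<m} \<noteq> {}" using m by (auto simp: lessThan_empty_iff)
  have "measure_pmf.expectation (count_sketch_pmf m (Suc k)) f
      = measure_pmf.expectation (?q \<bind> (\<lambda>y. map_pmf (\<lambda>s. s(k := y)) (count_sketch_pmf m k))) f"
    unfolding count_sketch_pmf_def lessThan_Suc by (subst Pi_pmf_insert') (auto simp: map_pmf_def)
  also have "\<dots> = (\<Sum>y\<in>{..<m} \<times> {1, -1}. pmf ?q y *
      measure_pmf.expectation (map_pmf (\<lambda>s. s(k := y)) (count_sketch_pmf m k)) f)"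
    by (subst pmf_expectation_bind[where A = "{..<m} \<times> {1, -1}"])
      (auto simp: finite_set_count_sketch_pmf[OF m] set_pmf_of_set ne)
  also have "\<dots> = (\<Sum>h<m. \<Sum>\<sigma>\<in>{1, -1}. (1 / (2 * real m)) *
      measure_pmf.expectation (count_sketch_pmf m k) (\<lambda>s. f (s(k := (h, \<sigma>)))))"
    unfolding sum.cartesian_product using ne
    by (intro sum.cong) (auto simp: pmf_pair pmf_of_set[OF ne finite_lessThan] split: prod.splits)
  finally show ?thesis
    by (simp add: sum_divide_distrib Bochner_Integration.integral_add integrable_count_sketch_pmf[OF m] add_divide_distrib)
qed

text \<open>The sketch preserves squared length in the mean: the cross terms of each new column
  change sign with its random sign.\<close>

lemma expectation_count_sketch_norm:
  assumes m: "0 < m"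
  shows "measure_pmf.expectation (count_sketch_pmf m k) (\<lambda>s. \<Sum>i<m. (count_sketch k s w i)\<^sup>2) = (\<Sum>j<k. (w j)\<^sup>2)"
proof (induction k)
  case 0
  show ?case by (simp add: count_sketch_def)
next
  case (Suc k)
  have step: "(\<Sum>i<m. (count_sketch (Suc k) (s(k := (h, 1))) w i)\<^sup>2) + (\<Sum>i<m. (count_sketch (Suc k) (s(k := (h, -1))) w i)\<^sup>2)
      = 2 * (\<Sum>i<m. (count_sketch k s w i)\<^sup>2) + 2 * (w k)\<^sup>2" if "h < m" for h s
    unfolding count_sketch_Suc_upd power2_eq_square sum_update_square[OF that] by (simp add: algebra_simps)
  have "measure_pmf.expectation (count_sketch_pmf m (Suc k)) (\<lambda>s. \<Sum>i<m. (count_sketch (Suc k) s w i)\<^sup>2)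
      = (\<Sum>h<m. measure_pmf.expectation (count_sketch_pmf m k)
          (\<lambda>s. 2 * (\<Sum>i<m. (count_sketch k s w i)\<^sup>2) + 2 * (w k)\<^sup>2)) / (2 * real m)"
    unfolding expectation_count_sketch_pmf_Suc[OF m] using step by simp
  also have "\<dots> = (\<Sum>j<Suc k. (w j)\<^sup>2)"
    using m by (subst Bochner_Integration.integral_add[OF integrable_count_sketch_pmf[OF m] integrable_count_sketch_pmf[OF m]])
      (simp add: Suc.IH field_simps)
  finally show ?case .
qed

text \<open>Averaging over the new sign removes the cross term, and averaging over the new bucket
  adds 1 / m times the mean squared length of the sketch of \<open>w\<close>, which is that of
  \<open>w\<close> itself. This increment is the one of the right-hand side except for
  \<open>2 * (a * b)\<^sup>2 / m\<close>, the only loss in the bound.\<close>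

lemma expectation_count_sketch_err_square:
  assumes m: "0 < m"
  shows "measure_pmf.expectation (count_sketch_pmf m k) (\<lambda>s. (count_sketch_err m k s u v)\<^sup>2)
    \<le> ((\<Sum>j<k. (u j)\<^sup>2) * (\<Sum>j<k. (v j)\<^sup>2) + (\<Sum>j<k. u j * v j)\<^sup>2) / real m"
proof (induction k)
  case 0
  show ?case by (simp add: count_sketch_err_def count_sketch_def)
next
  case (Suc k)
  define w where "w = (\<lambda>j. u k * v j + v k * u j)"
  define a b where "a = u k" and "b = v k"
  define A B C where "A = (\<Sum>j<k. (u j)\<^sup>2)" and "B = (\<Sum>j<k. (v j)\<^sup>2)" and "C = (\<Sum>j<k. u j * v j)"
  have step: "(count_sketch_err m (Suc k) (s(k := (h, 1))) u v)\<^sup>2 + (count_sketch_err m (Suc k) (s(k := (h, -1))) u v)\<^sup>2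
      = 2 * (count_sketch_err m k s u v)\<^sup>2 + 2 * (count_sketch k s w h)\<^sup>2" if "h < m" for h s
  proof -
    have *: "count_sketch_err m (Suc k) (s(k := (h, 1))) u v = count_sketch_err m k s u v + count_sketch k s w h"
      "count_sketch_err m (Suc k) (s(k := (h, -1))) u v = count_sketch_err m k s u v - count_sketch k s w h"
      using count_sketch_err_Suc_upd[OF that, of 1] count_sketch_err_Suc_upd[OF that, of "-1"] by (auto simp: w_def)
    show ?thesis unfolding * by (simp add: power2_eq_square algebra_simps)
  qed
  have "measure_pmf.expectation (count_sketch_pmf m (Suc k)) (\<lambda>s. (count_sketch_err m (Suc k) s u v)\<^sup>2)
      = (\<Sum>h<m. measure_pmf.expectation (count_sketch_pmf m k)
          (\<lambda>s. 2 * (count_sketch_err m k s u v)\<^sup>2 + 2 * (count_sketch k s w h)\<^sup>2)) / (2 * real m)"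
    unfolding expectation_count_sketch_pmf_Suc[OF m] using step by simp
  also have "\<dots> = (\<Sum>h<m. 2 * measure_pmf.expectation (count_sketch_pmf m k) (\<lambda>s. (count_sketch_err m k s u v)\<^sup>2)
          + 2 * measure_pmf.expectation (count_sketch_pmf m k) (\<lambda>s. (count_sketch k s w h)\<^sup>2)) / (2 * real m)"
    by (subst Bochner_Integration.integral_add[OF integrable_count_sketch_pmf[OF m] integrable_count_sketch_pmf[OF m]]) simp
  also have "\<dots> = measure_pmf.expectation (count_sketch_pmf m k) (\<lambda>s. (count_sketch_err m k s u v)\<^sup>2)
      + (\<Sum>h<m. measure_pmf.expectation (count_sketch_pmf m k) (\<lambda>s. (count_sketch k s w h)\<^sup>2)) / real m"
    using m by (simp add: sum.distrib sum_distrib_left[symmetric] add_divide_distrib)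
  also have "(\<Sum>h<m. measure_pmf.expectation (count_sketch_pmf m k) (\<lambda>s. (count_sketch k s w h)\<^sup>2))
      = measure_pmf.expectation (count_sketch_pmf m k) (\<lambda>s. \<Sum>h<m. (count_sketch k s w h)\<^sup>2)"
    by (intro Bochner_Integration.integral_sum[symmetric] integrable_count_sketch_pmf[OF m])
  also have "\<dots> = (\<Sum>j<k. (w j)\<^sup>2)" by (rule expectation_count_sketch_norm[OF m])
  also have "\<dots> = a\<^sup>2 * B + b\<^sup>2 * A + 2 * a * b * C"
    unfolding w_def A_def B_def C_def a_def[symmetric] b_def[symmetric]
      sum_distrib_left sum.distrib[symmetric]
    by (intro sum.cong) (auto simp: power2_eq_square algebra_simps)
  finally have "measure_pmf.expectation (count_sketch_pmf m (Suc k)) (\<lambda>s. (count_sketch_err m (Suc k) s u v)\<^sup>2)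
      \<le> (A * B + C\<^sup>2) / real m + (a\<^sup>2 * B + b\<^sup>2 * A + 2 * a * b * C) / real m"
    using Suc.IH by (simp add: A_def B_def C_def)
  also have "\<dots> = (A * B + C\<^sup>2 + (a\<^sup>2 * B + b\<^sup>2 * A + 2 * a * b * C)) / real m"
    by (simp add: add_divide_distrib)
  also have "\<dots> \<le> ((A + a\<^sup>2) * (B + b\<^sup>2) + (C + a * b)\<^sup>2) / real m"
  proof (intro divide_right_mono)
    have "(A + a\<^sup>2) * (B + b\<^sup>2) + (C + a * b)\<^sup>2
        = A * B + C\<^sup>2 + (a\<^sup>2 * B + b\<^sup>2 * A + 2 * a * b * C) + 2 * (a * b)\<^sup>2"
      by (simp add: power2_eq_square algebra_simps)
    then show "A * B + C\<^sup>2 + (a\<^sup>2 * B + b\<^sup>2 * A + 2 * a * b * C) \<le> (A + a\<^sup>2) * (B + b\<^sup>2) + (C + a * b)\<^sup>2"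
      by simp
  qed simp
  finally show ?case by (simp add: A_def B_def C_def a_def b_def)
qed

text \<open>The Frobenius norm dominates the quadratic form: Cauchy-Schwarz over pairs of indices,
  where the array of products \<open>c a * c b\<close> has Frobenius norm equal to the squared
  length of \<open>c\<close>.\<close>

lemma abs_quadratic_form_le:
  fixes D :: "nat \<Rightarrow> nat \<Rightarrow> real"
  assumes "(\<Sum>a<r. \<Sum>b<r. (D a b)\<^sup>2) \<le> \<epsilon>\<^sup>2" "0 \<le> \<epsilon>"
  shows "\<bar>\<Sum>a<r. \<Sum>b<r. c a * c b * D a b\<bar> \<le> \<epsilon> * (\<Sum>a<r. (c a)\<^sup>2)"
proof -
  let ?I = "{..<r} \<times> {..<r}"
  have "\<bar>\<Sum>a<r. \<Sum>b<r. c a * c b * D a b\<bar> \<le> (\<Sum>(a, b)\<in>?I. \<bar>c a * c b\<bar> * \<bar>D a b\<bar>)"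
    by (simp add: sum.cartesian_product abs_mult order_trans[OF sum_abs] case_prod_unfold)
  also have "\<dots> \<le> L2_set (\<lambda>(a, b). c a * c b) ?I * L2_set (\<lambda>(a, b). D a b) ?I"
    using L2_set_mult_ineq[of "\<lambda>(a, b). c a * c b" "\<lambda>(a, b). D a b" ?I] by (simp add: case_prod_unfold)
  also have "\<dots> \<le> (\<Sum>a<r. (c a)\<^sup>2) * \<epsilon>"
  proof (rule mult_mono)
    have "(\<Sum>x\<in>?I. (case x of (a, b) \<Rightarrow> c a * c b)\<^sup>2) = (\<Sum>a<r. (c a)\<^sup>2)\<^sup>2"
      by (simp add: power2_eq_square[of "sum _ _"] sum_product sum.cartesian_product case_prod_unfold power_mult_distrib)
    then show "L2_set (\<lambda>(a, b). c a * c b) ?I \<le> (\<Sum>a<r. (c a)\<^sup>2)"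
      by (simp add: L2_set_def sum_nonneg)
    show "L2_set (\<lambda>(a, b). D a b) ?I \<le> \<epsilon>"
      unfolding L2_set_def using assms
      by (intro real_le_lsqrt) (auto simp: sum.cartesian_product case_prod_unfold intro!: sum_nonneg)
  qed (auto simp: sum_nonneg)
  finally show ?thesis by (simp add: mult.commute)
qed

section \<open>The sketch as a random matrix\<close>

definition count_sketch_mat :: "nat \<Rightarrow> nat \<Rightarrow> (nat \<Rightarrow> nat \<times> real) \<Rightarrow> real mat" where
  "count_sketch_mat m n s = Matrix.mat m n (\<lambda>(i, j). if i = fst (s j) then snd (s j) else 0)"

lemma count_sketch_mat_mult_vec:
  assumes "i < m" "v \<in> carrier_vec n"
  shows "(count_sketch_mat m n s *\<^sub>v v) $ i = count_sketch n s (\<lambda>j. v $ j) i"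
proof -
  have "(count_sketch_mat m n s *\<^sub>v v) $ i = (\<Sum>j<n. (if i = fst (s j) then snd (s j) else 0) * v $ j)"
    using assms by (simp add: count_sketch_mat_def scalar_prod_def lessThan_atLeast0)
  then show ?thesis unfolding count_sketch_def by (auto intro!: sum.cong)
qed

lemma count_sketch_mat_distortion:
  assumes U: "U \<in> carrier_mat n r" "transpose_mat U * U = 1\<^sub>m r" and \<epsilon>: "0 \<le> \<epsilon>"
    and err: "(\<Sum>a<r. \<Sum>b<r. (count_sketch_err m n s (\<lambda>j. U $$ (j, a)) (\<lambda>j. U $$ (j, b)))\<^sup>2) \<le> \<epsilon>\<^sup>2"
    and c: "c \<in> carrier_vec r"
  shows "\<bar>(norm2 ((count_sketch_mat m n s * U) *\<^sub>v c))\<^sup>2 - (norm2 c)\<^sup>2\<bar> \<le> \<epsilon> * (norm2 c)\<^sup>2"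
proof -
  define x where "x = U *\<^sub>v c"
  have x: "x \<in> carrier_vec n" using U c by (simp add: x_def)
  have sm: "count_sketch_mat m n s \<in> carrier_mat m n" by (simp add: count_sketch_mat_def)
  have eq: "(count_sketch_mat m n s * U) *\<^sub>v c = count_sketch_mat m n s *\<^sub>v x"
    unfolding x_def using sm U(1) c by (intro assoc_mult_mat_vec) auto
  note sq = norm2_power2_eq_sum[unfolded power2_eq_square[of "_ $ _"]]
  have "(norm2 (count_sketch_mat m n s *\<^sub>v x))\<^sup>2 = (\<Sum>i<m. count_sketch n s (\<lambda>j. x $ j) i * count_sketch n s (\<lambda>j. x $ j) i)"
    using sm x by (subst sq[of _ m]) (auto simp: count_sketch_mat_mult_vec[OF _ x] simp del: index_mult_mat_vec intro!: sum.cong)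
  moreover have "(norm2 c)\<^sup>2 = (\<Sum>j<n. x $ j * x $ j)"
    using norm2_orthonormal[OF U c] sq[OF x] by (simp add: x_def)
  ultimately have "(norm2 (count_sketch_mat m n s *\<^sub>v x))\<^sup>2 - (norm2 c)\<^sup>2
      = count_sketch_err m n s (\<lambda>j. x $ j) (\<lambda>j. x $ j)" by (simp add: count_sketch_err_def)
  also have "\<dots> = count_sketch_err m n s (\<lambda>j. \<Sum>a<r. c $ a * U $$ (j, a)) (\<lambda>j. \<Sum>a<r. c $ a * U $$ (j, a))"
  proof -
    have xj: "x $ j = (\<Sum>a<r. c $ a * U $$ (j, a))" if "j < n" for j
      using that U c unfolding x_def by (auto simp: scalar_prod_def lessThan_atLeast0 intro!: sum.cong)
    have "count_sketch n s (\<lambda>j. x $ j) i = count_sketch n s (\<lambda>j. \<Sum>a<r. c $ a * U $$ (j, a)) i" for i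
      unfolding count_sketch_def by (intro sum.cong) (auto simp: xj)
    then show ?thesis unfolding count_sketch_err_def by (simp add: xj)
  qed
  also have "\<bar>\<dots>\<bar> \<le> \<epsilon> * (\<Sum>a<r. (c $ a)\<^sup>2)"
    unfolding count_sketch_err_bilinear by (rule abs_quadratic_form_le[OF err \<epsilon>])
  finally show ?thesis unfolding eq sq[OF c] by (simp add: power2_eq_square)
qed

lemma sparse_embedding_distortion:
  assumes X: "X \<in> carrier_mat n d" and m: "0 < m" and \<epsilon>: "0 < \<epsilon>" and \<delta>: "0 < \<delta>"
    and size: "2 * (real (vec_space.rank n X))\<^sup>2 / (\<delta> * \<epsilon>\<^sup>2) \<le> real m"
  shows "holds_with_prob_ge (measure_pmf (sparse_embedding m n)) (1 - \<delta>)
    (\<lambda>P. P \<in> carrier_mat m n \<and> sketch_distortion (P * X) X \<epsilon>)"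
proof -
  define r where "r = vec_space.rank n X"
  obtain U where U: "U \<in> carrier_mat n r" "transpose_mat U * U = 1\<^sub>m r"
    and range: "\<And>b. b \<in> carrier_vec d \<Longrightarrow> \<exists>c\<in>carrier_vec r. X *\<^sub>v b = U *\<^sub>v c"
    using ex_orthonormal_column_basis[OF X] unfolding r_def by blast
  define u where "u a = (\<lambda>j. U $$ (j, a))" for a
  have orth: "(\<Sum>j<n. u a j * u b j) = (if a = b then 1 else 0)" if "a < r" "b < r" for a b
  proof -
    have "(\<Sum>j<n. u a j * u b j) = (transpose_mat U * U) $$ (a, b)"
      using that U(1) by (auto simp: u_def scalar_prod_def lessThan_atLeast0 intro!: sum.cong)
    then show ?thesis using that by (simp add: U(2))
  qed
  let ?M = "measure_pmf (count_sketch_pmf m n)"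
  define T where "T s = (\<Sum>a<r. \<Sum>b<r. (count_sketch_err m n s (u a) (u b))\<^sup>2)" for s
  have T0: "0 \<le> T s" for s unfolding T_def by (intro sum_nonneg) auto
  have "measure_pmf.expectation (count_sketch_pmf m n) T
      = (\<Sum>a<r. \<Sum>b<r. measure_pmf.expectation (count_sketch_pmf m n) (\<lambda>s. (count_sketch_err m n s (u a) (u b))\<^sup>2))"
    unfolding T_def by (simp add: Bochner_Integration.integral_sum integrable_count_sketch_pmf[OF m])
  also have "\<dots> \<le> (\<Sum>a<r. \<Sum>b<r. 2 / real m)"
  proof (intro sum_mono)
    fix a b assume ab: "a \<in> {..<r}" "b \<in> {..<r}"
    have "measure_pmf.expectation (count_sketch_pmf m n) (\<lambda>s. (count_sketch_err m n s (u a) (u b))\<^sup>2)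
        \<le> (1 * 1 + (if a = b then 1 else 0)\<^sup>2) / real m"
      using expectation_count_sketch_err_square[OF m, of n "u a" "u b"] ab orth[of a a] orth[of b b] orth[of a b]
      by (simp add: power2_eq_square)
    \<comment> \<open>Attained by the diagonal pairs; the other pairs give 1 / m. Over all pairs
      this yields the factor 2 in the required size.\<close>
    also have "\<dots> \<le> 2 / real m" by (intro divide_right_mono) auto
    finally show "measure_pmf.expectation (count_sketch_pmf m n) (\<lambda>s. (count_sketch_err m n s (u a) (u b))\<^sup>2) \<le> 2 / real m" .
  qed
  also have "\<dots> = 2 * (real r)\<^sup>2 / real m" by (simp add: power2_eq_square)
  also have "\<dots> \<le> \<delta> * \<epsilon>\<^sup>2" using size m \<epsilon> \<delta> unfolding r_def[symmetric] by (simp add: field_simps)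
  finally have ET: "measure_pmf.expectation (count_sketch_pmf m n) T \<le> \<delta> * \<epsilon>\<^sup>2" .
  have "measure ?M {s \<in> space ?M. \<epsilon>\<^sup>2 \<le> T s} \<le> measure_pmf.expectation (count_sketch_pmf m n) T / \<epsilon>\<^sup>2"
    by (rule integral_Markov_inequality_measure[where A = "{}"]) (use \<epsilon> T0 m in \<open>auto intro: integrable_count_sketch_pmf\<close>)
  also have "\<dots> \<le> \<delta>" using ET \<epsilon> by (simp add: pos_divide_le_eq)
  finally have bad: "measure ?M {s. \<epsilon>\<^sup>2 \<le> T s} \<le> \<delta>" by simp
  define E where "E = {P. P \<in> carrier_mat m n \<and> sketch_distortion (P * X) X \<epsilon>}"
  have sub: "- {s. \<epsilon>\<^sup>2 \<le> T s} \<subseteq> count_sketch_mat m n -` E"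
  proof
    fix s assume "s \<in> - {s. \<epsilon>\<^sup>2 \<le> T s}"
    then have "(\<Sum>a<r. \<Sum>b<r. (count_sketch_err m n s (\<lambda>j. U $$ (j, a)) (\<lambda>j. U $$ (j, b)))\<^sup>2) \<le> \<epsilon>\<^sup>2"
      by (simp add: T_def u_def)
    note * = count_sketch_mat_distortion[OF U less_imp_le[OF \<epsilon>] this]
    have sm: "count_sketch_mat m n s \<in> carrier_mat m n" by (simp add: count_sketch_mat_def)
    show "s \<in> count_sketch_mat m n -` E"
      using sketch_distortion_of_basis[OF X sm U range *] sm by (simp add: E_def)
  qed
  have "1 - \<delta> \<le> 1 - measure ?M {s. \<epsilon>\<^sup>2 \<le> T s}" using bad by simp
  also have "\<dots> = measure ?M (- {s. \<epsilon>\<^sup>2 \<le> T s})"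
    using measure_pmf.prob_compl[of "{s. \<epsilon>\<^sup>2 \<le> T s}" "count_sketch_pmf m n"] by (simp add: Compl_eq_Diff_UNIV)
  also have "\<dots> \<le> measure ?M (count_sketch_mat m n -` E)"
    by (rule measure_pmf.finite_measure_mono[OF sub]) simp
  also have "\<dots> = measure (measure_pmf (sparse_embedding m n)) E"
    unfolding sparse_embedding_def count_sketch_pmf_def count_sketch_mat_def[abs_def] by (simp add: measure_map_pmf)
  finally show ?thesis unfolding holds_with_prob_ge_def by (intro bexI[of _ E]) (auto simp: E_def)
qed

subsection \<open>Gaussian matrices\<close>

text \<open>The entries before division by the square root of \<open>m\<close>, so that the squared
  length of the image of a unit vector is chi-square with \<open>m\<close> degrees of
  freedom.\<close>

definition gauss_entries :: "nat \<Rightarrow> nat \<Rightarrow> (nat \<times> nat \<Rightarrow> real) measure" where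
  "gauss_entries m n = Pi\<^sub>M ({..<m} \<times> {..<n}) (\<lambda>_. density lborel std_normal_density)"

text \<open>The moment generating function of a squared standard normal: the integrand is a multiple
  of the centred normal density of variance 1 / (1 - 2 s).\<close>

lemma nn_integral_exp_square_std_normal:
  assumes "s < 1 / 2"
  shows "(\<integral>\<^sup>+x. ennreal (std_normal_density x) * ennreal (exp (s * x\<^sup>2)) \<partial>lborel) = ennreal (1 / sqrt (1 - 2 * s))"
proof -
  define \<sigma> where "\<sigma> = 1 / sqrt (1 - 2 * s)"
  have \<sigma>: "0 < \<sigma>" and \<sigma>2: "\<sigma>\<^sup>2 = 1 / (1 - 2 * s)" using assms by (auto simp: \<sigma>_def power_divide)
  have "std_normal_density x * exp (s * x\<^sup>2) = \<sigma> * normal_density 0 \<sigma> x" for x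
  proof -
    have "- x\<^sup>2 / 2 + s * x\<^sup>2 = - x\<^sup>2 / (2 * \<sigma>\<^sup>2)" using assms by (simp add: \<sigma>2 field_simps)
    then have "exp (- x\<^sup>2 / 2) * exp (s * x\<^sup>2) = exp (- x\<^sup>2 / (2 * \<sigma>\<^sup>2))" by (metis exp_add)
    then show ?thesis
      using \<sigma> by (simp add: normal_density_def real_sqrt_mult)
  qed
  then have eq: "ennreal (std_normal_density x) * ennreal (exp (s * x\<^sup>2))
      = ennreal \<sigma> * ennreal (normal_density 0 \<sigma> x)" for x
    using \<sigma> by (simp flip: ennreal_mult)
  have "(\<integral>\<^sup>+x. ennreal (normal_density 0 \<sigma> x) \<partial>lborel) = emeasure (density lborel (normal_density 0 \<sigma>)) UNIV"
    by (simp add: emeasure_density)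
  also have "\<dots> = 1"
    using prob_space.emeasure_space_1[OF prob_space_normal_density[OF \<sigma>, of 0]] by simp
  finally show ?thesis unfolding eq by (simp add: nn_integral_cmult \<sigma>_def)
qed

text \<open>Independence means that the joint law is the product of the marginals, and here the
  joint law of the coordinates is the given product measure.\<close>

lemma indep_vars_PiM_coordinates:
  assumes N: "prob_space N" and I: "I \<noteq> {}"
  shows "prob_space.indep_vars (Pi\<^sub>M I (\<lambda>_. N)) (\<lambda>_. N) (\<lambda>i \<omega>. \<omega> i) I"
proof -
  interpret P: product_prob_space "\<lambda>_. N" I
    by (intro product_prob_spaceI N)
  have "distr (Pi\<^sub>M I (\<lambda>_. N)) (Pi\<^sub>M I (\<lambda>_. N)) (\<lambda>x. \<lambda>i\<in>I. x i)
      = distr (Pi\<^sub>M I (\<lambda>_. N)) (Pi\<^sub>M I (\<lambda>_. N)) (\<lambda>x. x)"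
    by (intro distr_cong) (auto simp: space_PiM PiE_restrict)
  also have "\<dots> = Pi\<^sub>M I (\<lambda>_. N)" by (intro distr_id2) simp
  also have "\<dots> = Pi\<^sub>M I (\<lambda>i. distr (Pi\<^sub>M I (\<lambda>_. N)) N (\<lambda>x. x i))"
    by (intro PiM_cong refl) (simp add: P.PiM_component)
  finally show ?thesis
    by (subst P.indep_vars_iff_distr_eq_PiM'[OF I]) auto
qed

lemma prob_space_gauss_entries: "prob_space (gauss_entries m n)"
  unfolding gauss_entries_def by (intro prob_space_PiM prob_space_normal_density) simp

lemma gauss_entry_measurable [measurable]:
  "i < m \<Longrightarrow> j < n \<Longrightarrow> (\<lambda>g. g (i, j)) \<in> borel_measurable (gauss_entries m n)"
  unfolding gauss_entries_def
  using measurable_component_singleton[of "(i, j)" "{..<m} \<times> {..<n}" "\<lambda>_. density lborel std_normal_density"]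
  by (simp cong: measurable_cong_sets)

lemma distributed_gauss_entry:
  assumes "i < m" "j < n"
  shows "distributed (gauss_entries m n) lborel (\<lambda>g. g (i, j)) std_normal_density"
proof -
  let ?N = "density lborel std_normal_density"
  interpret P: product_prob_space "\<lambda>_. ?N" "{..<m} \<times> {..<n}"
    by (intro product_prob_spaceI prob_space_normal_density) simp
  have "distr (gauss_entries m n) lborel (\<lambda>g. g (i, j)) = distr (gauss_entries m n) ?N (\<lambda>g. g (i, j))"
    by (intro distr_cong) auto
  also have "\<dots> = ?N" unfolding gauss_entries_def using assms by (intro P.PiM_component) auto
  finally show ?thesis
    unfolding distributed_def using gauss_entry_measurable[OF assms] by simp
qed

text \<open>A weighted sum of independent standard normals is centred normal with variance the sum
  of the squared weights, here 1.\<close>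

lemma distributed_gauss_row:
  assumes i: "i < m" and u: "(\<Sum>j<n. (u j)\<^sup>2) = 1"
  shows "distributed (gauss_entries m n) lborel (\<lambda>g. \<Sum>j<n. u j * g (i, j)) std_normal_density"
proof -
  let ?N = "density lborel std_normal_density"
  interpret prob_space "gauss_entries m n" by (rule prob_space_gauss_entries)
  \<comment> \<open>The rule for sums of independent normals asks for positive deviations, so
    indices of weight 0 are dropped.\<close>
  define J where "J = {j. j < n \<and> u j \<noteq> 0}"
  have J: "finite J" "J \<subseteq> {..<n}" by (auto simp: J_def)
  have sumJ: "(\<Sum>j<n. f j) = (\<Sum>j\<in>J. f j)" if "\<And>j. u j = 0 \<Longrightarrow> f j = 0" for f :: "nat \<Rightarrow> real"
    using that by (intro sum.mono_neutral_right) (auto simp: J_def)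
  have u': "(\<Sum>j\<in>J. \<bar>u j\<bar>\<^sup>2) = 1" using u sumJ[of "\<lambda>j. (u j)\<^sup>2"] by simp
  then have ne: "J \<noteq> {}" by auto
  have "indep_vars (\<lambda>_. ?N) (\<lambda>ij g. g ij) ({..<m} \<times> {..<n})"
    unfolding gauss_entries_def using i ne J
    by (intro indep_vars_PiM_coordinates prob_space_normal_density) auto
  then have "indep_vars (\<lambda>_. ?N) (\<lambda>ij g. g ij) ((\<lambda>j. (i, j)) ` J)"
    by (rule indep_vars_subset) (use i J in auto)
  then have ind: "indep_vars (\<lambda>_. borel) (\<lambda>ij g. u (snd ij) * g ij) ((\<lambda>j. (i, j)) ` J)"
    by (rule indep_vars_compose2) simp
  have "distributed (gauss_entries m n) lborel (\<lambda>g. \<Sum>ij\<in>(\<lambda>j. (i, j)) ` J. u (snd ij) * g ij)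
      (normal_density (\<Sum>ij\<in>(\<lambda>j. (i, j)) ` J. 0) (sqrt (\<Sum>ij\<in>(\<lambda>j. (i, j)) ` J. \<bar>u (snd ij)\<bar>\<^sup>2)))"
  proof (rule sum_indep_normal[OF _ _ ind])
    fix ij assume "ij \<in> (\<lambda>j. (i, j)) ` J"
    then obtain j where ij: "ij = (i, j)" and j: "j < n" "u j \<noteq> 0" by (auto simp: J_def)
    then show "0 < \<bar>u (snd ij)\<bar>" by simp
    show "distributed (gauss_entries m n) lborel (\<lambda>g. u (snd ij) * g ij) (normal_density 0 \<bar>u (snd ij)\<bar>)"
      using normal_density_affine[OF distributed_gauss_entry[OF i j(1)], of "u j" 0] j by (simp add: ij)
  qed (use J ne in auto)
  moreover have "(\<Sum>ij\<in>(\<lambda>j. (i, j)) ` J. f ij) = (\<Sum>j\<in>J. f (i, j))" for f :: "nat \<times> nat \<Rightarrow> real"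
    by (subst sum.reindex) (auto simp: inj_on_def)
  ultimately show ?thesis using sumJ[of "\<lambda>j. u j * g (i, j)" for g] by (simp add: u'[simplified])
qed

text \<open>Different rows depend on disjoint groups of entries, hence are independent, and the
  expectation of the product is a product of \<open>m\<close> equal factors.\<close>

lemma nn_integral_exp_gauss_rows:
  assumes u: "(\<Sum>j<n. (u j)\<^sup>2) = 1" and s: "s < 1 / 2"
  shows "(\<integral>\<^sup>+g. ennreal (exp (s * (\<Sum>i<m. (\<Sum>j<n. u j * g (i, j))\<^sup>2))) \<partial>gauss_entries m n)
    = ennreal ((1 / sqrt (1 - 2 * s)) ^ m)"
proof (cases "m = 0")
  case True
  then show ?thesis
    using prob_space.emeasure_space_1[OF prob_space_gauss_entries[of m n]] by simp
next
  case False
  let ?N = "density lborel std_normal_density"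
  let ?I = "{..<m} \<times> {..<n}"
  interpret prob_space "gauss_entries m n" by (rule prob_space_gauss_entries)
  have n: "n \<noteq> 0" using u by (cases n) auto
  have "indep_vars (\<lambda>_. ?N) (\<lambda>ij g. g ij) ?I"
    unfolding gauss_entries_def using n False
    by (intro indep_vars_PiM_coordinates prob_space_normal_density) (auto simp: lessThan_empty_iff)
  then have "indep_vars (\<lambda>i. Pi\<^sub>M ({i} \<times> {..<n}) (\<lambda>_. ?N)) (\<lambda>i g. restrict (\<lambda>ij. g ij) ({i} \<times> {..<n})) {..<m}"
    by (rule indep_vars_restrict) (auto simp: disjoint_family_on_def)
  then have "indep_vars (\<lambda>_. borel) (\<lambda>i g. ennreal (exp (s * (\<Sum>j<n. u j * restrict g ({i} \<times> {..<n}) (i, j))\<^sup>2))) {..<m}"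
  proof (rule indep_vars_compose2)
    fix i
    have [measurable]: "(\<lambda>g. g (i, j)) \<in> borel_measurable (Pi\<^sub>M ({i} \<times> {..<n}) (\<lambda>_. ?N))" if "j < n" for j
      using that measurable_component_singleton[of "(i, j)" "{i} \<times> {..<n}" "\<lambda>_. ?N"]
      by (simp cong: measurable_cong_sets)
    show "(\<lambda>g. ennreal (exp (s * (\<Sum>j<n. u j * g (i, j))\<^sup>2))) \<in> borel_measurable (Pi\<^sub>M ({i} \<times> {..<n}) (\<lambda>_. ?N))"
      by measurable
  qed
  then have ind: "indep_vars (\<lambda>_. borel) (\<lambda>i g. ennreal (exp (s * (\<Sum>j<n. u j * g (i, j))\<^sup>2))) {..<m}"
    by simp
  have "(\<integral>\<^sup>+g. ennreal (exp (s * (\<Sum>i<m. (\<Sum>j<n. u j * g (i, j))\<^sup>2))) \<partial>gauss_entries m n)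
      = (\<integral>\<^sup>+g. (\<Prod>i<m. ennreal (exp (s * (\<Sum>j<n. u j * g (i, j))\<^sup>2))) \<partial>gauss_entries m n)"
    by (simp add: sum_distrib_left exp_sum prod_ennreal)
  also have "\<dots> = (\<Prod>i<m. \<integral>\<^sup>+g. ennreal (exp (s * (\<Sum>j<n. u j * g (i, j))\<^sup>2)) \<partial>gauss_entries m n)"
    by (rule indep_vars_nn_integral[OF _ ind]) auto
  also have "\<dots> = (\<Prod>i<m. ennreal (1 / sqrt (1 - 2 * s)))"
  proof (rule prod.cong)
    fix i assume "i \<in> {..<m}"
    then show "(\<integral>\<^sup>+g. ennreal (exp (s * (\<Sum>j<n. u j * g (i, j))\<^sup>2)) \<partial>gauss_entries m n)
        = ennreal (1 / sqrt (1 - 2 * s))"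
      using distributed_nn_integral[OF distributed_gauss_row[of i m u n], of "\<lambda>x. ennreal (exp (s * x\<^sup>2))"] u
      by (simp add: nn_integral_exp_square_std_normal[OF s])
  qed simp
  finally show ?thesis using s by (simp add: ennreal_power)
qed

text \<open>The Chernoff factors of one row at exponents t / 8 and - t / 8. With second-order lower
  bounds for the logarithm at 1 - t / 4 and 1 + t / 4 the linear terms cancel, leaving the exponents
  - t^2 / 16 and - 3 t^2 / 32.\<close>

lemma chi_square_factor_le:
  fixes t :: real
  assumes "0 \<le> t" "t \<le> 1"
  shows "exp (- (t / 8) * (1 + t)) * (1 / sqrt (1 - 2 * (t / 8))) \<le> exp (- t\<^sup>2 / 16)"
    and "exp ((t / 8) * (1 - t)) * (1 / sqrt (1 - 2 * (- (t / 8)))) \<le> exp (- t\<^sup>2 / 16)"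
proof -
  have sq: "1 / sqrt x = exp (- ln x / 2)" if "0 < x" for x :: real
    using that by (simp add: exp_minus ln_sqrt[symmetric] inverse_eq_divide)
  have "- (t / 4) - 2 * (t / 4)\<^sup>2 \<le> ln (1 - t / 4)"
    using assms by (intro ln_one_minus_pos_lower_bound) auto
  then have "- (t / 8) * (1 + t) + - ln (1 - t / 4) / 2 \<le> - t\<^sup>2 / 16"
    by (simp add: power2_eq_square field_simps)
  then show "exp (- (t / 8) * (1 + t)) * (1 / sqrt (1 - 2 * (t / 8))) \<le> exp (- t\<^sup>2 / 16)"
    using sq[of "1 - t / 4"] assms by (simp flip: exp_add)
  have "t / 4 - (t / 4)\<^sup>2 \<le> ln (1 + t / 4)"
    using assms by (intro ln_one_plus_pos_lower_bound) auto
  then have "(t / 8) * (1 - t) + - ln (1 + t / 4) / 2 \<le> - (3 * t\<^sup>2 / 32)"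
    by (simp add: power2_eq_square field_simps)
  also have "\<dots> \<le> - t\<^sup>2 / 16" by simp
  finally show "exp ((t / 8) * (1 - t)) * (1 / sqrt (1 - 2 * (- (t / 8)))) \<le> exp (- t\<^sup>2 / 16)"
    using sq[of "1 + t / 4"] assms by (simp flip: exp_add)
qed

text \<open>Chernoff's bound for each side. One non-optimal exponent size t / 8 serves both, so that
  a single rate covers the two tails.\<close>

lemma gauss_rows_tail:
  assumes u: "(\<Sum>j<n. (u j)\<^sup>2) = 1" and t: "0 < t" "t \<le> 1"
  shows "measure (gauss_entries m n)
    {g \<in> space (gauss_entries m n). t * real m \<le> \<bar>(\<Sum>i<m. (\<Sum>j<n. u j * g (i, j))\<^sup>2) - real m\<bar>}
    \<le> 2 * exp (- t\<^sup>2 * real m / 16)"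
proof -
  let ?G = "gauss_entries m n"
  interpret prob_space ?G by (rule prob_space_gauss_entries)
  define Y where "Y g = (\<Sum>i<m. (\<Sum>j<n. u j * g (i, j))\<^sup>2)" for g :: "nat \<times> nat \<Rightarrow> real"
  have [measurable]: "Y \<in> borel_measurable ?G" unfolding Y_def by measurable
  define s where "s = t / 8"
  have s: "0 < s" "s < 1 / 2" "- s < 1 / 2" using t by (auto simp: s_def)
  have pw: "exp (a * real m) * b ^ m \<le> exp (- t\<^sup>2 * real m / 16)"
    if "exp a * b \<le> exp (- t\<^sup>2 / 16)" "0 \<le> b" for a b
  proof -
    have "exp (a * real m) * b ^ m = (exp a * b) ^ m"
      by (simp add: power_mult_distrib exp_of_nat2_mult)
    also have "\<dots> \<le> exp (- t\<^sup>2 / 16) ^ m" using that by (intro power_mono) auto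
    finally show ?thesis by (simp add: exp_of_nat2_mult[symmetric])
  qed
  have "emeasure ?G {g \<in> space ?G. real m * (1 + t) \<le> Y g}
      \<le> ennreal (exp (- s * (real m * (1 + t)))) * (\<integral>\<^sup>+g. ennreal (exp (s * Y g)) * indicator (space ?G) g \<partial>?G)"
    by (rule Chernoff_ineq_nn_integral_ge) (use s in auto)
  also have "(\<integral>\<^sup>+g. ennreal (exp (s * Y g)) * indicator (space ?G) g \<partial>?G) = (\<integral>\<^sup>+g. ennreal (exp (s * Y g)) \<partial>?G)"
    by (intro nn_integral_cong) simp
  also have "\<dots> = ennreal ((1 / sqrt (1 - 2 * s)) ^ m)"
    unfolding Y_def by (rule nn_integral_exp_gauss_rows[OF u s(2)])
  also have "ennreal (exp (- s * (real m * (1 + t)))) * \<dots>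
      = ennreal (exp ((- s * (1 + t)) * real m) * (1 / sqrt (1 - 2 * s)) ^ m)"
    using s by (simp add: ennreal_mult algebra_simps)
  also have "\<dots> \<le> ennreal (exp (- t\<^sup>2 * real m / 16))"
    using chi_square_factor_le(1)[of t] t s by (intro ennreal_leI pw) (auto simp: s_def)
  finally have up: "measure ?G {g \<in> space ?G. real m * (1 + t) \<le> Y g} \<le> exp (- t\<^sup>2 * real m / 16)"
    by (simp add: emeasure_eq_measure)
  have "emeasure ?G {g \<in> space ?G. Y g \<le> real m * (1 - t)}
      \<le> ennreal (exp (s * (real m * (1 - t)))) * (\<integral>\<^sup>+g. ennreal (exp (- s * Y g)) * indicator (space ?G) g \<partial>?G)"
    by (rule Chernoff_ineq_nn_integral_le) (use s in auto)
  also have "(\<integral>\<^sup>+g. ennreal (exp (- s * Y g)) * indicator (space ?G) g \<partial>?G) = (\<integral>\<^sup>+g. ennreal (exp (- s * Y g)) \<partial>?G)"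
    by (intro nn_integral_cong) simp
  also have "\<dots> = ennreal ((1 / sqrt (1 - 2 * - s)) ^ m)"
    unfolding Y_def by (rule nn_integral_exp_gauss_rows[OF u s(3)])
  also have "ennreal (exp (s * (real m * (1 - t)))) * \<dots>
      = ennreal (exp ((s * (1 - t)) * real m) * (1 / sqrt (1 - 2 * - s)) ^ m)"
    using s by (simp add: ennreal_mult algebra_simps)
  also have "\<dots> \<le> ennreal (exp (- t\<^sup>2 * real m / 16))"
    using chi_square_factor_le(2)[of t] t s by (intro ennreal_leI pw) (auto simp: s_def)
  finally have lo: "measure ?G {g \<in> space ?G. Y g \<le> real m * (1 - t)} \<le> exp (- t\<^sup>2 * real m / 16)"
    by (simp add: emeasure_eq_measure)
  have "measure ?G {g \<in> space ?G. t * real m \<le> \<bar>Y g - real m\<bar>}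
      \<le> measure ?G ({g \<in> space ?G. real m * (1 + t) \<le> Y g} \<union> {g \<in> space ?G. Y g \<le> real m * (1 - t)})"
    by (rule finite_measure_mono) (auto simp: abs_if algebra_simps split: if_splits)
  also have "\<dots> \<le> measure ?G {g \<in> space ?G. real m * (1 + t) \<le> Y g} + measure ?G {g \<in> space ?G. Y g \<le> real m * (1 - t)}"
    by (rule measure_Un_le) auto
  finally show ?thesis using up lo by (simp add: Y_def)
qed

subsection \<open>A lattice net of the unit ball\<close>

text \<open>Rounding a point of the unit ball of dimension \<open>r\<close> towards \<open>0\<close> on the grid of width
  \<open>1 / (4 * sqrt r)\<close> gives an integer vector with \<open>(\<Sum>i<r. \<bar>z i\<bar>) \<le> (\<Sum>i<r. (z i)\<^sup>2) \<le> 16 * r\<close>.\<close>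

definition small_int_vectors :: "nat \<Rightarrow> (nat \<Rightarrow> int) set" where
  "small_int_vectors r =
    {z \<in> PiE {..<r} (\<lambda>_. {- int (16 * r)..int (16 * r)}). (\<Sum>i<r. \<bar>z i\<bar>) \<le> int (16 * r)}"

text \<open>Its points may leave the unit ball: integer vectors are selected by their 1-norm, which
  makes the count factorize, and the surplus points only enter the union bound.\<close>

definition lattice_net :: "nat \<Rightarrow> real vec set" where
  "lattice_net r = (\<lambda>z. vec r (\<lambda>i. real_of_int (z i) / (4 * sqrt (real r)))) ` small_int_vectors r"

text \<open>A truncated two-sided geometric series of total 3, the source of the 3 in the size of
  the net.\<close>

lemma sum_half_power_abs:
  "(\<Sum>k = - int n..int n. (1 / 2) ^ nat \<bar>k\<bar>) = 3 - 2 * (1 / 2 :: real) ^ n"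
proof (induction n)
  case (Suc n)
  let ?f = "\<lambda>k. (1 / 2 :: real) ^ nat \<bar>k\<bar>"
  have "{- int (Suc n)..int (Suc n)} = insert (int (Suc n)) (insert (- int (Suc n)) {- int n..int n})"
    by auto
  then have "sum ?f {- int (Suc n)..int (Suc n)}
      = ?f (int (Suc n)) + (?f (- int (Suc n)) + sum ?f {- int n..int n})"
    by (simp only:) (subst sum.insert; (subst sum.insert)?; auto)
  also have "\<dots> = 3 - 2 * (1 / 2) ^ Suc n"
    unfolding Suc.IH abs_minus_cancel abs_of_nat nat_int by (simp only: power_Suc)
  finally show ?case .
qed simp

lemma finite_small_int_vectors: "finite (small_int_vectors r)"
proof (rule finite_subset)
  show "small_int_vectors r \<subseteq> PiE {..<r} (\<lambda>_. {- int (16 * r)..int (16 * r)})"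
    unfolding small_int_vectors_def by blast
qed (intro finite_PiE finite_lessThan finite_atLeastAtMost_int)

text \<open>Every vector counted has weight \<open>(1/2) ^ (\<Sum>i<r. \<bar>z i\<bar>)\<close> at least \<open>(1/2) ^ (16 * r)\<close>, and the
  total weight of all integer vectors factorizes over the coordinates.\<close>

lemma card_small_int_vectors_le: "real (card (small_int_vectors r)) \<le> (3 * 2 ^ 16) ^ r"
proof -
  let ?B = "PiE {..<r} (\<lambda>_. {- int (16 * r)..int (16 * r)})"
  define w where "w z = (\<Prod>i<r. (1 / 2 :: real) ^ nat \<bar>z i\<bar>)" for z :: "nat \<Rightarrow> int"
  have fin: "finite ?B" by (intro finite_PiE) auto
  have w: "1 \<le> 2 ^ (16 * r) * w z" if "z \<in> small_int_vectors r" for z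
  proof -
    have "int (\<Sum>i<r. nat \<bar>z i\<bar>) \<le> int (16 * r)" using that by (simp add: small_int_vectors_def)
    then have "(\<Sum>i<r. nat \<bar>z i\<bar>) \<le> 16 * r" by linarith
    then have "(1 / 2 :: real) ^ (16 * r) \<le> (1 / 2) ^ (\<Sum>i<r. nat \<bar>z i\<bar>)"
      by (intro power_decreasing) auto
    then have "2 ^ (16 * r) * (1 / 2 :: real) ^ (16 * r) \<le> 2 ^ (16 * r) * w z"
      unfolding w_def power_sum by (rule mult_left_mono) simp
    moreover have "2 ^ (16 * r) * (1 / 2 :: real) ^ (16 * r) = 1"
      unfolding power_mult_distrib[symmetric] by simp
    ultimately show ?thesis by linarith
  qed
  have "real (card (small_int_vectors r)) \<le> (\<Sum>z\<in>small_int_vectors r. 2 ^ (16 * r) * w z)"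
    using sum_mono[of "small_int_vectors r" "\<lambda>_. 1 :: real", OF w] by simp
  also have "\<dots> \<le> (\<Sum>z\<in>?B. 2 ^ (16 * r) * w z)"
  proof (rule sum_mono2[OF fin])
    show "small_int_vectors r \<subseteq> ?B" unfolding small_int_vectors_def by blast
  qed (simp add: w_def prod_nonneg)
  also have "\<dots> = 2 ^ (16 * r) * (\<Prod>i<r. \<Sum>k = - int (16 * r)..int (16 * r). (1 / 2) ^ nat \<bar>k\<bar>)"
    unfolding w_def by (subst prod_sum_PiE) (auto simp: sum_distrib_left)
  also have "\<dots> \<le> 2 ^ (16 * r) * (\<Prod>i<r. 3)"
    unfolding sum_half_power_abs
  proof (intro mult_left_mono prod_mono conjI)
    have "0 \<le> (1 / 2 :: real) ^ (16 * r)" "(1 / 2 :: real) ^ (16 * r) \<le> 1"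
      by (auto intro: power_le_one)
    then show "0 \<le> 3 - 2 * (1 / 2 :: real) ^ (16 * r)" "3 - 2 * (1 / 2 :: real) ^ (16 * r) \<le> 3"
      by linarith+
  qed simp
  also have "\<dots> = (3 * 2 ^ 16) ^ r"
    unfolding power_mult power_mult_distrib prod_constant by simp
  finally show ?thesis .
qed

lemma lattice_net_props:
  shows "finite (lattice_net r)" and "lattice_net r \<subseteq> carrier_vec r"
    and "real (card (lattice_net r)) \<le> (3 * 2 ^ 16) ^ r"
proof -
  have "card (lattice_net r) \<le> card (small_int_vectors r)"
    unfolding lattice_net_def by (rule card_image_le[OF finite_small_int_vectors])
  then show "real (card (lattice_net r)) \<le> (3 * 2 ^ 16) ^ r"
    using card_small_int_vectors_le[of r] by linarith
qed (auto simp: lattice_net_def finite_small_int_vectors)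

text \<open>Floor for nonnegative and ceiling for negative numbers: coordinates do not grow in
  absolute value, so a rounded point of the unit ball stays in it.\<close>

lemma ex_int_round_towards_0:
  fixes x :: real
  shows "\<exists>k. \<bar>real_of_int k\<bar> \<le> \<bar>x\<bar> \<and> \<bar>x - real_of_int k\<bar> \<le> 1"
proof (cases "0 \<le> x")
  case True
  then have "0 \<le> real_of_int \<lfloor>x\<rfloor>" "real_of_int \<lfloor>x\<rfloor> \<le> x" "x \<le> real_of_int \<lfloor>x\<rfloor> + 1"
    by (simp, linarith+)
  then have "\<bar>real_of_int \<lfloor>x\<rfloor>\<bar> \<le> \<bar>x\<bar> \<and> \<bar>x - real_of_int \<lfloor>x\<rfloor>\<bar> \<le> 1" by arith
  then show ?thesis ..
next
  case False
  then have "real_of_int \<lceil>x\<rceil> \<le> 0" "x \<le> real_of_int \<lceil>x\<rceil>" "real_of_int \<lceil>x\<rceil> \<le> x + 1"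
    by (simp, linarith+)
  then have "\<bar>real_of_int \<lceil>x\<rceil>\<bar> \<le> \<bar>x\<bar> \<and> \<bar>x - real_of_int \<lceil>x\<rceil>\<bar> \<le> 1" by arith
  then show ?thesis ..
qed

lemma lattice_net_dense:
  assumes r: "0 < r" and c: "c \<in> carrier_vec r" and c1: "norm2 c \<le> 1"
  obtains c' where "c' \<in> lattice_net r" "norm2 c' \<le> 1" "norm2 (c - c') \<le> 1 / 4"
proof -
  \<comment> \<open>Every coordinate moves by at most 1 / q, so the squared distance is at most r /
    q^2 = 1 / 16.\<close>
  define q where "q = 4 * sqrt (real r)"
  have q: "0 < q" "q\<^sup>2 = 16 * real r" using r by (auto simp: q_def power_mult_distrib)
  obtain z where z: "\<And>i. \<bar>real_of_int (z i)\<bar> \<le> \<bar>q * c $ i\<bar>" "\<And>i. \<bar>q * c $ i - real_of_int (z i)\<bar> \<le> 1"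
    using choice[of "\<lambda>i k. \<bar>real_of_int k\<bar> \<le> \<bar>q * c $ i\<bar> \<and> \<bar>q * c $ i - real_of_int k\<bar> \<le> 1"]
      ex_int_round_towards_0 by auto
  \<comment> \<open>Membership in \<open>PiE\<close> requires the default value outside the index
    set.\<close>
  define z' where "z' = restrict z {..<r}"
  define c' where "c' = vec r (\<lambda>i. real_of_int (z' i) / q)"
  have c': "c' \<in> carrier_vec r" by (simp add: c'_def)
  note sq = norm2_power2_eq_sum
  have "(\<Sum>i<r. (c $ i)\<^sup>2) \<le> 1" using power_le_one[OF norm2_nonneg c1, of 2] by (simp add: sq[OF c])
  then have sum_c: "(\<Sum>i<r. (q * c $ i)\<^sup>2) \<le> 16 * real r"
    using r by (simp add: power_mult_distrib q(2) mult_le_cancel_left1 flip: sum_distrib_left)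
  have zi2: "(real_of_int (z i))\<^sup>2 \<le> (q * c $ i)\<^sup>2" for i using z(1)[of i] by (simp add: abs_le_square_iff)
  have "(\<Sum>i<r. real_of_int \<bar>z i\<bar>) \<le> (\<Sum>i<r. (real_of_int (z i))\<^sup>2)"
  proof (rule sum_mono)
    fix i
    have "\<bar>z i\<bar> \<le> \<bar>z i\<bar> * \<bar>z i\<bar>"
    proof (cases "z i = 0")
      case False
      then have "1 * \<bar>z i\<bar> \<le> \<bar>z i\<bar> * \<bar>z i\<bar>" by (intro mult_right_mono) auto
      then show ?thesis by (simp only: mult_1)
    qed simp
    then have "real_of_int \<bar>z i\<bar> \<le> real_of_int (\<bar>z i\<bar> * \<bar>z i\<bar>)" by (simp only: of_int_le_iff)
    then show "real_of_int \<bar>z i\<bar> \<le> (real_of_int (z i))\<^sup>2" by (simp add: power2_eq_square)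
  qed
  also have "\<dots> \<le> 16 * real r" by (rule order_trans[OF sum_mono[OF zi2] sum_c])
  finally have "real_of_int (\<Sum>i<r. \<bar>z i\<bar>) \<le> real_of_int (int (16 * r))" by simp
  then have sumz: "(\<Sum>i<r. \<bar>z i\<bar>) \<le> int (16 * r)" by (simp only: of_int_le_iff)
  have "\<bar>z i\<bar> \<le> int (16 * r)" if "i < r" for i
  proof -
    have "\<bar>z i\<bar> \<le> (\<Sum>i<r. \<bar>z i\<bar>)" by (rule member_le_sum) (use that in auto)
    then show ?thesis using sumz by linarith
  qed
  then have "z' \<in> small_int_vectors r"
    using sumz unfolding small_int_vectors_def z'_def by (auto simp: abs_le_iff minus_le_iff)
  then have net: "c' \<in> lattice_net r" unfolding lattice_net_def c'_def q_def by (rule imageI)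
  have "(norm2 c')\<^sup>2 = (\<Sum>i<r. (real_of_int (z i))\<^sup>2) / q\<^sup>2"
    unfolding sq[OF c'] sum_divide_distrib by (intro sum.cong) (auto simp: c'_def z'_def power_divide)
  also have "\<dots> \<le> 1" using \<open>(\<Sum>i<r. (real_of_int (z i))\<^sup>2) \<le> 16 * real r\<close> r by (simp add: q(2))
  finally have n1: "norm2 c' \<le> 1" by (simp add: power2_le_imp_le[of _ 1])
  have cc: "c - c' \<in> carrier_vec r" using c c' by simp
  have "(norm2 (c - c'))\<^sup>2 = (\<Sum>i<r. (q * c $ i - real_of_int (z i))\<^sup>2 / q\<^sup>2)"
    unfolding sq[OF cc] using c q(1)
    by (intro sum.cong) (auto simp: c'_def z'_def power_divide[symmetric] diff_divide_distrib)
  also have "\<dots> \<le> (\<Sum>i<r. 1 / q\<^sup>2)"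
    using z(2) by (intro sum_mono divide_right_mono) (auto simp: abs_square_le_1)
  also have "\<dots> = (1 / 4)\<^sup>2" unfolding q(2) using r by (simp add: power2_eq_square)
  finally have "norm2 (c - c') \<le> 1 / 4" by (rule power2_le_imp_le) simp
  then show thesis using that net n1 by blast
qed

text \<open>A bootstrap on the supremum \<open>S\<close> of the distortion over the unit ball.
  Between \<open>v\<close> and a net point \<open>v'\<close> the error changes by its polar form at
  \<open>v - v'\<close> and \<open>v + v'\<close>, at most S * (1/4) * 2. Hence
  \<open>S \<le> \<tau> + S / 2\<close>, so \<open>S\<close> is at most twice the value on the
  net.\<close>

lemma distortion_of_net:
  assumes A: "A \<in> carrier_mat m r" and r: "0 < r" and \<tau>: "0 \<le> \<tau>"
    and net: "\<And>c. c \<in> lattice_net r \<Longrightarrow> \<bar>(norm2 (A *\<^sub>v c))\<^sup>2 - (norm2 c)\<^sup>2\<bar> \<le> \<tau> * (norm2 c)\<^sup>2"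
    and c: "c \<in> carrier_vec r"
  shows "\<bar>(norm2 (A *\<^sub>v c))\<^sup>2 - (norm2 c)\<^sup>2\<bar> \<le> 2 * \<tau> * (norm2 c)\<^sup>2"
proof -
  define f where "f c = \<bar>(norm2 (A *\<^sub>v c))\<^sup>2 - (norm2 c)\<^sup>2\<bar>" for c
  define ball where "ball = {c \<in> carrier_vec r. norm2 c \<le> 1}"
  define S where "S = Sup (f ` ball)"
  obtain K where K: "0 \<le> K" "\<And>v. v \<in> carrier_vec r \<Longrightarrow> norm2 (A *\<^sub>v v) \<le> K * norm2 v"
    using norm2_mult_mat_vec_le[OF A] by blast
  have ne: "f ` ball \<noteq> {}" using zero_carrier_vec by (auto simp: ball_def intro!: exI[of _ "0\<^sub>v r"])
  \<comment> \<open>Finiteness of \<open>S\<close> has to be known beforehand: otherwise half of it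
    could not be subtracted.\<close>
  have bdd: "bdd_above (f ` ball)"
  proof (rule bdd_aboveI)
    fix x assume "x \<in> f ` ball"
    then obtain v where v: "v \<in> carrier_vec r" "norm2 v \<le> 1" "x = f v" by (auto simp: ball_def)
    have "norm2 (A *\<^sub>v v) \<le> K * 1" using K(2)[OF v(1)] mult_left_mono[OF v(2) K(1)] by linarith
    then have "(norm2 (A *\<^sub>v v))\<^sup>2 \<le> K\<^sup>2" by (intro power_mono) auto
    moreover have "(norm2 v)\<^sup>2 \<le> 1" using v(2) by (simp add: power_le_one)
    ultimately show "x \<le> K\<^sup>2 + 1" unfolding v(3) f_def
      using zero_le_power2[of "norm2 (A *\<^sub>v v)"] zero_le_power2[of "norm2 v"] zero_le_power2[of K] by linarith
  qed
  have fS: "f v \<le> S" if "v \<in> carrier_vec r" "norm2 v \<le> 1" for v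
    unfolding S_def using that by (intro cSup_upper bdd) (auto simp: ball_def)
  have "0 \<le> f (0\<^sub>v r)" by (simp add: f_def)
  also have "\<dots> \<le> S" by (rule fS) auto
  finally have S0: "0 \<le> S" .
  \<comment> \<open>Homogeneity extends the bound from the ball to all vectors, as polarization
    tests vectors of arbitrary length.\<close>
  have fSc: "f v \<le> S * (norm2 v)\<^sup>2" if v: "v \<in> carrier_vec r" for v
  proof (cases "norm2 v = 0")
    case True
    then have "norm2 (A *\<^sub>v v) = 0" using K(2)[OF v] norm2_nonneg[of "A *\<^sub>v v"] by simp
    then show ?thesis using True by (simp add: f_def)
  next
    case False
    then have p: "0 < norm2 v" using norm2_nonneg[of v] by linarith
    define v1 where "v1 = (1 / norm2 v) \<cdot>\<^sub>v v"
    have v1: "v1 \<in> carrier_vec r" "norm2 v1 = 1" using v p by (auto simp: v1_def)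
    have "norm2 (A *\<^sub>v v) = norm2 v * norm2 (A *\<^sub>v v1)"
      using A v p by (simp add: v1_def mult_mat_vec)
    then have "(norm2 (A *\<^sub>v v))\<^sup>2 - (norm2 v)\<^sup>2 = (norm2 v)\<^sup>2 * ((norm2 (A *\<^sub>v v1))\<^sup>2 - (norm2 v1)\<^sup>2)"
      using v1(2) by (simp add: power_mult_distrib right_diff_distrib)
    then have "f v = (norm2 v)\<^sup>2 * f v1" by (simp add: f_def abs_mult)
    also have "\<dots> \<le> (norm2 v)\<^sup>2 * S" using fS[OF v1(1)] v1(2) by (intro mult_left_mono) auto
    finally show ?thesis by (simp add: mult.commute)
  qed
  have "f v \<le> \<tau> + S / 2" if v: "v \<in> carrier_vec r" "norm2 v \<le> 1" for v
  proof -
    obtain v' where v': "v' \<in> lattice_net r" "norm2 v' \<le> 1" "norm2 (v - v') \<le> 1 / 4"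
      using lattice_net_dense[OF r v] by blast
    have v'c: "v' \<in> carrier_vec r" using v'(1) lattice_net_props(2) by blast
    define a b where "a = v - v'" and "b = v + v'"
    have ab: "a \<in> carrier_vec r" "b \<in> carrier_vec r" using v v'c by (auto simp: a_def b_def)
    \<comment> \<open>Polarization against the identity matrix, with the supremum \<open>S\<close>
      itself as the distortion.\<close>
    have "\<bar>(A *\<^sub>v a) \<bullet> (A *\<^sub>v b) - (1\<^sub>m r *\<^sub>v a) \<bullet> (1\<^sub>m r *\<^sub>v b)\<bar> \<le> S * norm2 (1\<^sub>m r *\<^sub>v a) * norm2 (1\<^sub>m r *\<^sub>v b)"
      by (rule abs_scalar_prod_distortion_le[OF A _ S0 _ ab]) (use fSc in \<open>auto simp: f_def\<close>)
    then have B: "\<bar>(A *\<^sub>v a) \<bullet> (A *\<^sub>v b) - a \<bullet> b\<bar> \<le> S * norm2 a * norm2 b" using ab by simp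
    have diff: "(x - x') \<bullet> (x + x') = (norm2 x)\<^sup>2 - (norm2 x')\<^sup>2"
      if "x \<in> carrier_vec k" "x' \<in> carrier_vec k" for x x' :: "real vec" and k
      using that by (simp add: minus_scalar_prod_distrib[of _ k] scalar_prod_add_distrib[of _ k]
          norm2_power2 comm_scalar_prod[of x' k x])
    have "(A *\<^sub>v a) \<bullet> (A *\<^sub>v b) = (norm2 (A *\<^sub>v v))\<^sup>2 - (norm2 (A *\<^sub>v v'))\<^sup>2"
      unfolding a_def b_def using A v v'c
      by (simp add: mult_minus_distrib_mat_vec[of _ m r] mult_add_distrib_mat_vec[of _ m r] diff[of _ m])
    moreover have "a \<bullet> b = (norm2 v)\<^sup>2 - (norm2 v')\<^sup>2" unfolding a_def b_def using v v'c by (simp add: diff)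
    moreover have "norm2 a * norm2 b \<le> 1 / 4 * 2"
      using v' v norm2_triangle[OF v(1) v'c] by (intro mult_mono) (auto simp: a_def b_def)
    then have "S * (norm2 a * norm2 b) \<le> S * (1 / 4 * 2)" using S0 by (intro mult_left_mono)
    ultimately have "f v \<le> f v' + S / 2" using B unfolding f_def by (simp add: mult.assoc)
    moreover have "f v' \<le> \<tau>"
    proof -
      have "\<tau> * (norm2 v')\<^sup>2 \<le> \<tau> * 1" using v'(2) \<tau> by (intro mult_left_mono) (auto simp: power_le_one)
      then show ?thesis using net[OF v'(1)] by (simp add: f_def)
    qed
    ultimately show ?thesis by simp
  qed
  then have "S \<le> \<tau> + S / 2" unfolding S_def by (intro cSup_least ne) (auto simp: ball_def S_def)
  then have "S * (norm2 c)\<^sup>2 \<le> 2 * \<tau> * (norm2 c)\<^sup>2" by (intro mult_right_mono) auto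
  then show ?thesis using fSc[OF c] by (simp add: f_def)
qed

subsection \<open>The Gaussian embedding\<close>

lemma mat_borel_entry_measurable:
  assumes "i < m" "j < n"
  shows "(\<lambda>P. P $$ (i, j)) \<in> borel_measurable (mat_borel m n)"
proof -
  let ?I = "{..<m} \<times> {..<n}"
  have "(\<lambda>A. \<lambda>ij\<in>?I. A $$ ij) \<in> measurable (mat_borel m n) (Pi\<^sub>M ?I (\<lambda>_. borel :: real measure))"
    unfolding mat_borel_def by (intro measurable_vimage_algebra1) (auto simp: space_PiM)
  then have "(\<lambda>A. (\<lambda>ij\<in>?I. A $$ ij) (i, j)) \<in> borel_measurable (mat_borel m n)"
    by (rule measurable_compose) (use assms in \<open>auto intro: measurable_component_singleton\<close>)
  then show ?thesis using assms by simp
qed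

lemma space_mat_borel: "space (mat_borel m n) = carrier_mat m n"
  by (simp add: mat_borel_def)

lemma gauss_matrix_measurable:
  "(\<lambda>g. Matrix.mat m n (\<lambda>ij. g ij / sqrt (real m))) \<in> measurable (gauss_entries m n) (mat_borel m n)"
proof -
  have [measurable]: "(\<lambda>g. g ij / sqrt (real m)) \<in> borel_measurable (gauss_entries m n)"
    if "ij \<in> {..<m} \<times> {..<n}" for ij
    using that by (cases ij) auto
  have "(\<lambda>g. \<lambda>ij\<in>{..<m} \<times> {..<n}. Matrix.mat m n (\<lambda>ij. g ij / sqrt (real m)) $$ ij)
      = (\<lambda>g. \<lambda>ij\<in>{..<m} \<times> {..<n}. g ij / sqrt (real m))"
    by (auto simp: fun_eq_iff restrict_def)
  then show ?thesis
    unfolding mat_borel_def by (intro measurable_vimage_algebra2) auto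
qed

lemma norm2_mult_mat_vec_power2:
  assumes "P \<in> carrier_mat m n" "x \<in> carrier_vec n"
  shows "(norm2 (P *\<^sub>v x))\<^sup>2 = (\<Sum>i<m. (\<Sum>j<n. x $ j * P $$ (i, j))\<^sup>2)"
proof -
  have "(norm2 (P *\<^sub>v x))\<^sup>2 = (\<Sum>i<m. ((P *\<^sub>v x) $ i)\<^sup>2)"
    using assms by (intro norm2_power2_eq_sum) auto
  moreover have "(P *\<^sub>v x) $ i = (\<Sum>j<n. x $ j * P $$ (i, j))" if "i < m" for i
    using that assms by (auto simp: scalar_prod_def lessThan_atLeast0 mult.commute intro!: sum.cong)
  ultimately show ?thesis by simp
qed

text \<open>For \<open>c\<close> in the net, \<open>U c\<close> divided by its length is a unit
  vector, to which the tail bound applies; the size of the net is exponential in the rank, which the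
  exponent in \<open>m\<close> outweighs.\<close>

lemma gaussian_embedding_distortion_pos_rank:
  assumes X: "X \<in> carrier_mat n d" and m: "0 < m" and \<epsilon>: "0 < \<epsilon>" "\<epsilon> \<le> 1" and \<delta>: "0 < \<delta>" "\<delta> < 1"
    and size: "64 * ln (6 * 2 ^ 16) * (real (vec_space.rank n X) + ln (1 / \<delta>)) / \<epsilon>\<^sup>2 \<le> real m"
    and rank: "0 < vec_space.rank n X"
  shows "holds_with_prob_ge (gaussian_embedding m n) (1 - \<delta>)
    (\<lambda>P. P \<in> carrier_mat m n \<and> sketch_distortion (P * X) X \<epsilon>)"
proof -
  define r where "r = vec_space.rank n X"
  have r: "0 < r" using rank by (simp add: r_def)
  obtain U where U: "U \<in> carrier_mat n r" "transpose_mat U * U = 1\<^sub>m r"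
    and range: "\<And>b. b \<in> carrier_vec d \<Longrightarrow> \<exists>c\<in>carrier_vec r. X *\<^sub>v b = U *\<^sub>v c"
    using ex_orthonormal_column_basis[OF X] unfolding r_def by blast
  let ?G = "gauss_entries m n"
  interpret prob_space ?G by (rule prob_space_gauss_entries)
  \<comment> \<open>Half of the target, since passing from the net to all vectors doubles the
    distortion.\<close>
  define t where "t = \<epsilon> / 2"
  have t: "0 < t" "t \<le> 1" using \<epsilon> by (auto simp: t_def)
  \<comment> \<open>The zero vector cannot be normalized; for it the required bound is
    trivial.\<close>
  define T where "T = lattice_net r - {0\<^sub>v r}"
  have T: "finite T" and Tc: "\<And>c. c \<in> T \<Longrightarrow> c \<in> carrier_vec r" and cardT: "real (card T) \<le> (3 * 2 ^ 16) ^ r"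
  proof -
    show "finite T" and "\<And>c. c \<in> T \<Longrightarrow> c \<in> carrier_vec r"
      using lattice_net_props(1,2)[of r] by (auto simp: T_def)
    have "card T \<le> card (lattice_net r)"
      unfolding T_def by (intro card_mono lattice_net_props) auto
    then show "real (card T) \<le> (3 * 2 ^ 16) ^ r" using lattice_net_props(3)[of r] by linarith
  qed
  define \<phi> where "\<phi> g = Matrix.mat m n (\<lambda>ij. g ij / sqrt (real m))" for g :: "nat \<times> nat \<Rightarrow> real"
  have \<phi>c: "\<phi> g \<in> carrier_mat m n" for g by (simp add: \<phi>_def)
  have \<phi>m: "\<phi> \<in> measurable ?G (mat_borel m n)"
    using gauss_matrix_measurable unfolding \<phi>_def[abs_def] .
  define bad where "bad c = {g \<in> space ?G. t * real m \<le>
      \<bar>(\<Sum>i<m. (\<Sum>j<n. (U *\<^sub>v c) $ j / norm2 c * g (i, j))\<^sup>2) - real m\<bar>}" for c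
  have badm: "bad c \<in> sets ?G" for c unfolding bad_def by measurable
  have Uc: "U *\<^sub>v c \<in> carrier_vec n" "norm2 (U *\<^sub>v c) = norm2 c" "0 < norm2 c" if "c \<in> T" for c
  proof -
    show "U *\<^sub>v c \<in> carrier_vec n" using U(1) Tc[OF that] by simp
    show "norm2 (U *\<^sub>v c) = norm2 c" by (rule norm2_orthonormal[OF U Tc[OF that]])
    show "0 < norm2 c"
      using that norm2_eq_0_iff[OF Tc[OF that]] norm2_nonneg[of c] by (auto simp: T_def less_le)
  qed
  have badp: "prob (bad c) \<le> 2 * exp (- t\<^sup>2 * real m / 16)" if c: "c \<in> T" for c
  proof -
    have "(\<Sum>j<n. ((U *\<^sub>v c) $ j)\<^sup>2) = (norm2 c)\<^sup>2"
      unfolding Uc(2)[OF c, symmetric] norm2_power2_eq_sum[OF Uc(1)[OF c]] ..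
    then have "(\<Sum>j<n. ((U *\<^sub>v c) $ j / norm2 c)\<^sup>2) = 1"
      using Uc(3)[OF c] by (simp add: power_divide flip: sum_divide_distrib)
    then show ?thesis unfolding bad_def by (rule gauss_rows_tail[OF _ t])
  qed
  have "prob (\<Union>c\<in>T. bad c) \<le> (\<Sum>c\<in>T. prob (bad c))"
    by (rule finite_measure_subadditive_finite[OF T]) (use badm in auto)
  also have "\<dots> \<le> (\<Sum>c\<in>T. 2 * exp (- t\<^sup>2 * real m / 16))" by (rule sum_mono[OF badp])
  also have "\<dots> = real (card T) * (2 * exp (- t\<^sup>2 * real m / 16))" by simp
  also have "\<dots> \<le> (3 * 2 ^ 16) ^ r * (2 * exp (- t\<^sup>2 * real m / 16))"
    by (rule mult_right_mono[OF cardT]) simp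
  also have "\<dots> \<le> (6 * 2 ^ 16) ^ r * exp (- t\<^sup>2 * real m / 16)"
  proof -
    \<comment> \<open>The factor 2 for the two tails is absorbed into the net size as 2 ^ r, which
      needs a positive rank and turns 3 into 6.\<close>
    have "(3 * 2 ^ 16) ^ r * 2 \<le> (3 * 2 ^ 16) ^ r * (2 :: real) ^ r"
      using r by (intro mult_left_mono self_le_power) auto
    also have "\<dots> = (6 * 2 ^ 16) ^ r" unfolding power_mult_distrib[symmetric] by simp
    finally have "(3 * 2 ^ 16) ^ r * 2 * exp (- t\<^sup>2 * real m / 16) \<le> (6 * 2 ^ 16) ^ r * exp (- t\<^sup>2 * real m / 16)"
      by (rule mult_right_mono) simp
    then show ?thesis by (simp only: mult.assoc)
  qed
  also have "\<dots> = exp (real r * ln (6 * 2 ^ 16) - t\<^sup>2 * real m / 16)"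
  proof -
    have "real r * ln (6 * 2 ^ 16) - t\<^sup>2 * real m / 16 = real r * ln (6 * 2 ^ 16) + - t\<^sup>2 * real m / 16"
      by simp
    then show ?thesis by (simp only: exp_add exp_of_nat_mult) simp
  qed
  also have "\<dots> \<le> exp (- ln (1 / \<delta>))"
  proof -
    define l :: real where "l = ln (6 * 2 ^ 16)"
    \<comment> \<open>The size condition multiplies both the rank and the logarithm of 1 / delta by
      \<open>l\<close>. The first product pays for the net, and because \<open>l\<close> is at least
      1 the second still leaves the full logarithm. The 64 is 16 from the tail exponent times 4 from
      halving the distortion.\<close>
    have l: "1 \<le> l" unfolding l_def using exp_le by (subst ln_ge_iff) auto
    have ln\<delta>: "0 \<le> ln (1 / \<delta>)" using \<delta> by simp
    have "64 * (l * (real r + ln (1 / \<delta>))) \<le> real m * \<epsilon>\<^sup>2"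
      using size \<epsilon> unfolding r_def[symmetric] l_def[symmetric] by (simp add: pos_divide_le_eq mult.assoc)
    then have "l * (real r + ln (1 / \<delta>)) \<le> t\<^sup>2 * real m / 16"
      by (simp add: t_def power_divide mult.commute)
    moreover have "1 * ln (1 / \<delta>) \<le> l * ln (1 / \<delta>)" by (rule mult_right_mono[OF l ln\<delta>])
    ultimately show ?thesis unfolding l_def[symmetric] by (simp add: algebra_simps)
  qed
  also have "\<dots> = \<delta>" using \<delta> by (simp add: ln_div)
  finally have bad: "prob (\<Union>c\<in>T. bad c) \<le> \<delta>" .
  \<comment> \<open>Finitely many conditions on matrix entries, hence a measurable set, although the
    distortion property itself quantifies over all vectors.\<close>
  define E where "E = {P \<in> space (mat_borel m n). \<forall>c\<in>T.
      \<bar>(\<Sum>i<m. (\<Sum>j<n. (U *\<^sub>v c) $ j * P $$ (i, j))\<^sup>2) - (norm2 c)\<^sup>2\<bar> \<le> t * (norm2 c)\<^sup>2}"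
  have Em: "E \<in> sets (mat_borel m n)"
    unfolding E_def
  proof (intro sets.sets_Collect_finite_All T)
    fix c
    define F where "F P = \<bar>(\<Sum>i<m. (\<Sum>j<n. (U *\<^sub>v c) $ j * P $$ (i, j))\<^sup>2) - (norm2 c)\<^sup>2\<bar>" for P
    have [measurable]: "F \<in> borel_measurable (mat_borel m n)"
      unfolding F_def[abs_def]
      by (intro borel_measurable_abs borel_measurable_diff borel_measurable_const borel_measurable_sum
          borel_measurable_power borel_measurable_times mat_borel_entry_measurable) auto
    have "{P \<in> space (mat_borel m n). F P \<le> t * (norm2 c)\<^sup>2} \<in> sets (mat_borel m n)" by measurable
    then show "{P \<in> space (mat_borel m n). \<bar>(\<Sum>i<m. (\<Sum>j<n. (U *\<^sub>v c) $ j * P $$ (i, j))\<^sup>2) - (norm2 c)\<^sup>2\<bar>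
        \<le> t * (norm2 c)\<^sup>2} \<in> sets (mat_borel m n)"
      by (simp only: F_def)
  qed
  have EQ: "P \<in> carrier_mat m n \<and> sketch_distortion (P * X) X \<epsilon>" if "P \<in> E" for P
  proof
    show P: "P \<in> carrier_mat m n" using that by (simp add: E_def space_mat_borel)
    have PU: "P * U \<in> carrier_mat m r" using P U by simp
    have net: "\<bar>(norm2 ((P * U) *\<^sub>v c))\<^sup>2 - (norm2 c)\<^sup>2\<bar> \<le> t * (norm2 c)\<^sup>2" if c: "c \<in> lattice_net r" for c
    proof (cases "c \<in> T")
      case True
      have "(P * U) *\<^sub>v c = P *\<^sub>v (U *\<^sub>v c)" using P U(1) Tc[OF True] by (intro assoc_mult_mat_vec) auto
      then show ?thesis
        using \<open>P \<in> E\<close> True norm2_mult_mat_vec_power2[OF P Uc(1)[OF True]] by (simp add: E_def)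
    next
      case False
      then have "c = 0\<^sub>v r" using c by (simp add: T_def)
      moreover have "A *\<^sub>v 0\<^sub>v r = 0\<^sub>v m" if "A \<in> carrier_mat m r" for A :: "real mat"
        using that by (intro eq_vecI) auto
      from this[OF PU] have "norm2 ((P * U) *\<^sub>v 0\<^sub>v r) = 0" by (simp only: norm2_zero)
      ultimately show ?thesis by (simp only: norm2_zero) simp
    qed
    have dist: "\<bar>(norm2 ((P * U) *\<^sub>v c))\<^sup>2 - (norm2 c)\<^sup>2\<bar> \<le> \<epsilon> * (norm2 c)\<^sup>2" if "c \<in> carrier_vec r" for c
      using distortion_of_net[OF PU r less_imp_le[OF t(1)] net that] by (simp add: t_def)
    show "sketch_distortion (P * X) X \<epsilon>" by (rule sketch_distortion_of_basis[OF X P U range dist])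
  qed
  have sub: "space ?G - (\<Union>c\<in>T. bad c) \<subseteq> \<phi> -` E \<inter> space ?G"
  proof
    fix g assume g: "g \<in> space ?G - (\<Union>c\<in>T. bad c)"
    have "\<bar>(\<Sum>i<m. (\<Sum>j<n. (U *\<^sub>v c) $ j * \<phi> g $$ (i, j))\<^sup>2) - (norm2 c)\<^sup>2\<bar> \<le> t * (norm2 c)\<^sup>2"
      if c: "c \<in> T" for c
    proof -
      define Y where "Y = (\<Sum>i<m. (\<Sum>j<n. (U *\<^sub>v c) $ j / norm2 c * g (i, j))\<^sup>2)"
      define q where "q = (norm2 c)\<^sup>2 / real m"
      have q: "0 \<le> q" "q * real m = (norm2 c)\<^sup>2" using m by (auto simp: q_def)
      have row: "(\<Sum>j<n. (U *\<^sub>v c) $ j * \<phi> g $$ (i, j))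
          = norm2 c / sqrt (real m) * (\<Sum>j<n. (U *\<^sub>v c) $ j / norm2 c * g (i, j))" if "i < m" for i
        unfolding sum_distrib_left using that Uc(3)[OF c] by (intro sum.cong) (auto simp: \<phi>_def)
      have a2: "(norm2 c / sqrt (real m))\<^sup>2 = q" by (simp add: q_def power_divide)
      have "(\<Sum>i<m. (\<Sum>j<n. (U *\<^sub>v c) $ j * \<phi> g $$ (i, j))\<^sup>2) = q * Y"
        unfolding Y_def sum_distrib_left
      proof (rule sum.cong)
        fix i assume "i \<in> {..<m}"
        then have "i < m" by simp
        then show "(\<Sum>j<n. (U *\<^sub>v c) $ j * \<phi> g $$ (i, j))\<^sup>2
            = q * (\<Sum>j<n. (U *\<^sub>v c) $ j / norm2 c * g (i, j))\<^sup>2"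
          by (simp only: row power_mult_distrib a2)
      qed simp
      then have "\<bar>(\<Sum>i<m. (\<Sum>j<n. (U *\<^sub>v c) $ j * \<phi> g $$ (i, j))\<^sup>2) - (norm2 c)\<^sup>2\<bar>
          = q * \<bar>Y - real m\<bar>"
        using q(1) by (simp only: q(2)[symmetric] right_diff_distrib[symmetric] abs_mult abs_of_nonneg)
      also have "q * \<bar>Y - real m\<bar> \<le> q * (t * real m)"
        using g c q(1) by (intro mult_left_mono) (auto simp: bad_def Y_def)
      also have "q * (t * real m) = t * (norm2 c)\<^sup>2" by (simp only: mult.left_commute[of q t] q(2))
      finally show ?thesis .
    qed
    then show "g \<in> \<phi> -` E \<inter> space ?G" using g by (simp add: E_def space_mat_borel \<phi>c)
  qed
  have "1 - \<delta> \<le> 1 - prob (\<Union>c\<in>T. bad c)" using bad by simp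
  also have "\<dots> = prob (space ?G - (\<Union>c\<in>T. bad c))"
    using T badm by (intro prob_compl[symmetric]) auto
  also have "\<dots> \<le> prob (\<phi> -` E \<inter> space ?G)"
    using measurable_sets[OF \<phi>m Em] by (intro finite_measure_mono[OF sub])
  also have "\<dots> = measure (distr ?G (mat_borel m n) \<phi>) E"
    by (rule measure_distr[OF \<phi>m Em, symmetric])
  also have "distr ?G (mat_borel m n) \<phi> = gaussian_embedding m n"
    unfolding gaussian_embedding_def gauss_entries_def \<phi>_def[abs_def] ..
  finally have "1 - \<delta> \<le> measure (gaussian_embedding m n) E" .
  moreover have "E \<in> sets (gaussian_embedding m n)" using Em by (simp add: gaussian_embedding_def)
  ultimately show ?thesis unfolding holds_with_prob_ge_def using EQ by blast
qed

text \<open>In rank 0 the grid of width 1 / (4 sqrt r) degenerates, but then the column space is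
  trivial and every matrix has the property.\<close>

lemma gaussian_embedding_distortion:
  assumes X: "X \<in> carrier_mat n d" and m: "0 < m" and \<epsilon>: "0 < \<epsilon>" "\<epsilon> \<le> 1" and \<delta>: "0 < \<delta>" "\<delta> < 1"
    and size: "64 * ln (6 * 2 ^ 16) * (real (vec_space.rank n X) + ln (1 / \<delta>)) / \<epsilon>\<^sup>2 \<le> real m"
  shows "holds_with_prob_ge (gaussian_embedding m n) (1 - \<delta>)
    (\<lambda>P. P \<in> carrier_mat m n \<and> sketch_distortion (P * X) X \<epsilon>)"
proof (cases "vec_space.rank n X = 0")
  case True
  obtain U where U: "U \<in> carrier_mat n 0" "transpose_mat U * U = 1\<^sub>m 0"
    and range: "\<And>b. b \<in> carrier_vec d \<Longrightarrow> \<exists>c\<in>carrier_vec 0. X *\<^sub>v b = U *\<^sub>v c"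
    using ex_orthonormal_column_basis[OF X] unfolding True by blast
  have "prob_space (gaussian_embedding m n)"
    unfolding gaussian_embedding_def gauss_entries_def[symmetric]
    by (intro prob_space.prob_space_distr prob_space_gauss_entries gauss_matrix_measurable)
  then have "1 - \<delta> \<le> measure (gaussian_embedding m n) (space (gaussian_embedding m n))"
    using \<delta> by (simp add: prob_space.prob_space)
  moreover have "P \<in> carrier_mat m n \<and> sketch_distortion (P * X) X \<epsilon>"
    if "P \<in> space (gaussian_embedding m n)" for P
  proof
    show P: "P \<in> carrier_mat m n" using that by (simp add: gaussian_embedding_def space_mat_borel)
    have "\<bar>(norm2 ((P * U) *\<^sub>v c))\<^sup>2 - (norm2 c)\<^sup>2\<bar> \<le> \<epsilon> * (norm2 c)\<^sup>2" if c: "c \<in> carrier_vec 0" for c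
    proof -
      have zero: "A *\<^sub>v c = 0\<^sub>v m" if "A \<in> carrier_mat m 0" for A :: "real mat"
        using that c by (intro eq_vecI) (auto simp: scalar_prod_def)
      have "(P * U) *\<^sub>v c = 0\<^sub>v m" by (rule zero) (use P U in simp)
      moreover have "norm2 c = 0" using c by (simp add: norm2_eq_L2_set[of _ 0])
      ultimately show ?thesis by (simp only: norm2_zero) simp
    qed
    then show "sketch_distortion (P * X) X \<epsilon>"
      using sketch_distortion_of_basis[OF X P U range] by blast
  qed
  ultimately show ?thesis unfolding holds_with_prob_ge_def by blast
qed (use gaussian_embedding_distortion_pos_rank[OF X m \<epsilon> \<delta> size] in simp)

subsection \<open>The theorem\<close>

lemma sro_contracts_with_prob:
  assumes emb: "holds_with_prob_ge D p (\<lambda>P. P \<in> carrier_mat m n \<and> sketch_distortion (P * X) X \<epsilon>)"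
    and X: "X \<in> carrier_mat n d" and y: "y \<in> carrier_vec n" and d: "0 < d"
    and crit: "critical_point d (regularized_ls X y h) x"
    and reg: "convex_on_vec d h \<or>
      (\<exists>L. frechet_subdifferential_smooth d L h \<and> vec_space.rank n X = d \<and> L / (sigma_min X)\<^sup>2 \<le> \<kappa>)"
    and \<kappa>: "0 \<le> \<kappa>" and \<epsilon>: "0 \<le> \<epsilon>" "\<epsilon> < 1 - \<kappa>"
  shows "holds_with_prob_ge D p (\<lambda>P. \<forall>\<beta>. iterative_sro d X y h P N \<beta> \<longrightarrow>
    matrix_norm_of X (\<beta> N - x) \<le> (\<epsilon> / (1 - \<kappa> - \<epsilon>)) ^ N * matrix_norm_of X x)"
  using emb iterative_sro_converges[OF X _ y d crit reg \<kappa> \<epsilon>]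
  unfolding holds_with_prob_ge_def by meson

text \<open>Solves eps / (1 - kappa - eps) = rho for eps. Both sketch sizes grow like 1 / eps^2,
  which explains the factor (rho + 1)^2 / rho^2; the remaining 1 / (1 - kappa)^2 goes into the
  constant.\<close>

lemma distortion_for_contraction_factor:
  fixes \<kappa> \<rho> :: real
  assumes "0 \<le> \<kappa>" "\<kappa> < 1" "0 < \<rho>" "\<epsilon> = (1 - \<kappa>) * \<rho> / (\<rho> + 1)"
  shows "0 < \<epsilon>" "\<epsilon> < 1 - \<kappa>" "\<epsilon> / (1 - \<kappa> - \<epsilon>) = \<rho>" "1 / (1 - \<kappa>)\<^sup>2 * ((\<rho> + 1)\<^sup>2 / \<rho>\<^sup>2) = 1 / \<epsilon>\<^sup>2"
proof -
  have eq: "1 - \<kappa> - \<epsilon> = (1 - \<kappa>) / (\<rho> + 1)" using assms by (simp add: field_simps)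
  have "0 < 1 - \<kappa> - \<epsilon>" unfolding eq using assms by simp
  then show "\<epsilon> < 1 - \<kappa>" by simp
  show "\<epsilon> / (1 - \<kappa> - \<epsilon>) = \<rho>" unfolding eq using assms by simp
qed (use assms in \<open>auto simp: power_divide power_mult_distrib\<close>)

text \<open>\<open>\<kappa>\<close> keeps the ratio of the smoothness constant to the squared
  smallest singular value uniformly away from 1. The threshold for the distortion and both constants
  \<open>C\<close> then depend on \<open>\<kappa>\<close> alone, and the factor in the first claim
  on \<open>\<kappa>\<close> and the distortion, but none of them on dimensions, data,
  \<open>h\<close> or the failure probability.\<close>

theorem mainTheorem5:
  fixes \<kappa> :: real
  assumes "0 \<le> \<kappa>" and "\<kappa> < 1"
  shows
    "(\<exists>\<epsilon>\<^sub>0>0. \<epsilon>\<^sub>0 < 1 \<and> (\<forall>\<epsilon>. 0 < \<epsilon> \<and> \<epsilon> < \<epsilon>\<^sub>0 \<longrightarrow> (\<exists>\<rho>>0. \<rho> < 1 \<and>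
       (\<forall>n d m X y h \<delta> D \<beta>s N.
          0 < n \<and> 0 < d \<and> 0 < m \<and> 1 \<le> N \<and>
          X \<in> carrier_mat n d \<and> y \<in> carrier_vec n \<and>
          frechet_subdifferentiable d h \<and>
          0 < \<delta> \<and> \<delta> < 1 \<and>
          oblivious_l2_embedding m n d \<epsilon> \<delta> D \<and>
          critical_point d (regularized_ls X y h) \<beta>s \<and>
          (convex_on_vec d h \<or>
           (\<exists>L. frechet_subdifferential_smooth d L h \<and> vec_space.rank n X = d \<and>
                L / (sigma_min X)\<^sup>2 < 1 - \<epsilon> \<and> L / (sigma_min X)\<^sup>2 \<le> \<kappa>))
          \<longrightarrow>
          holds_with_prob_ge D (1 - \<delta>)
            (\<lambda>P. \<forall>\<beta>. iterative_sro d X y h P N \<beta> \<longrightarrow>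
                 matrix_norm_of X (\<beta> N - \<beta>s) \<le> \<rho> ^ N * matrix_norm_of X \<beta>s))))) \<and>
     (\<exists>C>0. \<forall>\<rho> n d m X y h \<delta> \<beta>s N.
          0 < \<rho> \<and> \<rho> < 1 \<and>
          0 < n \<and> 0 < d \<and> 0 < m \<and> 1 \<le> N \<and>
          X \<in> carrier_mat n d \<and> y \<in> carrier_vec n \<and>
          frechet_subdifferentiable d h \<and>
          0 < \<delta> \<and> \<delta> < 1 \<and>
          critical_point d (regularized_ls X y h) \<beta>s \<and>
          (convex_on_vec d h \<or>
           (\<exists>L. frechet_subdifferential_smooth d L h \<and> vec_space.rank n X = d \<and>
                L / (sigma_min X)\<^sup>2 \<le> \<kappa>)) \<and>
          C * ((real (vec_space.rank n X) + ln (1 / \<delta>)) * (\<rho> + 1)\<^sup>2 / \<rho>\<^sup>2) \<le> real m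
          \<longrightarrow>
          holds_with_prob_ge (gaussian_embedding m n) (1 - \<delta>)
            (\<lambda>P. \<forall>\<beta>. iterative_sro d X y h P N \<beta> \<longrightarrow>
                 matrix_norm_of X (\<beta> N - \<beta>s) \<le> \<rho> ^ N * matrix_norm_of X \<beta>s)) \<and>
     (\<exists>C>0. \<forall>\<rho> n d m X y h \<delta> \<beta>s N.
          0 < \<rho> \<and> \<rho> < 1 \<and>
          0 < n \<and> 0 < d \<and> 0 < m \<and> 1 \<le> N \<and>
          X \<in> carrier_mat n d \<and> y \<in> carrier_vec n \<and>
          frechet_subdifferentiable d h \<and>
          0 < \<delta> \<and> \<delta> < 1 \<and>
          critical_point d (regularized_ls X y h) \<beta>s \<and>
          (convex_on_vec d h \<or>
           (\<exists>L. frechet_subdifferential_smooth d L h \<and> vec_space.rank n X = d \<and>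
                L / (sigma_min X)\<^sup>2 \<le> \<kappa>)) \<and>
          C * ((real (vec_space.rank n X))\<^sup>2 / \<delta> * (\<rho> + 1)\<^sup>2 / \<rho>\<^sup>2) \<le> real m
          \<longrightarrow>
          holds_with_prob_ge (measure_pmf (sparse_embedding m n)) (1 - \<delta>)
            (\<lambda>P. \<forall>\<beta>. iterative_sro d X y h P N \<beta> \<longrightarrow>
                 matrix_norm_of X (\<beta> N - \<beta>s) \<le> \<rho> ^ N * matrix_norm_of X \<beta>s))"
proof (intro conjI)
  \<comment> \<open>Below this threshold the distortion is smaller than 1 - kappa - eps, that is,
    the contraction factor is smaller than 1.\<close>
  let ?\<epsilon>\<^sub>0 = "(1 - \<kappa>) / 2"
  show "\<exists>\<epsilon>\<^sub>0>0. \<epsilon>\<^sub>0 < 1 \<and> (\<forall>\<epsilon>. 0 < \<epsilon> \<and> \<epsilon> < \<epsilon>\<^sub>0 \<longrightarrow> (\<exists>\<rho>>0. \<rho> < 1 \<and>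
       (\<forall>n d m X y h \<delta> D \<beta>s N.
          0 < n \<and> 0 < d \<and> 0 < m \<and> 1 \<le> N \<and>
          X \<in> carrier_mat n d \<and> y \<in> carrier_vec n \<and>
          frechet_subdifferentiable d h \<and>
          0 < \<delta> \<and> \<delta> < 1 \<and>
          oblivious_l2_embedding m n d \<epsilon> \<delta> D \<and>
          critical_point d (regularized_ls X y h) \<beta>s \<and>
          (convex_on_vec d h \<or>
           (\<exists>L. frechet_subdifferential_smooth d L h \<and> vec_space.rank n X = d \<and>
                L / (sigma_min X)\<^sup>2 < 1 - \<epsilon> \<and> L / (sigma_min X)\<^sup>2 \<le> \<kappa>))
          \<longrightarrow>
          holds_with_prob_ge D (1 - \<delta>)
            (\<lambda>P. \<forall>\<beta>. iterative_sro d X y h P N \<beta> \<longrightarrow>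
                 matrix_norm_of X (\<beta> N - \<beta>s) \<le> \<rho> ^ N * matrix_norm_of X \<beta>s))))"
  proof (rule exI[of _ ?\<epsilon>\<^sub>0], intro conjI allI impI)
    fix \<epsilon> assume "0 < \<epsilon> \<and> \<epsilon> < ?\<epsilon>\<^sub>0"
    then have \<epsilon>: "0 < \<epsilon>" "\<epsilon> < 1 - \<kappa>" and lt: "\<epsilon> < 1 - \<kappa> - \<epsilon>" using assms by (auto simp: field_simps)
    show "\<exists>\<rho>>0. \<rho> < 1 \<and>
       (\<forall>n d m X y h \<delta> D \<beta>s N.
          0 < n \<and> 0 < d \<and> 0 < m \<and> 1 \<le> N \<and>
          X \<in> carrier_mat n d \<and> y \<in> carrier_vec n \<and>
          frechet_subdifferentiable d h \<and>
          0 < \<delta> \<and> \<delta> < 1 \<and>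
          oblivious_l2_embedding m n d \<epsilon> \<delta> D \<and>
          critical_point d (regularized_ls X y h) \<beta>s \<and>
          (convex_on_vec d h \<or>
           (\<exists>L. frechet_subdifferential_smooth d L h \<and> vec_space.rank n X = d \<and>
                L / (sigma_min X)\<^sup>2 < 1 - \<epsilon> \<and> L / (sigma_min X)\<^sup>2 \<le> \<kappa>))
          \<longrightarrow>
          holds_with_prob_ge D (1 - \<delta>)
            (\<lambda>P. \<forall>\<beta>. iterative_sro d X y h P N \<beta> \<longrightarrow>
                 matrix_norm_of X (\<beta> N - \<beta>s) \<le> \<rho> ^ N * matrix_norm_of X \<beta>s))"
    proof (rule exI[of _ "\<epsilon> / (1 - \<kappa> - \<epsilon>)"], intro conjI allI impI; (elim conjE)?)
      show "0 < \<epsilon> / (1 - \<kappa> - \<epsilon>)" "\<epsilon> / (1 - \<kappa> - \<epsilon>) < 1" using \<epsilon> lt by (auto simp: divide_less_eq)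
    next
      fix n d m X y h \<delta> D \<beta>s N
      assume X: "X \<in> carrier_mat n d" and y: "y \<in> carrier_vec n" and d: "0 < d"
        and emb: "oblivious_l2_embedding m n d \<epsilon> \<delta> D"
        and crit: "critical_point d (regularized_ls X y h) \<beta>s"
        and reg: "convex_on_vec d h \<or>
           (\<exists>L. frechet_subdifferential_smooth d L h \<and> vec_space.rank n X = d \<and>
                L / (sigma_min X)\<^sup>2 < 1 - \<epsilon> \<and> L / (sigma_min X)\<^sup>2 \<le> \<kappa>)"
      obtain E where E: "E \<in> sets D" "1 - \<delta> \<le> measure D E" and
        EQ: "\<And>P b. P \<in> E \<Longrightarrow> b \<in> carrier_vec d \<Longrightarrow>
             (1 - \<epsilon>) * (norm2 (X *\<^sub>v b))\<^sup>2 \<le> (norm2 ((P * X) *\<^sub>v b))\<^sup>2 \<and>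
             (norm2 ((P * X) *\<^sub>v b))\<^sup>2 \<le> (1 + \<epsilon>) * (norm2 (X *\<^sub>v b))\<^sup>2"
        using emb X unfolding oblivious_l2_embedding_def holds_with_prob_ge_def by blast
      have "P \<in> carrier_mat m n \<and> sketch_distortion (P * X) X \<epsilon>" if P: "P \<in> E" for P
      proof
        have "sets D = sets (mat_borel m n)" using emb by (simp add: oblivious_l2_embedding_def)
        then show "P \<in> carrier_mat m n"
          using sets.sets_into_space[of E "mat_borel m n"] E(1) P by (auto simp: space_mat_borel)
        show "sketch_distortion (P * X) X \<epsilon>"
          unfolding sketch_distortion_def
        proof
          fix b :: "real vec" assume "b \<in> carrier_vec (dim_col X)"
          then have "b \<in> carrier_vec d" using X by simp
          from EQ[OF P this]
          show "\<bar>(norm2 ((P * X) *\<^sub>v b))\<^sup>2 - (norm2 (X *\<^sub>v b))\<^sup>2\<bar> \<le> \<epsilon> * (norm2 (X *\<^sub>v b))\<^sup>2"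
            by (auto simp: abs_le_iff algebra_simps)
        qed
      qed
      then have "holds_with_prob_ge D (1 - \<delta>) (\<lambda>P. P \<in> carrier_mat m n \<and> sketch_distortion (P * X) X \<epsilon>)"
        using E unfolding holds_with_prob_ge_def by blast
      moreover have "convex_on_vec d h \<or>
           (\<exists>L. frechet_subdifferential_smooth d L h \<and> vec_space.rank n X = d \<and> L / (sigma_min X)\<^sup>2 \<le> \<kappa>)"
        using reg by blast
      ultimately show "holds_with_prob_ge D (1 - \<delta>)
            (\<lambda>P. \<forall>\<beta>. iterative_sro d X y h P N \<beta> \<longrightarrow>
                 matrix_norm_of X (\<beta> N - \<beta>s) \<le> (\<epsilon> / (1 - \<kappa> - \<epsilon>)) ^ N * matrix_norm_of X \<beta>s)"
        using sro_contracts_with_prob[OF _ X y d crit _ assms(1) less_imp_le[OF \<epsilon>(1)] \<epsilon>(2)] by blast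
    qed
  qed (use assms in auto)
next
  \<comment> \<open>The constant of the Gaussian size condition, divided by the squared gap that
    enters when the distortion is expressed through the contraction factor.\<close>
  let ?C = "64 * ln (6 * 2 ^ 16) / (1 - \<kappa>)\<^sup>2"
  show "\<exists>C>0. \<forall>\<rho> n d m X y h \<delta> \<beta>s N.
          0 < \<rho> \<and> \<rho> < 1 \<and>
          0 < n \<and> 0 < d \<and> 0 < m \<and> 1 \<le> N \<and>
          X \<in> carrier_mat n d \<and> y \<in> carrier_vec n \<and>
          frechet_subdifferentiable d h \<and>
          0 < \<delta> \<and> \<delta> < 1 \<and>
          critical_point d (regularized_ls X y h) \<beta>s \<and>
          (convex_on_vec d h \<or>
           (\<exists>L. frechet_subdifferential_smooth d L h \<and> vec_space.rank n X = d \<and>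
                L / (sigma_min X)\<^sup>2 \<le> \<kappa>)) \<and>
          C * ((real (vec_space.rank n X) + ln (1 / \<delta>)) * (\<rho> + 1)\<^sup>2 / \<rho>\<^sup>2) \<le> real m
          \<longrightarrow>
          holds_with_prob_ge (gaussian_embedding m n) (1 - \<delta>)
            (\<lambda>P. \<forall>\<beta>. iterative_sro d X y h P N \<beta> \<longrightarrow>
                 matrix_norm_of X (\<beta> N - \<beta>s) \<le> \<rho> ^ N * matrix_norm_of X \<beta>s)"
  proof (rule exI[of _ ?C], intro conjI allI impI; (elim conjE)?)
    show "0 < ?C" using assms by (intro divide_pos_pos mult_pos_pos ln_gt_zero) auto
  next
    fix \<rho> n d m X y h \<delta> \<beta>s N
    assume \<rho>: "0 < \<rho>" and X: "X \<in> carrier_mat n d" and y: "y \<in> carrier_vec n" and d: "0 < d"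
      and m: "0 < m" and \<delta>: "0 < \<delta>" "\<delta> < 1"
      and crit: "critical_point d (regularized_ls X y h) \<beta>s"
      and reg: "convex_on_vec d h \<or>
           (\<exists>L. frechet_subdifferential_smooth d L h \<and> vec_space.rank n X = d \<and>
                L / (sigma_min X)\<^sup>2 \<le> \<kappa>)"
      and size: "?C * ((real (vec_space.rank n X) + ln (1 / \<delta>)) * (\<rho> + 1)\<^sup>2 / \<rho>\<^sup>2) \<le> real m"
    define \<epsilon> where "\<epsilon> = (1 - \<kappa>) * \<rho> / (\<rho> + 1)"
    note \<epsilon> = distortion_for_contraction_factor[OF assms \<rho> \<epsilon>_def]
    have "?C * ((real (vec_space.rank n X) + ln (1 / \<delta>)) * (\<rho> + 1)\<^sup>2 / \<rho>\<^sup>2)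
        = 64 * ln (6 * 2 ^ 16) * (real (vec_space.rank n X) + ln (1 / \<delta>))
          * (1 / (1 - \<kappa>)\<^sup>2 * ((\<rho> + 1)\<^sup>2 / \<rho>\<^sup>2))" by simp
    then have size': "64 * ln (6 * 2 ^ 16) * (real (vec_space.rank n X) + ln (1 / \<delta>)) / \<epsilon>\<^sup>2 \<le> real m"
      using size unfolding \<epsilon>(4) by simp
    have "\<epsilon> \<le> 1" using \<epsilon>(2) assms by simp
    from sro_contracts_with_prob[OF gaussian_embedding_distortion[OF X m \<epsilon>(1) this \<delta> size']
        X y d crit reg assms(1) less_imp_le[OF \<epsilon>(1)] \<epsilon>(2)]
    show "holds_with_prob_ge (gaussian_embedding m n) (1 - \<delta>)
            (\<lambda>P. \<forall>\<beta>. iterative_sro d X y h P N \<beta> \<longrightarrow>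
                 matrix_norm_of X (\<beta> N - \<beta>s) \<le> \<rho> ^ N * matrix_norm_of X \<beta>s)"
      unfolding \<epsilon>(3) .
  qed
next
  \<comment> \<open>The 2 is the second-moment constant of the sparse sketch; the divisor again
    comes from expressing the distortion through the contraction factor.\<close>
  let ?C = "2 / (1 - \<kappa>)\<^sup>2"
  show "\<exists>C>0. \<forall>\<rho> n d m X y h \<delta> \<beta>s N.
          0 < \<rho> \<and> \<rho> < 1 \<and>
          0 < n \<and> 0 < d \<and> 0 < m \<and> 1 \<le> N \<and>
          X \<in> carrier_mat n d \<and> y \<in> carrier_vec n \<and>
          frechet_subdifferentiable d h \<and>
          0 < \<delta> \<and> \<delta> < 1 \<and>
          critical_point d (regularized_ls X y h) \<beta>s \<and>
          (convex_on_vec d h \<or>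
           (\<exists>L. frechet_subdifferential_smooth d L h \<and> vec_space.rank n X = d \<and>
                L / (sigma_min X)\<^sup>2 \<le> \<kappa>)) \<and>
          C * ((real (vec_space.rank n X))\<^sup>2 / \<delta> * (\<rho> + 1)\<^sup>2 / \<rho>\<^sup>2) \<le> real m
          \<longrightarrow>
          holds_with_prob_ge (measure_pmf (sparse_embedding m n)) (1 - \<delta>)
            (\<lambda>P. \<forall>\<beta>. iterative_sro d X y h P N \<beta> \<longrightarrow>
                 matrix_norm_of X (\<beta> N - \<beta>s) \<le> \<rho> ^ N * matrix_norm_of X \<beta>s)"
  proof (rule exI[of _ ?C], intro conjI allI impI; (elim conjE)?)
    show "0 < ?C" using assms by simp
  next
    fix \<rho> n d m X y h \<delta> \<beta>s N
    assume \<rho>: "0 < \<rho>" and X: "X \<in> carrier_mat n d" and y: "y \<in> carrier_vec n" and d: "0 < d"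
      and m: "0 < m" and \<delta>: "0 < \<delta>" "\<delta> < 1"
      and crit: "critical_point d (regularized_ls X y h) \<beta>s"
      and reg: "convex_on_vec d h \<or>
           (\<exists>L. frechet_subdifferential_smooth d L h \<and> vec_space.rank n X = d \<and>
                L / (sigma_min X)\<^sup>2 \<le> \<kappa>)"
      and size: "?C * ((real (vec_space.rank n X))\<^sup>2 / \<delta> * (\<rho> + 1)\<^sup>2 / \<rho>\<^sup>2) \<le> real m"
    define \<epsilon> where "\<epsilon> = (1 - \<kappa>) * \<rho> / (\<rho> + 1)"
    note \<epsilon> = distortion_for_contraction_factor[OF assms \<rho> \<epsilon>_def]
    have "?C * ((real (vec_space.rank n X))\<^sup>2 / \<delta> * (\<rho> + 1)\<^sup>2 / \<rho>\<^sup>2)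
        = 2 * (real (vec_space.rank n X))\<^sup>2 / \<delta> * (1 / (1 - \<kappa>)\<^sup>2 * ((\<rho> + 1)\<^sup>2 / \<rho>\<^sup>2))"
      by (simp add: ac_simps)
    then have size': "2 * (real (vec_space.rank n X))\<^sup>2 / (\<delta> * \<epsilon>\<^sup>2) \<le> real m"
      using size unfolding \<epsilon>(4) by simp
    from sro_contracts_with_prob[OF sparse_embedding_distortion[OF X m \<epsilon>(1) \<delta>(1) size']
        X y d crit reg assms(1) less_imp_le[OF \<epsilon>(1)] \<epsilon>(2)]
    show "holds_with_prob_ge (measure_pmf (sparse_embedding m n)) (1 - \<delta>)
            (\<lambda>P. \<forall>\<beta>. iterative_sro d X y h P N \<beta> \<longrightarrow>
                 matrix_norm_of X (\<beta> N - \<beta>s) \<le> \<rho> ^ N * matrix_norm_of X \<beta>s)"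
      unfolding \<epsilon>(3) .
  qed
qed

end
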